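(* Let $K\ge 2$ be an integer, $\varepsilon>0$, $\beta>\log K$ and $1\le p<\infty$. Let $X$ be a regular $K$-ary rooted tree with root $0$, equipped with the metric $d_X(x,y)=\int_{[x,y]}e^{-\varepsilon|z|}\,d|z|$ and the measure $d\mu(x)=e^{-\beta|x|}\,d|x|$. Suppose that $$\theta\ge 1-\frac{\beta-\log K}{p\varepsilon}\quad\text{and}\quad\theta>0.$$ Then there is a bounded linear extension operator $\operatorname{Ext}:B^\theta_{p,p}(\partial X)\to N^{1,p}(X)$ such that for every $u\in B^\theta_{p,p}(\partial X)$ we have $\operatorname{Tr}(\operatorname{Ext}u)=u$ $\nu$-a.e., where $\operatorname{Tr}f(\zeta)=\lim_{[0,\zeta)\ni x\to\zeta}f(x)$ is the limit along the geodesic ray $[0,\zeta)$ from $0$ to $\zeta\in\partial X$. Furthermore, for $\nu$-a.e. $\zeta\in\partial X$ and any geodesic $\gamma$ in $X$ terminating at $\zeta$, we have $\lim_{t\to\infty}\operatorname{Ext}u(\gamma(t))=u(\zeta)$. Moreover, there is a constant $C$, independent of $u$, such that with $\tilde u=\operatorname{Ext}u$, $$\|g_{\tilde u}\|_{L^p(X)}\le C\|u\|_{B^\theta_{p,p}(\partial X)},\qquad \|\tilde u\|_{N^{1,p}(X)}\le C\bigl(\|u\|_{L^p(\partial X)}+\|u\|_{B^\theta_{p,p}(\partial X)}\bigr)=C\|u\|_{\widetilde B^\theta_{p,p}(\partial X)}.$$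
   Context: A rooted tree is a connected graph without cycles with a distinguished vertex $0$ (the root). Each edge is regarded as an isometric copy of the unit interval, so that $X$ consists of vertices and edge points; $[x,y]$ is the geodesic between $x$ and $y$, $|x-y|$ is its (unweighted) length, $|x|=|x-0|$, and $d|z|$ is the measure giving each edge Lebesgue measure $1$. The neighbor of a vertex $x\neq 0$ closer to the root is its parent; all other neighbors are its children. A tree is regular $K$-ary if every vertex has exactly $K$ children. Upper gradients: a Borel function $g:X\to[0,\infty]$ is an upper gradient of $u:X\to\mathbb{R}$ if $|u(z)-u(y)|\le\int_{[z,y]}g\,d_Xs$ for all $z,y\in X$, where $d_Xs=e^{-\varepsilon|x|}\,d|x|$ is arc length with respect to $d_X$. The Newtonian space $N^{1,p}(X)$ consists of the functions $u$ on $X$ with $\|u\|_{N^{1,p}(X)}:=\bigl(\int_X|u|^p\,d\mu+\inf_g\int_X g^p\,d\mu\bigr)^{1/p}<\infty$, the infimum being over all upper gradients $g$ of $u$. Each $u\in N^{1,p}(X)$ has a minimal upper gradient $g_u\in L^p(X)$, unique up to measure zero, with $g_u\le g$ a.e. for every upper gradient $g\in L^p(X)$ of $u$. $L^p(X)$ is with respect to $\mu$. Boundary: $\partial X=\overline X\setminus X$, where $\overline X$ is the completion of $X$ with respect to $d_X$; its elements are identified with the infinite geodesics starting at $0$. For distinct $\zeta,\xi\in\partial X$ whose geodesics from $0$ share exactly their first $k$ edges, $d_X(\zeta,\xi)=\frac{2}{\varepsilon}e^{-\varepsilon k}$. $B(\zeta,t)$ is the open ball in $\partial X$. $\nu$ is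 the normalized $Q$-dimensional Hausdorff measure on $\partial X$ with $Q=(\log K)/\varepsilon$; it is the probability measure assigning mass $K^{-n}$ to the set of boundary points whose geodesic passes through a given vertex at distance $n$ from $0$. Besov spaces: for $\nu$-measurable $f:\partial X\to\mathbb{R}$ and $t>0$, $$E_p(f,t)=\Bigl(\int_{\partial X}\frac{1}{\nu(B(\zeta,t))}\int_{B(\zeta,t)}|f(\zeta)-f(\xi)|^p\,d\nu(\xi)\,d\nu(\zeta)\Bigr)^{1/p},$$ and for $\theta>0$, $\|f\|_{B^\theta_{p,p}(\partial X)}=\bigl(\int_0^\infty (E_p(f,t)/t^\theta)^p\,\frac{dt}{t}\bigr)^{1/p}$ (a seminorm). $B^\theta_{p,p}(\partial X)$ consists of all $f\in L^p(\partial X)=L^p(\partial X,\nu)$ with finite seminorm, normed by $\|f\|_{\widetilde B^\theta_{p,p}(\partial X)}=\|f\|_{L^p(\partial X)}+\|f\|_{B^\theta_{p,p}(\partial X)}$. *)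

theory Defs
  imports "HOL-Analysis.Analysis"
begin

section \<open>Rooted trees\<close>

record 'v rtree =
  verts :: "'v set"
  edges :: "'v set set"
  origin :: 'v

definition walk :: "'v rtree \<Rightarrow> 'v list \<Rightarrow> bool" where
  "walk T xs \<longleftrightarrow> xs \<noteq> [] \<and> set xs \<subseteq> verts T \<and> successively (\<lambda>x y. {x, y} \<in> edges T) xs"

definition cycle :: "'v rtree \<Rightarrow> 'v list \<Rightarrow> bool" where
  "cycle T xs \<longleftrightarrow> walk T xs \<and> distinct xs \<and> 3 \<le> length xs \<and> {last xs, hd xs} \<in> edges T"

definition rooted_tree :: "'v rtree \<Rightarrow> bool" where
  "rooted_tree T \<longleftrightarrow>
     edges T \<subseteq> {{x, y} | x y. x \<in> verts T \<and> y \<in> verts T \<and> x \<noteq> y} \<and>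
     origin T \<in> verts T \<and>
     (\<forall>x\<in>verts T. \<forall>y\<in>verts T. \<exists>xs. walk T xs \<and> hd xs = x \<and> last xs = y) \<and>
     (\<nexists>xs. cycle T xs)"

definition graph_dist :: "'v rtree \<Rightarrow> 'v \<Rightarrow> 'v \<Rightarrow> nat" where
  "graph_dist T x y = (LEAST n. \<exists>xs. walk T xs \<and> hd xs = x \<and> last xs = y \<and> length xs = Suc n)"

definition parent :: "'v rtree \<Rightarrow> 'v \<Rightarrow> 'v" where
  "parent T x =
     (THE y. {x, y} \<in> edges T \<and> graph_dist T (origin T) y < graph_dist T (origin T) x)"

definition children :: "'v rtree \<Rightarrow> 'v \<Rightarrow> 'v set" where
  "children T x = {y. {x, y} \<in> edges T \<and> \<not> (x \<noteq> origin T \<and> y = parent T x)}"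

definition regular_tree :: "nat \<Rightarrow> 'v rtree \<Rightarrow> bool" where
  "regular_tree K T \<longleftrightarrow>
     rooted_tree T \<and> (\<forall>x\<in>verts T. finite (children T x) \<and> card (children T x) = K)"


section \<open>The tree as a metric graph\<close>

text \<open>
  Every vertex other than the root is the lower end of exactly one edge. For such a vertex \<open>v\<close> and
  \<open>0 < s \<le> 1\<close>, the pair \<open>(v, s)\<close> is the point of the edge from \<open>parent T v\<close> to \<open>v\<close> at length \<open>s\<close>
  from \<open>parent T v\<close>. Thus \<open>(v, 1)\<close> is the vertex \<open>v\<close> itself, and the root, which has no
  parent edge, is represented by \<open>(origin T, 1)\<close> only.
\<close>

type_synonym 'v point = "'v \<times> real"

definition points :: "'v rtree \<Rightarrow> 'v point set" where
  "points T = {(v, s). v \<in> verts T \<and> 0 < s \<and> s \<le> 1 \<and> (v = origin T \<longrightarrow> s = 1)}"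

definition vertex_point :: "'v \<Rightarrow> 'v point" where
  "vertex_point v = (v, 1)"

text \<open>
  The vertices bounding the edge on which a point lies, with their distances to the point.
\<close>

definition edge_ends :: "'v rtree \<Rightarrow> 'v point \<Rightarrow> ('v \<times> real) set" where
  "edge_ends T x =
     insert (fst x, 1 - snd x) (if fst x = origin T then {} else {(parent T (fst x), snd x)})"

text \<open>The unweighted length distance \<open>|x - y|\<close>.\<close>

definition len_dist :: "'v rtree \<Rightarrow> 'v point \<Rightarrow> 'v point \<Rightarrow> real" where
  "len_dist T x y =
     (if fst x = fst y then \<bar>snd x - snd y\<bar>
      else Min ((\<lambda>((a, r), (b, s)). r + real (graph_dist T a b) + s) ` (edge_ends T x \<times> edge_ends T y)))"

definition height :: "'v rtree \<Rightarrow> 'v point \<Rightarrow> real" where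
  "height T x = len_dist T x (vertex_point (origin T))"

definition segment :: "'v rtree \<Rightarrow> 'v point \<Rightarrow> 'v point \<Rightarrow> 'v point set" where
  "segment T x y = {z \<in> points T. len_dist T x z + len_dist T z y = len_dist T x y}"

text \<open>
  Length measure in edge coordinates. It lives on \<open>points T\<close> without the root (a null set), and is
  used to write down \<open>d\<^sub>X\<close> before the Borel sets of \<open>d\<^sub>X\<close> are available; \<open>length_measure\<close> below
  is the same measure on these Borel sets.
\<close>

definition edge_measure :: "'v rtree \<Rightarrow> 'v point measure" where
  "edge_measure T = count_space (verts T - {origin T}) \<Otimes>\<^sub>M restrict_space lborel {0<..1}"

definition dX :: "'v rtree \<Rightarrow> real \<Rightarrow> 'v point \<Rightarrow> 'v point \<Rightarrow> real" where
  "dX T \<epsilon> x y = (LINT z:segment T x y|edge_measure T. exp (- \<epsilon> * height T z))"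

definition X_borel :: "'v rtree \<Rightarrow> real \<Rightarrow> 'v point measure" where
  "X_borel T \<epsilon> = sigma (points T) {U. openin (Metric_space.mtopology (points T) (dX T \<epsilon>)) U}"

definition length_measure :: "'v rtree \<Rightarrow> real \<Rightarrow> 'v point measure" where
  "length_measure T \<epsilon> = distr (edge_measure T) (X_borel T \<epsilon>) (\<lambda>x. x)"

definition mu :: "'v rtree \<Rightarrow> real \<Rightarrow> real \<Rightarrow> 'v point measure" where
  "mu T \<epsilon> \<beta> = completion (density (length_measure T \<epsilon>) (\<lambda>x. ennreal (exp (- \<beta> * height T x))))"


section \<open>Powers and \<open>L\<^sup>p\<close> norms with values in \<open>[0, \<infinity>]\<close>\<close>

text \<open>Only used for \<open>a > 0\<close>.\<close>

definition enn_powr :: "ennreal \<Rightarrow> real \<Rightarrow> ennreal" where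
  "enn_powr x a = (if x = \<infinity> then \<infinity> else ennreal (enn2real x powr a))"

definition Lp_norm :: "'a measure \<Rightarrow> real \<Rightarrow> ('a \<Rightarrow> ennreal) \<Rightarrow> ennreal" where
  "Lp_norm M p f = enn_powr (\<integral>\<^sup>+x. enn_powr (f x) p \<partial>M) (1 / p)"


section \<open>Upper gradients and Newtonian spaces\<close>

definition upper_gradient :: "'v rtree \<Rightarrow> real \<Rightarrow> ('v point \<Rightarrow> real) \<Rightarrow> ('v point \<Rightarrow> ennreal) \<Rightarrow> bool" where
  "upper_gradient T \<epsilon> u g \<longleftrightarrow>
     g \<in> borel_measurable (X_borel T \<epsilon>) \<and>
     (\<forall>z\<in>points T. \<forall>y\<in>points T.
        ennreal \<bar>u z - u y\<bar>
          \<le> (\<integral>\<^sup>+x\<in>segment T z y. g x * ennreal (exp (- \<epsilon> * height T x)) \<partial>length_measure T \<epsilon>))"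

definition newton_norm :: "'v rtree \<Rightarrow> real \<Rightarrow> real \<Rightarrow> real \<Rightarrow> ('v point \<Rightarrow> real) \<Rightarrow> ennreal" where
  "newton_norm T \<epsilon> \<beta> p u =
     enn_powr ((\<integral>\<^sup>+x. ennreal (\<bar>u x\<bar> powr p) \<partial>mu T \<epsilon> \<beta>) +
               (INF g\<in>{g. upper_gradient T \<epsilon> u g}. \<integral>\<^sup>+x. enn_powr (g x) p \<partial>mu T \<epsilon> \<beta>)) (1 / p)"

definition newton_space :: "'v rtree \<Rightarrow> real \<Rightarrow> real \<Rightarrow> real \<Rightarrow> ('v point \<Rightarrow> real) set" where
  "newton_space T \<epsilon> \<beta> p =
     {u \<in> borel_measurable (mu T \<epsilon> \<beta>). newton_norm T \<epsilon> \<beta> p u < \<infinity>}"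

definition minimal_upper_gradient ::
    "'v rtree \<Rightarrow> real \<Rightarrow> real \<Rightarrow> real \<Rightarrow> ('v point \<Rightarrow> real) \<Rightarrow> ('v point \<Rightarrow> ennreal) \<Rightarrow> bool" where
  "minimal_upper_gradient T \<epsilon> \<beta> p u g \<longleftrightarrow>
     upper_gradient T \<epsilon> u g \<and> Lp_norm (mu T \<epsilon> \<beta>) p g < \<infinity> \<and>
     (\<forall>h. upper_gradient T \<epsilon> u h \<and> Lp_norm (mu T \<epsilon> \<beta>) p h < \<infinity> \<longrightarrow>
          (AE x in mu T \<epsilon> \<beta>. g x \<le> h x))"


section \<open>The boundary\<close>

text \<open>
  Boundary points are the infinite geodesics starting at the root, given by their sequences of
  vertices.
\<close>

definition boundary :: "'v rtree \<Rightarrow> (nat \<Rightarrow> 'v) set" where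
  "boundary T =
     {\<zeta>. \<zeta> 0 = origin T \<and> range \<zeta> \<subseteq> verts T \<and>
         (\<forall>m n. m \<le> n \<longrightarrow> graph_dist T (\<zeta> m) (\<zeta> n) = n - m)}"

text \<open>The \<open>LEAST\<close> is the number of edges shared by two distinct geodesics from the root.\<close>

definition boundary_dist :: "real \<Rightarrow> (nat \<Rightarrow> 'v) \<Rightarrow> (nat \<Rightarrow> 'v) \<Rightarrow> real" where
  "boundary_dist \<epsilon> \<zeta> \<xi> =
     (if \<zeta> = \<xi> then 0 else 2 / \<epsilon> * exp (- \<epsilon> * real (LEAST k. \<zeta> (Suc k) \<noteq> \<xi> (Suc k))))"

definition boundary_ball :: "'v rtree \<Rightarrow> real \<Rightarrow> (nat \<Rightarrow> 'v) \<Rightarrow> real \<Rightarrow> (nat \<Rightarrow> 'v) set" where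
  "boundary_ball T \<epsilon> = Metric_space.mball (boundary T) (boundary_dist \<epsilon>)"

text \<open>
  The distance, in the completion of \<open>X\<close> with respect to \<open>d\<^sub>X\<close>, from a point of \<open>X\<close> to the boundary
  point represented by the Cauchy sequence of the vertices of \<open>\<zeta>\<close>.
\<close>

definition dist_to_boundary :: "'v rtree \<Rightarrow> real \<Rightarrow> 'v point \<Rightarrow> (nat \<Rightarrow> 'v) \<Rightarrow> real" where
  "dist_to_boundary T \<epsilon> x \<zeta> = lim (\<lambda>n. dX T \<epsilon> x (vertex_point (\<zeta> n)))"

definition ray :: "'v rtree \<Rightarrow> (nat \<Rightarrow> 'v) \<Rightarrow> 'v point set" where
  "ray T \<zeta> = (\<Union>n. segment T (vertex_point (origin T)) (vertex_point (\<zeta> n)))"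

text \<open>The filter of \<open>[0, \<zeta>) \<ni> x \<rightarrow> \<zeta>\<close>.\<close>

definition radial :: "'v rtree \<Rightarrow> real \<Rightarrow> (nat \<Rightarrow> 'v) \<Rightarrow> 'v point filter" where
  "radial T \<epsilon> \<zeta> =
     inf (filtercomap (\<lambda>x. dist_to_boundary T \<epsilon> x \<zeta>) (nhds 0)) (principal (ray T \<zeta>))"

definition boundary_trace :: "'v rtree \<Rightarrow> real \<Rightarrow> ('v point \<Rightarrow> real) \<Rightarrow> (nat \<Rightarrow> 'v) \<Rightarrow> real" where
  "boundary_trace T \<epsilon> f \<zeta> = Lim (radial T \<epsilon> \<zeta>) f"

text \<open>
  Geodesics are parametrized by unweighted arc length and may start at any point of \<open>X\<close>.
\<close>

definition geodesic_to :: "'v rtree \<Rightarrow> real \<Rightarrow> (real \<Rightarrow> 'v point) \<Rightarrow> (nat \<Rightarrow> 'v) \<Rightarrow> bool" where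
  "geodesic_to T \<epsilon> \<gamma> \<zeta> \<longleftrightarrow>
     (\<forall>t\<ge>0. \<gamma> t \<in> points T) \<and>
     (\<forall>s\<ge>0. \<forall>t\<ge>0. len_dist T (\<gamma> s) (\<gamma> t) = \<bar>s - t\<bar>) \<and>
     ((\<lambda>t. dist_to_boundary T \<epsilon> (\<gamma> t) \<zeta>) \<longlongrightarrow> 0) at_top"


section \<open>Hausdorff measure\<close>

text \<open>Only used for exponents \<open>Q > 0\<close>, so that empty sets and singletons contribute \<open>0\<close> to a sum.\<close>

definition set_diam :: "('a \<Rightarrow> 'a \<Rightarrow> real) \<Rightarrow> 'a set \<Rightarrow> ennreal" where
  "set_diam d U = (SUP (x, y)\<in>U \<times> U. ennreal (d x y))"

definition hausdorff_pre :: "'a set \<Rightarrow> ('a \<Rightarrow> 'a \<Rightarrow> real) \<Rightarrow> real \<Rightarrow> real \<Rightarrow> 'a set \<Rightarrow> ennreal" where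
  "hausdorff_pre M d Q \<delta> A =
     (INF U\<in>{U :: nat \<Rightarrow> 'a set. (\<forall>i. U i \<subseteq> M \<and> set_diam d (U i) \<le> ennreal \<delta>) \<and> A \<subseteq> (\<Union>i. U i)}.
        \<Sum>i. enn_powr (set_diam d (U i)) Q)"

definition hausdorff_outer :: "'a set \<Rightarrow> ('a \<Rightarrow> 'a \<Rightarrow> real) \<Rightarrow> real \<Rightarrow> 'a set \<Rightarrow> ennreal" where
  "hausdorff_outer M d Q A = (SUP \<delta>\<in>{0<..}. hausdorff_pre M d Q \<delta> A)"

text \<open>
  Normalized Hausdorff measure of dimension \<open>Q = ln K / \<epsilon>\<close> on the Borel sets of the boundary,
  completed. It gives mass \<open>K\<^sup>-\<^sup>n\<close> to the set of boundary points whose geodesic passes through a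
  given vertex at distance \<open>n\<close> from the root.
\<close>

definition nu :: "nat \<Rightarrow> 'v rtree \<Rightarrow> real \<Rightarrow> (nat \<Rightarrow> 'v) measure" where
  "nu K T \<epsilon> =
     (let M = boundary T; d = boundary_dist \<epsilon>; H = hausdorff_outer M d (ln (real K) / \<epsilon>)
      in completion (measure_of M {U. openin (Metric_space.mtopology M d) U} (\<lambda>A. H A / H M)))"


section \<open>Besov spaces\<close>

definition besov_E ::
    "nat \<Rightarrow> 'v rtree \<Rightarrow> real \<Rightarrow> real \<Rightarrow> ((nat \<Rightarrow> 'v) \<Rightarrow> real) \<Rightarrow> real \<Rightarrow> ennreal" where
  "besov_E K T \<epsilon> p f t =
     enn_powr (\<integral>\<^sup>+\<zeta>. (\<integral>\<^sup>+\<xi>\<in>boundary_ball T \<epsilon> \<zeta> t. ennreal (\<bar>f \<zeta> - f \<xi>\<bar> powr p) \<partial>nu K T \<epsilon>)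
                     / emeasure (nu K T \<epsilon>) (boundary_ball T \<epsilon> \<zeta> t) \<partial>nu K T \<epsilon>) (1 / p)"

definition besov_seminorm ::
    "nat \<Rightarrow> 'v rtree \<Rightarrow> real \<Rightarrow> real \<Rightarrow> real \<Rightarrow> ((nat \<Rightarrow> 'v) \<Rightarrow> real) \<Rightarrow> ennreal" where
  "besov_seminorm K T \<epsilon> p \<theta> f =
     enn_powr (\<integral>\<^sup>+t\<in>{0<..}. enn_powr (besov_E K T \<epsilon> p f t / ennreal (t powr \<theta>)) p / ennreal t \<partial>lborel)
       (1 / p)"

definition besov_norm ::
    "nat \<Rightarrow> 'v rtree \<Rightarrow> real \<Rightarrow> real \<Rightarrow> real \<Rightarrow> ((nat \<Rightarrow> 'v) \<Rightarrow> real) \<Rightarrow> ennreal" where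
  "besov_norm K T \<epsilon> p \<theta> f =
     Lp_norm (nu K T \<epsilon>) p (\<lambda>\<zeta>. ennreal \<bar>f \<zeta>\<bar>) + besov_seminorm K T \<epsilon> p \<theta> f"

definition besov_space ::
    "nat \<Rightarrow> 'v rtree \<Rightarrow> real \<Rightarrow> real \<Rightarrow> real \<Rightarrow> ((nat \<Rightarrow> 'v) \<Rightarrow> real) set" where
  "besov_space K T \<epsilon> p \<theta> =
     {f \<in> borel_measurable (nu K T \<epsilon>).
        Lp_norm (nu K T \<epsilon>) p (\<lambda>\<zeta>. ennreal \<bar>f \<zeta>\<bar>) < \<infinity> \<and> besov_seminorm K T \<epsilon> p \<theta> f < \<infinity>}"

end

theory Submission
  imports Defs
begin

text \<open>
  The extension of \<open>u\<close> takes at a vertex \<open>v\<close> the average of \<open>u\<close> over the cylinder of \<open>v\<close>, that is,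
  over the boundary points whose geodesic passes through \<open>v\<close>, and interpolates linearly along the
  edges. Three facts make this work.

  First, everything on the tree reduces to the geodesics from the root, here called stems. The
  distance of two points is determined by their heights and their Gromov product with respect to the
  root (\<open>len_dist_eq\<close>), and up to one point a segment is the symmetric difference of two stems
  (\<open>segment_eq\<close>). Hence \<open>d\<^sub>X\<close> has a closed form (\<open>dX_eq\<close>), Borel sets can be described edge by edge
  (\<open>measurable_XB_I\<close>), and the interpolation of a vertex function is the integral of its increments
  along stems. So its slope is an upper gradient (\<open>slope_upper_gradient\<close>). It is minimal
  (\<open>slope_minimal\<close>) since the integrals of any other upper gradient over the subintervals of an edge
  are at least those of the slope.

  Second, \<open>\<nu>\<close> gives the cylinder of each vertex of level \<open>n\<close> the mass \<open>K\<^sup>-\<^sup>n\<close>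
  (\<open>emeasure_nu0_cyl\<close>). Cylinders split covers by small sets, so Hausdorff outer measure is additive
  on them. A cylinder has a cover by small cylinders whose cost is at most the expected mass, and a
  cover of the whole boundary costs at least the expected total, since cylinders that are cheaper
  than that leave out some branch of the tree (\<open>cylinder_cover_mass\<close>).

  Third, the balls of the boundary are cylinders, and the \<open>p\<close>-th power of the Besov seminorm
  dominates the series of the mean oscillations of \<open>u\<close> on the cylinders of level \<open>n\<close>, with weights
  \<open>e\<^sup>\<epsilon>\<^sup>\<theta>\<^sup>p\<^sup>n\<close> (\<open>besov_series_le\<close>). By Jensen's inequality, the increment of the averages along an edge
  at level \<open>n\<close> is controlled by these oscillations. Summing over the \<open>K\<^sup>n\<close> edges of a level gives the
  weight \<open>e\<close> to the power \<open>n(\<epsilon>p - \<beta> + log K)\<close> for the energy of the slope, and the lower bound on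
  \<open>\<theta>\<close> says that this is at most the Besov weight (\<open>slope_energy\<close>). The \<open>L\<^sup>p\<close> norm of the extension
  is a geometric series, which converges as \<open>\<beta> > log K\<close> (\<open>interp_Lp\<close>). As the mean oscillations are
  summable, the averages along almost every ray converge to \<open>u\<close> (\<open>avg_tendsto_AE\<close>), which gives the
  trace. A geodesic converging to \<open>\<zeta>\<close> eventually runs on the ray to \<open>\<zeta>\<close> (\<open>geodesic_to_ray\<close>), so it
  sees the same limit.
\<close>


section \<open>Ancestors and distances in a rooted tree\<close>

lemma graph_dist_commute: "graph_dist T x y = graph_dist T y x"
proof -
  have "(\<exists>xs. walk T xs \<and> hd xs = a \<and> last xs = b \<and> length xs = n)"
    if "\<exists>xs. walk T xs \<and> hd xs = b \<and> last xs = a \<and> length xs = n" for a b n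
  proof -
    from that obtain xs where xs: "walk T xs" "hd xs = b" "last xs = a" "length xs = n" by blast
    have "walk T (rev xs)"
      using xs(1) by (auto simp: walk_def successively_rev insert_commute)
    then show ?thesis using xs by (intro exI[of _ "rev xs"]) (auto simp: hd_rev last_rev walk_def)
  qed
  then have "(\<exists>xs. walk T xs \<and> hd xs = x \<and> last xs = y \<and> length xs = Suc n)
      \<longleftrightarrow> (\<exists>xs. walk T xs \<and> hd xs = y \<and> last xs = x \<and> length xs = Suc n)" for n by blast
  then show ?thesis by (simp add: graph_dist_def)
qed

lemma walk_join:
  assumes "walk T xs" "walk T ys" "last xs = hd ys"
  shows "walk T (xs @ tl ys)" "hd (xs @ tl ys) = hd xs" "last (xs @ tl ys) = last ys"
proof -
  from assms obtain y ys' where ys: "ys = y # ys'" by (cases ys) (auto simp: walk_def)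
  show "walk T (xs @ tl ys)"
    using assms ys by (auto simp: walk_def successively_append_iff successively_Cons)
  show "hd (xs @ tl ys) = hd xs" "last (xs @ tl ys) = last ys"
    using assms ys by (auto simp: walk_def)
qed

lemma walk_distinct:
  assumes "walk T xs"
  shows "\<exists>ys. walk T ys \<and> distinct ys \<and> hd ys = hd xs \<and> last ys = last xs \<and> set ys \<subseteq> set xs"
  using assms
proof (induction "length xs" arbitrary: xs rule: less_induct)
  case less
  show ?case
  proof (cases "distinct xs")
    case False
    then obtain as bs cs x where xs: "xs = as @ [x] @ bs @ [x] @ cs"
      using not_distinct_decomp by blast
    let ?ys = "as @ [x] @ cs"
    have "walk T ?ys"
      using less.prems xs by (auto simp: walk_def successively_append_iff successively_Cons)
    moreover have "hd ?ys = hd xs" "last ?ys = last xs" "set ?ys \<subseteq> set xs" "length ?ys < length xs"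
      using xs by (auto simp: hd_append)
    ultimately show ?thesis using less.hyps[of ?ys] by fastforce
  qed (use less.prems in blast)
qed

lemma eq_nat_if_le_iff: "(\<And>k. k \<le> a \<longleftrightarrow> k \<le> b) \<Longrightarrow> a = (b::nat)"
  by (meson le_antisym order_refl)

locale tree =
  fixes T :: "'v rtree"
  assumes rooted: "rooted_tree T"
begin

abbreviation "V \<equiv> verts T"
abbreviation "orig \<equiv> origin T"
abbreviation "adj x y \<equiv> {x, y} \<in> edges T"
abbreviation "lev v \<equiv> graph_dist T orig v"
abbreviation "par \<equiv> parent T"

lemma adjD: "adj x y \<Longrightarrow> x \<in> V \<and> y \<in> V \<and> x \<noteq> y"
  using rooted by (fastforce simp: rooted_tree_def doubleton_eq_iff)

lemma root_in [simp]: "orig \<in> V"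
  using rooted by (simp add: rooted_tree_def)

lemma graph_dist_walk:
  assumes "x \<in> V" "y \<in> V"
  obtains xs where "walk T xs" "hd xs = x" "last xs = y" "length xs = Suc (graph_dist T x y)"
proof -
  obtain xs where xs: "walk T xs" "hd xs = x" "last xs = y"
    using rooted assms by (fastforce simp: rooted_tree_def)
  then have "\<exists>n. \<exists>xs. walk T xs \<and> hd xs = x \<and> last xs = y \<and> length xs = Suc n"
    by (intro exI[of _ "length xs - 1"] exI[of _ xs]) (auto simp: walk_def Suc_leI)
  from LeastI_ex[OF this] show ?thesis using that unfolding graph_dist_def by blast
qed

lemma graph_dist_le: "walk T xs \<Longrightarrow> graph_dist T (hd xs) (last xs) \<le> length xs - 1"
  unfolding graph_dist_def by (rule Least_le) (auto simp: walk_def intro!: exI[of _ xs])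

lemma graph_dist_triangle:
  assumes "x \<in> V" "y \<in> V" "z \<in> V"
  shows "graph_dist T x z \<le> graph_dist T x y + graph_dist T y z"
proof -
  obtain xs where xs: "walk T xs" "hd xs = x" "last xs = y" "length xs = Suc (graph_dist T x y)"
    using graph_dist_walk assms by blast
  obtain ys where ys: "walk T ys" "hd ys = y" "last ys = z" "length ys = Suc (graph_dist T y z)"
    using graph_dist_walk assms by blast
  have "last xs = hd ys" using xs ys by simp
  note j = walk_join[OF xs(1) ys(1) this]
  show ?thesis using graph_dist_le[OF j(1)] unfolding j(2,3) using xs ys by simp
qed

lemma graph_dist_adj: "adj x y \<Longrightarrow> graph_dist T x y \<le> 1"
  using graph_dist_le[of "[x, y]"] adjD[of x y] by (simp add: walk_def)

lemma graph_dist_self [simp]: "x \<in> V \<Longrightarrow> graph_dist T x x = 0"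
  using graph_dist_le[of "[x]"] by (simp add: walk_def)

lemma lev_eq_0: "v \<in> V \<Longrightarrow> lev v = 0 \<longleftrightarrow> v = orig"
proof
  assume "v \<in> V" "lev v = 0"
  then obtain xs where "hd xs = orig" "last xs = v" "length xs = Suc 0"
    using graph_dist_walk[of orig v] by (metis root_in)
  then show "v = orig" by (cases xs) auto
qed auto

lemma lev_pos: "v \<in> V \<Longrightarrow> v \<noteq> orig \<Longrightarrow> 0 < lev v"
  using lev_eq_0 by blast

lemma lev_adj: "adj x y \<Longrightarrow> lev y \<le> Suc (lev x)"
  using graph_dist_triangle[of orig x y] graph_dist_adj[of x y] adjD[of x y] by simp

lemma ex_lower:
  assumes "v \<in> V" "v \<noteq> orig"
  shows "\<exists>y. adj v y \<and> Suc (lev y) = lev v"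
proof -
  obtain xs where xs: "walk T xs" "hd xs = orig" "last xs = v" "length xs = Suc (lev v)"
    using graph_dist_walk assms root_in by blast
  define ys where "ys = butlast xs"
  have l: "length ys = lev v" and ne: "ys \<noteq> []" and xs': "xs = ys @ [v]"
    using xs lev_pos[OF assms] by (auto simp: ys_def walk_def simp flip: length_greater_0_conv)
  have ys: "walk T ys" "hd ys = orig" "adj (last ys) v"
    using xs ne unfolding xs' by (auto simp: walk_def successively_append_iff)
  have "lev (last ys) \<le> lev v - 1" using graph_dist_le[OF ys(1)] ys l by simp
  moreover have "lev v \<le> Suc (lev (last ys))" using lev_adj ys by blast
  ultimately show ?thesis
    using ys lev_pos[OF assms] by (intro exI[of _ "last ys"]) (auto simp: insert_commute)
qed

lemma descending_walk:
  assumes "v \<in> V"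
  shows "\<exists>xs. walk T xs \<and> hd xs = v \<and> last xs = orig \<and> (\<forall>x\<in>set (tl xs). lev x < lev v)"
  using assms
proof (induction "lev v" arbitrary: v rule: less_induct)
  case less
  show ?case
  proof (cases "v = orig")
    case True
    then show ?thesis by (intro exI[of _ "[orig]"]) (auto simp: walk_def)
  next
    case False
    then obtain y where y: "adj v y" "Suc (lev y) = lev v" using ex_lower less.prems by blast
    then obtain xs where xs: "walk T xs" "hd xs = y" "last xs = orig" "\<forall>x\<in>set (tl xs). lev x < lev y"
      using less.hyps[of y] adjD by auto
    then have "set xs = insert y (set (tl xs))" by (cases xs) (auto simp: walk_def)
    then show ?thesis using xs y less.prems
      by (intro exI[of _ "v # xs"]) (auto simp: walk_def successively_Cons)
  qed
qed

text \<open>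
  This is where acyclicity enters: descending walks from two different such neighbours to the root
  avoid \<open>x\<close>, so together with \<open>x\<close> they would contain a cycle.
\<close>

lemma lower_neighbour_unique:
  assumes "adj x y" "adj x z" "lev y \<le> lev x" "lev z \<le> lev x"
  shows "y = z"
proof (rule ccontr)
  assume "y \<noteq> z"
  have *: "\<exists>xs. walk T xs \<and> hd xs = v \<and> last xs = orig \<and> x \<notin> set xs"
    if v: "adj x v" "lev v \<le> lev x" for v
  proof -
    obtain xs where xs: "walk T xs" "hd xs = v" "last xs = orig" "\<forall>x\<in>set (tl xs). lev x < lev v"
      using descending_walk[of v] adjD v by blast
    then have "set xs = insert v (set (tl xs))" by (cases xs) (auto simp: walk_def)
    then show ?thesis using xs v adjD[OF v(1)] by (intro exI[of _ xs]) auto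
  qed
  obtain xs where xs: "walk T xs" "hd xs = y" "last xs = orig" "x \<notin> set xs" using * assms by blast
  obtain ys where ys: "walk T ys" "hd ys = z" "last ys = orig" "x \<notin> set ys" using * assms by blast
  have ry: "walk T (rev ys)" "hd (rev ys) = orig" "last (rev ys) = z"
    using ys by (auto simp: walk_def successively_rev insert_commute hd_rev last_rev)
  have "last xs = hd (rev ys)" using xs ry by simp
  note j = walk_join[OF xs(1) ry(1) this]
  obtain ds where ds: "walk T ds" "distinct ds" "hd ds = y" "last ds = z"
      "set ds \<subseteq> set (xs @ tl (rev ys))"
    using walk_distinct[OF j(1)] unfolding j(2,3) using xs ry by auto
  have "set (tl (rev ys)) \<subseteq> set ys" by (metis list.set_sel(2) set_rev subsetI tl_Nil)
  then have nx: "x \<notin> set ds" using ds(5) xs ys by auto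
  have "length ds \<ge> 2" using ds \<open>y \<noteq> z\<close>
    by (cases ds; cases "tl ds") (auto simp: walk_def)
  then have "cycle T (x # ds)"
    using ds nx assms adjD[OF assms(1)]
    by (auto simp: cycle_def walk_def successively_Cons insert_commute)
  then show False using rooted by (auto simp: rooted_tree_def)
qed

lemma par:
  assumes "v \<in> V" "v \<noteq> orig"
  shows "adj v (par v)" "Suc (lev (par v)) = lev v" "par v \<in> V"
proof -
  obtain y where y: "adj v y" "Suc (lev y) = lev v" using ex_lower assms by blast
  have "par v = y"
    unfolding parent_def
  proof (rule the_equality)
    show "z = y" if "adj v z \<and> lev z < lev v" for z
      using lower_neighbour_unique[of v z y] that y by simp
  qed (use y in simp)
  then show "adj v (par v)" "Suc (lev (par v)) = lev v" "par v \<in> V" using y adjD by auto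
qed

lemma adj_cases:
  assumes "adj v y"
  shows "(v \<noteq> orig \<and> y = par v) \<or> (y \<noteq> orig \<and> v = par y)"
proof -
  have *: "a \<noteq> orig \<and> b = par a" if "adj a b" "lev b \<le> lev a" for a b
  proof -
    have ab: "a \<in> V" "b \<in> V" "a \<noteq> b" using adjD that by auto
    have "a \<noteq> orig" using that ab lev_eq_0 by fastforce
    moreover have "lev (par a) \<le> lev a" using par(2)[OF ab(1)] \<open>a \<noteq> orig\<close> by linarith
    ultimately show ?thesis using lower_neighbour_unique[of a b "par a"] par ab that by auto
  qed
  show ?thesis using *[of v y] *[of y v] assms by (cases "lev y \<le> lev v") (auto simp: insert_commute)
qed

lemma children_iff: "v \<in> V \<Longrightarrow> y \<in> children T v \<longleftrightarrow> y \<in> V \<and> y \<noteq> orig \<and> par y = v"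
proof
  assume "v \<in> V" "y \<in> children T v"
  then show "y \<in> V \<and> y \<noteq> orig \<and> par y = v" using adj_cases[of v y] adjD[of v y] by (auto simp: children_def)
next
  assume *: "v \<in> V" "y \<in> V \<and> y \<noteq> orig \<and> par y = v"
  then have "adj y v" "Suc (lev v) = lev y" using par[of y] by auto
  moreover have "v \<noteq> orig \<Longrightarrow> Suc (lev (par v)) = lev v" using par * by auto
  ultimately show "y \<in> children T v" by (auto simp: children_def insert_commute)
qed

definition anc :: "'v \<Rightarrow> nat \<Rightarrow> 'v" where
  "anc v k = (par ^^ (lev v - k)) v"

lemma anc_lev [simp]: "anc v (lev v) = v"
  by (simp add: anc_def)

lemma anc_par:
  assumes "v \<in> V" "v \<noteq> orig" "k < lev v"
  shows "anc (par v) k = anc v k"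
proof -
  have "lev v - k = Suc (lev (par v) - k)" using par(2)[OF assms(1,2)] assms by linarith
  then show ?thesis by (simp add: anc_def funpow_swap1)
qed

lemma anc_in_lev: "v \<in> V \<Longrightarrow> k \<le> lev v \<Longrightarrow> anc v k \<in> V \<and> lev (anc v k) = k"
proof (induction "lev v" arbitrary: v rule: less_induct)
  case less
  show ?case
  proof (cases "k = lev v")
    case False
    then have *: "k < lev v" "v \<noteq> orig" using less.prems by auto
    then show ?thesis using less.hyps[of "par v"] par[OF less.prems(1) *(2)] anc_par[of v k] less.prems
      by simp
  qed (use less.prems in auto)
qed

lemma anc_in [simp]: "v \<in> V \<Longrightarrow> k \<le> lev v \<Longrightarrow> anc v k \<in> V"
  and lev_anc [simp]: "v \<in> V \<Longrightarrow> k \<le> lev v \<Longrightarrow> lev (anc v k) = k"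
  using anc_in_lev by auto

lemma anc_0 [simp]: "v \<in> V \<Longrightarrow> anc v 0 = orig"
  using anc_in_lev[of v 0] lev_eq_0[of "anc v 0"] by simp

lemma anc_anc: "v \<in> V \<Longrightarrow> k \<le> lev v \<Longrightarrow> j \<le> k \<Longrightarrow> anc (anc v k) j = anc v j"
proof -
  assume *: "v \<in> V" "k \<le> lev v" "j \<le> k"
  have "anc (anc v k) j = (par ^^ (k - j)) ((par ^^ (lev v - k)) v)"
    using * anc_in_lev[of v k] by (simp add: anc_def)
  also have "\<dots> = (par ^^ (k - j + (lev v - k))) v" by (simp add: funpow_add)
  also have "k - j + (lev v - k) = lev v - j" using * by simp
  finally show ?thesis by (simp add: anc_def)
qed

lemma par_anc: "v \<in> V \<Longrightarrow> k < lev v \<Longrightarrow> par (anc v (Suc k)) = anc v k"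
  by (metis Suc_diff_Suc anc_def comp_apply funpow.simps(2))

text \<open>The level of the last common ancestor.\<close>

definition meet_lev :: "'v \<Rightarrow> 'v \<Rightarrow> nat" where
  "meet_lev v w = Max {k. k \<le> lev v \<and> k \<le> lev w \<and> anc v k = anc w k}"

text \<open>
  The levels at which two vertices have a common ancestor form an initial segment. So numbers
  \<open>meet_lev v w\<close> can be compared through the levels below them, which turns statements about them into
  statements about ancestors.
\<close>

lemma le_meet_lev_iff:
  assumes "v \<in> V" "w \<in> V"
  shows "k \<le> meet_lev v w \<longleftrightarrow> k \<le> lev v \<and> k \<le> lev w \<and> anc v k = anc w k"
proof -
  let ?A = "{k. k \<le> lev v \<and> k \<le> lev w \<and> anc v k = anc w k}"
  have fin: "finite ?A" by (rule finite_subset[of _ "{..lev v}"]) auto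
  have "0 \<in> ?A" using assms by auto
  then have M: "meet_lev v w \<in> ?A" unfolding meet_lev_def using fin by (intro Max_in) auto
  show ?thesis
  proof
    assume k: "k \<le> meet_lev v w"
    then have "anc v k = anc (anc v (meet_lev v w)) k" "anc w k = anc (anc w (meet_lev v w)) k"
      using anc_anc[OF assms(1) _ k] anc_anc[OF assms(2) _ k] M by simp_all
    then show "k \<le> lev v \<and> k \<le> lev w \<and> anc v k = anc w k" using k M by auto
  next
    assume "k \<le> lev v \<and> k \<le> lev w \<and> anc v k = anc w k"
    then show "k \<le> meet_lev v w" unfolding meet_lev_def using fin by (intro Max_ge) auto
  qed
qed

lemma meet_lev_commute: "v \<in> V \<Longrightarrow> w \<in> V \<Longrightarrow> meet_lev v w = meet_lev w v"
  by (rule eq_nat_if_le_iff) (auto simp: le_meet_lev_iff)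

lemma meet_lev_self: "v \<in> V \<Longrightarrow> meet_lev v v = lev v"
  by (rule eq_nat_if_le_iff) (auto simp: le_meet_lev_iff)

lemma meet_lev_le: "v \<in> V \<Longrightarrow> w \<in> V \<Longrightarrow> meet_lev v w \<le> lev v" "v \<in> V \<Longrightarrow> w \<in> V \<Longrightarrow> meet_lev v w \<le> lev w"
  using le_meet_lev_iff by blast+

lemma meet_lev_eq_lev: "v \<in> V \<Longrightarrow> w \<in> V \<Longrightarrow> meet_lev v w = lev v \<longleftrightarrow> lev v \<le> lev w \<and> anc w (lev v) = v"
  using le_meet_lev_iff[of v w "lev v"] meet_lev_le(1)[of v w]
  by (metis anc_lev dual_order.antisym order_refl)

lemma meet_lev_ultra:
  assumes "u \<in> V" "v \<in> V" "w \<in> V"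
  shows "min (meet_lev u v) (meet_lev v w) \<le> meet_lev u w"
proof -
  let ?k = "min (meet_lev u v) (meet_lev v w)"
  have "?k \<le> meet_lev u v" "?k \<le> meet_lev v w" by auto
  then show ?thesis using assms unfolding le_meet_lev_iff[OF assms(1,2)] le_meet_lev_iff[OF assms(2,3)]
    by (simp add: le_meet_lev_iff)
qed

lemma meet_lev_par:
  assumes "v \<in> V" "v \<noteq> orig" "w \<in> V"
  shows "meet_lev (par v) w = min (lev v - 1) (meet_lev v w)"
proof (rule eq_nat_if_le_iff)
  fix k
  have "lev (par v) = lev v - 1" using par(2)[OF assms(1,2)] by simp
  then show "k \<le> meet_lev (par v) w \<longleftrightarrow> k \<le> min (lev v - 1) (meet_lev v w)"
    using assms par[OF assms(1,2)] anc_par[OF assms(1,2), of k] by (auto simp: le_meet_lev_iff)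
qed

lemma graph_dist_anc:
  assumes "v \<in> V" "k \<le> lev v"
  shows "graph_dist T v (anc v k) \<le> lev v - k"
  using assms
proof (induction "lev v - k" arbitrary: k)
  case (Suc n)
  have k: "k < lev v" using Suc by linarith
  have "graph_dist T v (anc v (Suc k)) \<le> lev v - Suc k" using Suc k by simp
  moreover have "graph_dist T (anc v (Suc k)) (anc v k) \<le> 1"
  proof -
    have a: "anc v (Suc k) \<in> V" "lev (anc v (Suc k)) = Suc k" using k Suc.prems by auto
    then have "anc v (Suc k) \<noteq> orig" using lev_eq_0[OF a(1)] by simp
    then show ?thesis using graph_dist_adj[OF par(1)[OF a(1)]] par_anc[OF Suc.prems(1) k] by simp
  qed
  ultimately show ?case
    using graph_dist_triangle[of v "anc v (Suc k)" "anc v k"] Suc.prems k by auto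
qed simp

text \<open>
  The quantity \<open>lev v + lev w - 2 * meet_lev v w\<close> vanishes for \<open>v = w\<close> and grows by at most one when \<open>w\<close>
  moves along an edge, whether to its parent or to a child.
\<close>

lemma walk_length_ge:
  assumes "walk T xs"
  shows "lev (hd xs) + lev (last xs) < length xs + 2 * meet_lev (hd xs) (last xs)"
  using assms
proof (induction xs rule: rev_induct)
  case (snoc z xs)
  show ?case
  proof (cases "xs = []")
    case True
    then show ?thesis using snoc by (simp add: walk_def meet_lev_self)
  next
    case False
    let ?v = "hd xs" and ?y = "last xs"
    have w: "walk T xs" and a: "adj ?y z" using snoc.prems False by (auto simp: walk_def successively_append_iff)
    then have V: "?v \<in> V" "?y \<in> V" "z \<in> V" using False adjD by (auto simp: walk_def)
    have IH: "lev ?v + lev ?y < length xs + 2 * meet_lev ?v ?y" using snoc.IH w by blast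
    have "lev ?v + lev z < Suc (length xs) + 2 * meet_lev ?v z"
      using adj_cases[OF a]
    proof
      assume *: "?y \<noteq> orig \<and> z = par ?y"
      then have "meet_lev ?v z = min (lev ?y - 1) (meet_lev ?v ?y)"
        using meet_lev_par[of ?y ?v] V meet_lev_commute[of ?v z] meet_lev_commute[of ?v ?y] by simp
      then show ?thesis using IH * par(2)[of ?y] V meet_lev_le[of ?v ?y] lev_pos[of ?y] by simp
    next
      assume *: "z \<noteq> orig \<and> ?y = par z"
      then have "meet_lev ?v ?y = min (lev z - 1) (meet_lev ?v z)"
        using meet_lev_par[of z ?v] V meet_lev_commute[of ?v z] meet_lev_commute[of ?v ?y] by simp
      then show ?thesis using IH * par(2)[of z] V by simp
    qed
    then show ?thesis using False by simp
  qed
qed (simp add: walk_def)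

text \<open>
  A walk that realizes the lower bound goes up to the last common ancestor and down again.
\<close>

lemma graph_dist_meet:
  assumes "v \<in> V" "w \<in> V"
  shows "graph_dist T v w + 2 * meet_lev v w = lev v + lev w"
proof (rule antisym)
  let ?m = "meet_lev v w"
  have m: "?m \<le> lev v" "?m \<le> lev w" "anc v ?m = anc w ?m" using le_meet_lev_iff assms by blast+
  have "graph_dist T v w \<le> graph_dist T v (anc v ?m) + graph_dist T w (anc w ?m)"
    using graph_dist_triangle[of v "anc v ?m" w] graph_dist_commute[of T w "anc w ?m"] m assms by simp
  also have "\<dots> \<le> (lev v - ?m) + (lev w - ?m)"
    using graph_dist_anc[OF assms(1) m(1)] graph_dist_anc[OF assms(2) m(2)] by (rule add_mono)
  finally show "graph_dist T v w + 2 * ?m \<le> lev v + lev w" using m by linarith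
  obtain xs where xs: "walk T xs" "hd xs = v" "last xs = w" "length xs = Suc (graph_dist T v w)"
    using graph_dist_walk assms by blast
  then show "lev v + lev w \<le> graph_dist T v w + 2 * ?m" using walk_length_ge[OF xs(1)] by simp
qed

lemma boundary_iff:
  "\<zeta> \<in> boundary T \<longleftrightarrow> \<zeta> 0 = orig \<and> (\<forall>n. \<zeta> (Suc n) \<in> V \<and> \<zeta> (Suc n) \<noteq> orig \<and> par (\<zeta> (Suc n)) = \<zeta> n)"
proof
  assume b: "\<zeta> \<in> boundary T"
  then have z0: "\<zeta> 0 = orig" and zV: "\<zeta> n \<in> V" for n by (auto simp: boundary_def)
  have d: "graph_dist T (\<zeta> m) (\<zeta> n) = n - m" if "m \<le> n" for m n using b that by (auto simp: boundary_def)
  have lev: "lev (\<zeta> n) = n" for n using d[of 0 n] z0 by simp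
  have "meet_lev (\<zeta> n) (\<zeta> (Suc n)) = n" for n
    using graph_dist_meet[OF zV zV, of n "Suc n"] d[of n "Suc n"] lev by simp
  then have "anc (\<zeta> (Suc n)) n = \<zeta> n" for n
    using meet_lev_eq_lev[OF zV zV, of n "Suc n"] lev by simp
  moreover have "\<zeta> (Suc n) \<noteq> orig" for n using lev[of "Suc n"] by auto
  ultimately show "\<zeta> 0 = orig \<and> (\<forall>n. \<zeta> (Suc n) \<in> V \<and> \<zeta> (Suc n) \<noteq> orig \<and> par (\<zeta> (Suc n)) = \<zeta> n)"
    using z0 zV par_anc[OF zV] lev by (metis anc_lev lessI)
next
  assume *: "\<zeta> 0 = orig \<and> (\<forall>n. \<zeta> (Suc n) \<in> V \<and> \<zeta> (Suc n) \<noteq> orig \<and> par (\<zeta> (Suc n)) = \<zeta> n)"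
  have zV: "\<zeta> n \<in> V" for n using * by (cases n) auto
  have lev: "lev (\<zeta> n) = n" for n
  proof (induction n)
    case (Suc n)
    then show ?case using * par(2)[of "\<zeta> (Suc n)"] by metis
  qed (use * in auto)
  have anc: "anc (\<zeta> (m + k)) m = \<zeta> m" for m k
  proof (induction k)
    case (Suc k)
    then show ?case using anc_par[of "\<zeta> (Suc (m + k))" m] * lev by simp
  qed (use lev in \<open>metis add_0_right anc_lev\<close>)
  have "meet_lev (\<zeta> m) (\<zeta> (m + k)) = m" for m k
    using meet_lev_eq_lev[OF zV zV, of m "m + k"] lev anc by simp
  then have "graph_dist T (\<zeta> m) (\<zeta> (m + k)) = k" for m k
    using graph_dist_meet[OF zV zV, of m "m + k"] lev by simp
  then have "graph_dist T (\<zeta> m) (\<zeta> n) = n - m" if "m \<le> n" for m n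
    using that by (metis le_add_diff_inverse)
  then show "\<zeta> \<in> boundary T" using * zV by (auto simp: boundary_def)
qed

lemma boundary_in: "\<zeta> \<in> boundary T \<Longrightarrow> \<zeta> n \<in> V"
  by (auto simp: boundary_def)

lemma boundary_lev [simp]: "\<zeta> \<in> boundary T \<Longrightarrow> lev (\<zeta> n) = n"
  unfolding boundary_def by (metis (mono_tags, lifting) diff_zero mem_Collect_eq zero_le)

lemma boundary_anc: assumes "\<zeta> \<in> boundary T" "k \<le> n" shows "anc (\<zeta> n) k = \<zeta> k"
proof -
  have "graph_dist T (\<zeta> k) (\<zeta> n) = n - k" using assms by (simp add: boundary_def)
  then have "meet_lev (\<zeta> k) (\<zeta> n) = k"
    using graph_dist_meet[of "\<zeta> k" "\<zeta> n"] boundary_in[OF assms(1)] assms by simp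
  then show ?thesis using meet_lev_eq_lev[of "\<zeta> k" "\<zeta> n"] boundary_in[OF assms(1)] assms(1) by simp
qed

end

section \<open>The tree as a metric graph\<close>

text \<open>
  Two statements about the Gromov products of three points, with the geometry stripped off: in both,
  what matters is that the two smallest of three products agree.
\<close>

lemma three_products:
  fixes a b c h :: real
  assumes "a \<le> h" "b \<le> h" "min a b \<le> c" "min b c \<le> a" "min a c \<le> b"
  shows "a + b = h + c \<longleftrightarrow> (a = h \<or> b = h) \<and> c \<le> h"
  using assms by linarith

lemma three_products_meet:
  fixes a b c h k :: real
  assumes "a \<le> h" "b \<le> h" "c \<le> h" "a \<le> k" "min k a \<le> b" "min k a \<le> c" "min b c \<le> k" "min k b \<le> a"
  shows "a = h \<longleftrightarrow> b = h \<and> c = h"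
  using assms by linarith

context tree
begin

abbreviation "P \<equiv> points T"
abbreviation "origin_pt \<equiv> (orig, 1 :: real)"

definition hgt :: "'v point \<Rightarrow> real" where
  "hgt x = real (lev (fst x)) + snd x - 1"

text \<open>
  The Gromov product with respect to the root, that is, the height at which the geodesics from the
  root to \<open>x\<close> and \<open>y\<close> separate. The heights enter since a point inside an edge is represented by
  the lower end of this edge, which is further away from the root.
\<close>

definition gprod :: "'v point \<Rightarrow> 'v point \<Rightarrow> real" where
  "gprod x y = min (min (hgt x) (hgt y)) (real (meet_lev (fst x) (fst y)))"

lemma pointsD:
  assumes "x \<in> P"
  shows "fst x \<in> V" "0 < snd x" "snd x \<le> 1" "fst x = orig \<Longrightarrow> snd x = 1"
  using assms by (auto simp: points_def)

lemma vertex_in_P [simp]: "v \<in> V \<Longrightarrow> (v, 1) \<in> P"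
  by (simp add: points_def)

lemma hgt_nonneg: "x \<in> P \<Longrightarrow> 0 \<le> hgt x"
  using pointsD[of x] lev_pos[of "fst x"] by (cases "fst x = orig") (auto simp: hgt_def Suc_le_eq)

text \<open>
  The minimum over pairs of edge ends is attained at the ends that face each other: the parent end of
  a point, unless the other point lies below it.
\<close>

lemma len_dist_eq:
  assumes "x \<in> P" "y \<in> P"
  shows "len_dist T x y = hgt x + hgt y - 2 * gprod x y"
proof -
  obtain v s where x: "x = (v, s)" by force
  obtain w t where y: "y = (w, t)" by force
  note v = pointsD[OF assms(1), unfolded x, simplified]
  note w = pointsD[OF assms(2), unfolded y, simplified]
  show ?thesis
  proof (cases "v = w")
    case True
    then show ?thesis
      using v w by (auto simp: x y len_dist_def hgt_def gprod_def meet_lev_self min_def)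
  next
    case False
    define n m M where "n = real (lev v)" and "m = real (lev w)" and "M = real (meet_lev v w)"
    have gd: "real (graph_dist T a b) = real (lev a) + real (lev b) - 2 * real (meet_lev a b)"
      if "a \<in> V" "b \<in> V" for a b
      using graph_dist_meet[OF that] by linarith
    have M: "M \<le> n" "M \<le> m" using meet_lev_le v(1) w(1) by (auto simp: n_def m_def M_def)
    have Mi: "M < n \<Longrightarrow> M \<le> n - 1" "M < m \<Longrightarrow> M \<le> m - 1" by (auto simp: n_def m_def M_def)
    have Mne: "M < n \<or> M < m"
    proof (rule ccontr)
      assume "\<not> ?thesis"
      then have "meet_lev v w = lev v" "lev v = lev w" using M by (auto simp: n_def m_def M_def)
      then show False using False meet_lev_eq_lev[of v w] v w by auto
    qed
    have vr: "v = orig \<Longrightarrow> n = 0 \<and> s = 1 \<and> M = 0" "w = orig \<Longrightarrow> m = 0 \<and> t = 1 \<and> M = 0"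
      using v w M by (auto simp: n_def m_def M_def)
    have pv: "real (lev (par v)) = n - 1" "par v \<in> V" "1 \<le> n"
      "real (meet_lev (par v) w) = min (n - 1) M" if "v \<noteq> orig"
      using par[OF v(1) that] meet_lev_par[OF v(1) that w(1)] lev_pos[OF v(1) that]
      by (auto simp: n_def M_def of_nat_diff Suc_le_eq min_def)
    have pw: "real (lev (par w)) = m - 1" "par w \<in> V" "1 \<le> m"
      "real (meet_lev v (par w)) = min (m - 1) M" if "w \<noteq> orig"
      using par[OF w(1) that] meet_lev_par[OF w(1) that v(1)] lev_pos[OF w(1) that]
        meet_lev_commute[OF v(1) w(1)] meet_lev_commute[OF v(1), of "par w"]
      by (auto simp: m_def M_def of_nat_diff Suc_le_eq min_def)
    have pvw: "real (meet_lev (par v) (par w)) = min (n - 1) (min (m - 1) M)"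
      if "v \<noteq> orig" "w \<noteq> orig"
      using meet_lev_par[OF v(1) that(1) pw(2)[OF that(2)]] lev_pos[OF v(1) that(1)] pw(4)[OF that(2)]
      by (auto simp: n_def of_nat_diff Suc_le_eq min_def)
    define R where "R = hgt x + hgt y - 2 * gprod x y"
    have R: "R = (n + s - 1) + (m + t - 1) - 2 * min (min (n + s - 1) (m + t - 1)) M"
      by (simp add: R_def hgt_def gprod_def x y n_def m_def M_def)
    define A where "A = (\<lambda>((a, r), (b, s)). r + real (graph_dist T a b) + s) ` (edge_ends T x \<times> edge_ends T y)"
    have fin: "finite A" by (auto simp: A_def edge_ends_def)
    note gds = gd[OF v(1) w(1), folded n_def m_def M_def]
    have gpv: "real (graph_dist T (par v) w) = (n - 1) + m - 2 * min (n - 1) M" if "v \<noteq> orig"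
      using gd[OF pv(2)[OF that] w(1)] pv[OF that] by (simp add: m_def)
    have gpw: "real (graph_dist T v (par w)) = n + (m - 1) - 2 * min (m - 1) M" if "w \<noteq> orig"
      using gd[OF v(1) pw(2)[OF that]] pw[OF that] by (simp add: n_def)
    have gpvw: "real (graph_dist T (par v) (par w)) = (n - 1) + (m - 1) - 2 * min (n - 1) (min (m - 1) M)"
      if "v \<noteq> orig" "w \<noteq> orig"
      using gd[OF pv(2)[OF that(1)] pw(2)[OF that(2)]] pv[OF that(1)] pw[OF that(2)] pvw[OF that] by simp
    have mem1: "(1 - s) + (n + m - 2 * M) + (1 - t) \<in> A"
      unfolding A_def gds[symmetric]
      by (rule image_eqI[of _ _ "((v, 1 - s), (w, 1 - t))"]) (auto simp: edge_ends_def x y)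
    have mem2: "s + ((n - 1) + m - 2 * min (n - 1) M) + (1 - t) \<in> A" if "v \<noteq> orig"
      unfolding A_def gpv[OF that, symmetric]
      by (rule image_eqI[of _ _ "((par v, s), (w, 1 - t))"]) (use that in \<open>auto simp: edge_ends_def x y\<close>)
    have mem3: "(1 - s) + (n + (m - 1) - 2 * min (m - 1) M) + t \<in> A" if "w \<noteq> orig"
      unfolding A_def gpw[OF that, symmetric]
      by (rule image_eqI[of _ _ "((v, 1 - s), (par w, t))"]) (use that in \<open>auto simp: edge_ends_def x y\<close>)
    have mem4: "s + ((n - 1) + (m - 1) - 2 * min (n - 1) (min (m - 1) M)) + t \<in> A"
      if "v \<noteq> orig" "w \<noteq> orig"
      unfolding A_def gpvw[OF that, symmetric]
      by (rule image_eqI[of _ _ "((par v, s), (par w, t))"]) (use that in \<open>auto simp: edge_ends_def x y\<close>)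
    have cases: "r = (1 - s) + (n + m - 2 * M) + (1 - t)
        \<or> v \<noteq> orig \<and> r = s + ((n - 1) + m - 2 * min (n - 1) M) + (1 - t)
        \<or> w \<noteq> orig \<and> r = (1 - s) + (n + (m - 1) - 2 * min (m - 1) M) + t
        \<or> v \<noteq> orig \<and> w \<noteq> orig \<and> r = s + ((n - 1) + (m - 1) - 2 * min (n - 1) (min (m - 1) M)) + t"
      if rA: "r \<in> A" for r
    proof -
      obtain a r1 b r2 where ab: "(a, r1) \<in> edge_ends T x" "(b, r2) \<in> edge_ends T y"
        and r: "r = r1 + real (graph_dist T a b) + r2"
        using rA by (auto simp: A_def)
      have a: "a = v \<and> r1 = 1 - s \<or> v \<noteq> orig \<and> a = par v \<and> r1 = s"
        using ab(1) by (auto simp: edge_ends_def x split: if_splits)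
      have b: "b = w \<and> r2 = 1 - t \<or> w \<noteq> orig \<and> b = par w \<and> r2 = t"
        using ab(2) by (auto simp: edge_ends_def y split: if_splits)
      show ?thesis
        using a b
      proof (elim disjE conjE)
        assume "a = v" "r1 = 1 - s" "b = w" "r2 = 1 - t"
        then show ?thesis using r gds by (intro disjI1) metis
      next
        assume *: "a = v" "r1 = 1 - s" "w \<noteq> orig" "b = par w" "r2 = t"
        then have "r = (1 - s) + (n + (m - 1) - 2 * min (m - 1) M) + t" using r gpw by metis
        then show ?thesis using * by blast
      next
        assume *: "v \<noteq> orig" "a = par v" "r1 = s" "b = w" "r2 = 1 - t"
        then have "r = s + ((n - 1) + m - 2 * min (n - 1) M) + (1 - t)" using r gpv by metis
        then show ?thesis using * by blast
      next
        assume *: "v \<noteq> orig" "a = par v" "r1 = s" "w \<noteq> orig" "b = par w" "r2 = t"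
        then have "r = s + ((n - 1) + (m - 1) - 2 * min (n - 1) (min (m - 1) M)) + t" using r gpvw by metis
        then show ?thesis using * by blast
      qed
    qed
    have lb: "R \<le> r" if "r \<in> A" for r
      using cases[OF that] M Mi Mne v(2,3) w(2,3) pv(3) pw(3) vr unfolding R
      by (elim disjE) (auto simp: min_def split: if_splits)
    have "R \<in> A"
    proof -
      consider "M = n" "M < m" | "M = m" "M < n" | "M < n" "M < m" using M Mne by linarith
      then show ?thesis
      proof cases
        case 1
        then have "w \<noteq> orig" using vr M Mne by (auto simp: n_def m_def M_def)
        then have "R = (1 - s) + (n + (m - 1) - 2 * min (m - 1) M) + t"
          using 1 Mi v(2,3) w(2,3) unfolding R by (auto simp: min_def)
        then show ?thesis using mem3 \<open>w \<noteq> orig\<close> by simp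
      next
        case 2
        then have "v \<noteq> orig" using vr M Mne by (auto simp: n_def m_def M_def)
        then have "R = s + ((n - 1) + m - 2 * min (n - 1) M) + (1 - t)"
          using 2 Mi v(2,3) w(2,3) unfolding R by (auto simp: min_def)
        then show ?thesis using mem2 \<open>v \<noteq> orig\<close> by simp
      next
        case 3
        then have "v \<noteq> orig" "w \<noteq> orig" using vr by (auto simp: n_def m_def M_def)
        then have "R = s + ((n - 1) + (m - 1) - 2 * min (n - 1) (min (m - 1) M)) + t"
          using 3 Mi v(2,3) w(2,3) unfolding R by (auto simp: min_def)
        then show ?thesis using mem4 \<open>v \<noteq> orig\<close> \<open>w \<noteq> orig\<close> by simp
      qed
    qed
    then have "Min A = R" using lb fin by (intro Min_eqI) auto
    then show ?thesis using False by (simp add: len_dist_def x y A_def R_def)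
  qed
qed

lemma gprod_commute: "x \<in> P \<Longrightarrow> y \<in> P \<Longrightarrow> gprod x y = gprod y x"
  using meet_lev_commute[of "fst x" "fst y"] pointsD(1) by (auto simp: gprod_def)

lemma gprod_le: "gprod x y \<le> hgt x" "gprod x y \<le> hgt y"
  by (auto simp: gprod_def)

lemma gprod_self: "x \<in> P \<Longrightarrow> gprod x x = hgt x"
  using pointsD[of x] by (auto simp: gprod_def meet_lev_self hgt_def)

lemma gprod_nonneg: "x \<in> P \<Longrightarrow> y \<in> P \<Longrightarrow> 0 \<le> gprod x y"
  using hgt_nonneg by (auto simp: gprod_def)

lemma gprod_ultra:
  assumes "x \<in> P" "y \<in> P" "z \<in> P"
  shows "min (gprod x y) (gprod y z) \<le> gprod x z"
proof -
  have "real (min (meet_lev (fst x) (fst y)) (meet_lev (fst y) (fst z))) \<le> real (meet_lev (fst x) (fst z))"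
    using meet_lev_ultra pointsD(1) assms by (simp only: of_nat_le_iff)
  then show ?thesis unfolding gprod_def of_nat_min by linarith
qed

lemma height_eq: "x \<in> P \<Longrightarrow> height T x = hgt x"
  using hgt_nonneg[of x] by (simp add: height_def vertex_point_def len_dist_eq) (simp add: hgt_def gprod_def)

lemma point_eqI:
  assumes "x \<in> P" "y \<in> P" "gprod x y = hgt x" "gprod x y = hgt y"
  shows "x = y"
proof -
  have h: "hgt x = hgt y" using assms by simp
  note p = pointsD[OF assms(1)] pointsD[OF assms(2)]
  have l: "lev (fst x) = lev (fst y)" using h p unfolding hgt_def by linarith
  then have s: "snd x = snd y" using h by (simp add: hgt_def)
  have "real (lev (fst x)) < real (meet_lev (fst x) (fst y)) + 1"
    using assms(3) p unfolding gprod_def hgt_def by linarith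
  then have "meet_lev (fst x) (fst y) = lev (fst x)" using meet_lev_le(1)[of "fst x" "fst y"] p by linarith
  then have "fst x = fst y" using meet_lev_eq_lev[of "fst x" "fst y"] p l by simp
  then show ?thesis using s by (simp add: prod_eq_iff)
qed

text \<open>The geodesic from the root to a point.\<close>

definition stem :: "'v point \<Rightarrow> 'v point set" where
  "stem x = {z \<in> P. gprod x z = hgt z}"

lemma stem_iff:
  assumes "(v, s) \<in> P"
  shows "(w, t) \<in> stem (v, s) \<longleftrightarrow>
    (w, t) \<in> P \<and> (if w = v then t \<le> s else lev w < lev v \<and> anc v (lev w) = w)"
proof (cases "(w, t) \<in> P")
  case True
  note p = pointsD[OF assms, simplified] pointsD[OF True, simplified]
  have "gprod (v, s) (w, t) = hgt (w, t) \<longleftrightarrow> hgt (w, t) \<le> hgt (v, s) \<and> hgt (w, t) \<le> meet_lev v w"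
    by (auto simp: gprod_def)
  also have "hgt (w, t) \<le> meet_lev v w \<longleftrightarrow> lev w \<le> meet_lev v w"
  proof
    assume "hgt (w, t) \<le> meet_lev v w"
    then have "real (lev w) < real (meet_lev v w) + 1" using p unfolding hgt_def by simp
    then show "lev w \<le> meet_lev v w" by linarith
  qed (use p in \<open>simp add: hgt_def\<close>)
  also have "lev w \<le> meet_lev v w \<longleftrightarrow> lev w \<le> lev v \<and> anc v (lev w) = w"
    using le_meet_lev_iff[of v w "lev w"] p by auto
  also have "hgt (w, t) \<le> hgt (v, s) \<and> (lev w \<le> lev v \<and> anc v (lev w) = w) \<longleftrightarrow>
      (if w = v then t \<le> s else lev w < lev v \<and> anc v (lev w) = w)"
  proof (cases "w = v")
    case False
    have "lev w \<le> lev v \<and> anc v (lev w) = w \<longleftrightarrow> lev w < lev v \<and> anc v (lev w) = w"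
      using False by (metis anc_lev le_eq_less_or_eq)
    moreover have "hgt (w, t) \<le> hgt (v, s)" if "lev w < lev v"
    proof -
      have "real (lev w) + 1 \<le> real (lev v)" using that by linarith
      then show ?thesis using p by (simp add: hgt_def)
    qed
    ultimately show ?thesis using False by auto
  qed (auto simp: hgt_def)
  finally show ?thesis using True by (simp add: stem_def)
qed (simp add: stem_def)

lemma stem_origin: "stem origin_pt = {origin_pt}"
  by (auto simp: stem_iff points_def split: if_splits)

lemma stem_step:
  assumes "(v, s) \<in> P" "v \<noteq> orig"
  shows "stem (v, s) = stem (par v, 1) \<union> {v} \<times> {0<..s}" "stem (par v, 1) \<inter> {v} \<times> {0<..s} = {}"
proof -
  note p = pointsD[OF assms(1), simplified]
  have pv: "par v \<in> V" "Suc (lev (par v)) = lev v" using par[OF p(1) assms(2)] by auto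
  have *: "(w, t) \<in> stem (par v, 1) \<longleftrightarrow> (w, t) \<in> P \<and> lev w < lev v \<and> anc v (lev w) = w" for w t
  proof (cases "(w, t) \<in> P")
    case True
    note q = pointsD[OF True, simplified]
    have "(w = par v \<or> lev w < lev (par v) \<and> anc (par v) (lev w) = w) \<longleftrightarrow> lev w < lev v \<and> anc v (lev w) = w"
    proof (cases "lev w < lev v")
      case True
      then have "anc (par v) (lev w) = anc v (lev w)" using anc_par p(1) assms(2) by simp
      moreover have "lev w = lev (par v) \<Longrightarrow> anc (par v) (lev w) = par v" by simp
      ultimately show ?thesis using True pv by (metis anc_lev less_Suc_eq)
    qed (use pv in auto)
    then show ?thesis using True q stem_iff[of "par v" 1 w t] pv by auto
  qed (simp add: stem_def)
  show "stem (v, s) = stem (par v, 1) \<union> {v} \<times> {0<..s}"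
  proof (rule set_eqI, clarify)
    fix w t
    show "(w, t) \<in> stem (v, s) \<longleftrightarrow> (w, t) \<in> stem (par v, 1) \<union> {v} \<times> {0<..s}"
      using assms p * stem_iff[OF assms(1), of w t] by (auto simp: points_def)
  qed
  show "stem (par v, 1) \<inter> {v} \<times> {0<..s} = {}" using * by auto
qed

text \<open>
  The branch point of the stems of \<open>x\<close> and \<open>y\<close>.
\<close>

definition meet :: "'v point \<Rightarrow> 'v point \<Rightarrow> 'v point" where
  "meet x y = (if gprod x y = hgt x then x else if gprod x y = hgt y then y
     else (anc (fst x) (meet_lev (fst x) (fst y)), 1))"

lemma
  assumes "x \<in> P" "y \<in> P"
  shows meet_in: "meet x y \<in> P" and hgt_meet: "hgt (meet x y) = gprod x y"
    and stem_meet: "stem (meet x y) = stem x \<inter> stem y"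
proof -
  note px = pointsD[OF assms(1)] and py = pointsD[OF assms(2)]
  let ?q = "meet x y"
  have q: "?q \<in> P \<and> hgt ?q = gprod x y \<and> gprod ?q x = hgt ?q \<and> gprod ?q y = hgt ?q"
  proof (cases "gprod x y = hgt x \<or> gprod x y = hgt y")
    case True
    then show ?thesis using assms gprod_self gprod_commute by (auto simp: meet_def)
  next
    case False
    define k where "k = meet_lev (fst x) (fst y)"
    have g: "gprod x y = k" "k \<le> hgt x" "k \<le> hgt y" using False by (auto simp: gprod_def k_def min_def split: if_splits)
    have k: "k \<le> lev (fst x)" "k \<le> lev (fst y)" "anc (fst x) k = anc (fst y) k"
      using le_meet_lev_iff[of "fst x" "fst y" k] px py by (auto simp: k_def)
    define a where "a = anc (fst x) k"
    have a: "a \<in> V" "lev a = k" using px(1) k(1) unfolding a_def by simp_all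
    have "meet_lev a (fst x) = lev a" "meet_lev a (fst y) = lev a"
    proof -
      have "anc (fst x) (lev a) = a" "anc (fst y) (lev a) = a" using a k by (simp_all add: a_def)
      then show "meet_lev a (fst x) = lev a" "meet_lev a (fst y) = lev a"
        using a px(1) py(1) k(1,2) meet_lev_eq_lev[of a "fst x"] meet_lev_eq_lev[of a "fst y"] by simp_all
    qed
    then have "gprod (a, 1) x = hgt (a, 1)" "gprod (a, 1) y = hgt (a, 1)"
      using a g by (auto simp: gprod_def hgt_def)
    moreover have "?q = (a, 1)" using False by (simp add: meet_def a_def k_def)
    ultimately show ?thesis using a g by (simp add: hgt_def)
  qed
  then show "?q \<in> P" "hgt ?q = gprod x y" by auto
  show "stem ?q = stem x \<inter> stem y"
  proof -
    have "gprod ?q z = hgt z \<longleftrightarrow> gprod x z = hgt z \<and> gprod y z = hgt z" if z: "z \<in> P" for z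
    proof (rule three_products_meet)
      have e: "gprod x ?q = hgt ?q" "gprod y ?q = hgt ?q" "gprod z y = gprod y z" "hgt ?q = gprod x y"
        using q gprod_commute assms z by metis+
      have P: "?q \<in> P" "gprod ?q x = hgt ?q" using q by auto
      show "gprod ?q z \<le> hgt z" "gprod x z \<le> hgt z" "gprod y z \<le> hgt z" "gprod ?q z \<le> hgt ?q"
        by (rule gprod_le)+
      show "min (hgt ?q) (gprod ?q z) \<le> gprod x z" using gprod_ultra[OF assms(1) P(1) z] e by simp
      show "min (hgt ?q) (gprod ?q z) \<le> gprod y z" using gprod_ultra[OF assms(2) P(1) z] e by simp
      show "min (gprod x z) (gprod y z) \<le> hgt ?q" using gprod_ultra[OF assms(1) z assms(2)] e by simp
      show "min (hgt ?q) (gprod x z) \<le> gprod ?q z" using gprod_ultra[OF P(1) assms(1) z] P by simp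
    qed
    then show ?thesis by (auto simp: stem_def)
  qed
qed

text \<open>
  By the formula for distances, \<open>z\<close> lies on \<open>[x, y]\<close> iff
  \<open>gprod x z + gprod z y = hgt z + gprod x y\<close>. As the two smallest of the three products agree, this
  says that \<open>z\<close> lies on one of the two stems and at least as high as their branch point. Thus
  integrals over segments become integrals over stems.
\<close>

lemma segment_eq:
  assumes "x \<in> P" "y \<in> P"
  shows "segment T x y = (stem x - stem y) \<union> (stem y - stem x) \<union> {meet x y}"
proof (rule set_eqI)
  fix z
  note m = meet_in[OF assms] hgt_meet[OF assms] stem_meet[OF assms]
  show "z \<in> segment T x y \<longleftrightarrow> z \<in> (stem x - stem y) \<union> (stem y - stem x) \<union> {meet x y}"
  proof (cases "z \<in> P")
    case z: True
    have "z \<in> segment T x y \<longleftrightarrow> gprod x z + gprod z y = hgt z + gprod x y"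
      using z assms by (auto simp: segment_def len_dist_eq)
    also have "\<dots> \<longleftrightarrow> (gprod x z = hgt z \<or> gprod y z = hgt z) \<and> gprod x y \<le> hgt z"
      unfolding gprod_commute[OF z assms(2)]
      using gprod_le[of x z] gprod_le[of y z] gprod_commute[OF assms] gprod_commute[OF z assms(2)]
        gprod_ultra[OF assms(1) z assms(2)] gprod_ultra[OF assms(1,2) z] gprod_ultra[OF assms(2,1) z]
      by (intro three_products) (simp_all add: min.commute)
    also have "\<dots> \<longleftrightarrow> z \<in> (stem x - stem y) \<union> (stem y - stem x) \<union> {meet x y}"
    proof (cases "z \<in> stem x \<inter> stem y")
      case True
      then have s: "gprod (meet x y) z = hgt z" using m by (auto simp: stem_def)
      have "gprod x y \<le> hgt z \<longleftrightarrow> z = meet x y"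
        using s m gprod_le[of "meet x y" z] point_eqI[OF m(1) z] gprod_self[OF z] by auto
      then show ?thesis using True by (auto simp: stem_def)
    next
      case False
      moreover have "z \<noteq> meet x y"
      proof -
        have "meet x y \<in> stem (meet x y)" using m(1) gprod_self[OF m(1)] unfolding stem_def by blast
        then show ?thesis using False m(3) by blast
      qed
      moreover have "gprod x y \<le> hgt z" if "gprod x z = hgt z" "gprod y z \<noteq> hgt z"
        using that gprod_ultra[OF assms(2,1) z] gprod_le[of y z] gprod_commute[OF assms]
        by (auto simp: min_def split: if_splits)
      moreover have "gprod x y \<le> hgt z" if "gprod y z = hgt z" "gprod x z \<noteq> hgt z"
        using that gprod_ultra[OF assms(1,2) z] gprod_le[of x z]
        by (auto simp: min_def split: if_splits)
      ultimately show ?thesis using z by (auto simp: stem_def)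
    qed
    finally show ?thesis .
  next
    case False
    then show ?thesis using m by (auto simp: segment_def stem_def)
  qed
qed

lemma len_dist_commute: "len_dist T x y = len_dist T y x"
proof -
  have "(\<lambda>((a, r), (b, s)). r + real (graph_dist T a b) + s) ` (edge_ends T x \<times> edge_ends T y) =
    (\<lambda>((a, r), (b, s)). r + real (graph_dist T a b) + s) ` (edge_ends T y \<times> edge_ends T x)"
    (is "?f ` (?A \<times> ?B) = _")
  proof -
    have "?f ` (?B \<times> ?A) = ?f ` (prod.swap ` (?A \<times> ?B))" by (simp only: product_swap)
    also have "\<dots> = (?f \<circ> prod.swap) ` (?A \<times> ?B)" by (simp only: image_comp)
    also have "?f \<circ> prod.swap = ?f" by (auto simp: fun_eq_iff graph_dist_commute)
    finally show ?thesis by simp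
  qed
  then show ?thesis by (simp add: len_dist_def abs_minus_commute)
qed

lemma segment_commute: "segment T x y = segment T y x"
proof -
  have "len_dist T x z + len_dist T z y = len_dist T x y \<longleftrightarrow> len_dist T y z + len_dist T z x = len_dist T y x" for z
    using len_dist_commute[of x z] len_dist_commute[of z y] len_dist_commute[of x y] by auto
  then show ?thesis by (simp add: segment_def)
qed

lemma boundary_vertex:
  assumes "\<zeta> \<in> boundary T"
  shows "vertex_point (\<zeta> n) \<in> P" "hgt (vertex_point (\<zeta> n)) = n"
  using assms boundary_in[of \<zeta> n] by (auto simp: vertex_point_def hgt_def)

end

section \<open>Levels of a regular tree\<close>

locale kary_tree = tree T for T :: "'v rtree" +
  fixes K :: nat and \<epsilon> :: real
  assumes K_ge_2: "2 \<le> K" and eps: "0 < \<epsilon>"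
    and finite_children: "\<And>x. x \<in> V \<Longrightarrow> finite (children T x)"
    and card_children: "\<And>x. x \<in> V \<Longrightarrow> card (children T x) = K"
begin

definition level :: "nat \<Rightarrow> 'v set" where
  "level n = {v \<in> V. lev v = n}"

abbreviation "V0 \<equiv> V - {orig}"

lemma levelD: "v \<in> level n \<Longrightarrow> v \<in> V" "v \<in> level n \<Longrightarrow> lev v = n"
  by (auto simp: level_def)

lemma level_0: "level 0 = {orig}"
  using lev_eq_0 by (auto simp: level_def)

lemma child_iff: "v \<in> level n \<Longrightarrow> w \<in> children T v \<longleftrightarrow> w \<in> level (Suc n) \<and> par w = v"
  using children_iff[of v w] par(2)[of w] lev_eq_0[of w] by (auto simp: level_def)

lemma par_level: "w \<in> level (Suc n) \<Longrightarrow> par w \<in> level n"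
  using par[of w] lev_eq_0[of w] by (auto simp: level_def)

lemma level_Suc: "level (Suc n) = (\<Union>v\<in>level n. children T v)"
  using child_iff par_level by blast

lemma finite_level [simp]: "finite (level n)"
proof (induction n)
  case (Suc n)
  show ?case unfolding level_Suc using Suc finite_children[OF levelD(1)] by (intro finite_UN_I)
qed (simp add: level_0)

lemma sum_level_Suc:
  fixes f :: "'v \<Rightarrow> 'b :: comm_monoid_add"
  shows "(\<Sum>w\<in>level (Suc n). f w) = (\<Sum>v\<in>level n. \<Sum>w\<in>children T v. f w)"
  unfolding level_Suc
proof (rule sum.UNION_disjoint)
  show "\<forall>i\<in>level n. \<forall>j\<in>level n. i \<noteq> j \<longrightarrow> children T i \<inter> children T j = {}"
    by (auto simp: child_iff)
qed (simp_all add: finite_children[OF levelD(1)])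

lemma card_level: "card (level n) = K ^ n"
proof (induction n)
  case (Suc n)
  have "card (level (Suc n)) = (\<Sum>w\<in>level (Suc n). 1)" by simp
  also have "\<dots> = (\<Sum>v\<in>level n. K)"
    unfolding sum_level_Suc by (intro sum.cong refl) (simp add: card_children[OF levelD(1)])
  finally show ?case using Suc by simp
qed (simp add: level_0)

lemma V0_levels: "V0 = (\<Union>n. level (Suc n))"
proof -
  have "v \<in> level (Suc (lev v - 1))" if "v \<in> V0" for v
    using that lev_pos[of v] by (auto simp: level_def)
  moreover have "orig \<notin> level (Suc n)" for n by (auto simp: level_def)
  ultimately show ?thesis by (auto dest: levelD(1))
qed

lemma countable_V [simp]: "countable V"
proof -
  have "V = (\<Union>n. level n)" by (auto simp: level_def)
  then show ?thesis by (metis countable_UN countable_finite countableI_type finite_level)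
qed

lemma nn_integral_V0:
  "(\<integral>\<^sup>+v. f v \<partial>count_space V0) = (\<Sum>n. \<Sum>v\<in>level (Suc n). f v)"
proof -
  have "(\<integral>\<^sup>+v. f v \<partial>count_space V0) = (\<integral>\<^sup>+v. (\<Sum>n. f v * indicator (level (Suc n)) v) \<partial>count_space V0)"
  proof (rule nn_integral_cong)
    fix v assume "v \<in> space (count_space V0)"
    then have v: "v \<in> V0" by simp
    then obtain n where n: "v \<in> level (Suc n)" using V0_levels by blast
    then have "f v * indicator (level (Suc m)) v = (if m = n then f v else 0)" for m
      by (auto simp: level_def)
    then show "f v = (\<Sum>n. f v * indicator (level (Suc n)) v)"
      using sums_If_finite_set[of "{n}" "\<lambda>_. f v"] by (auto simp: sums_iff)
  qed
  also have "\<dots> = (\<Sum>n. \<integral>\<^sup>+v. f v * indicator (level (Suc n)) v \<partial>count_space V0)"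
    by (rule nn_integral_suminf) simp
  also have "\<dots> = (\<Sum>n. \<Sum>v\<in>level (Suc n). f v)"
  proof (rule suminf_cong)
    fix n
    have "level (Suc n) \<subseteq> V0" using V0_levels by blast
    then show "(\<integral>\<^sup>+v. f v * indicator (level (Suc n)) v \<partial>count_space V0) = (\<Sum>v\<in>level (Suc n). f v)"
      by (subst nn_integral_count_space'[of "level (Suc n)"]) (auto intro!: sum.cong)
  qed
  finally show ?thesis .
qed


section \<open>Integration over the edges\<close>

abbreviation "unit_len \<equiv> restrict_space lborel {0<..1 :: real}"
abbreviation "E \<equiv> edge_measure T"

lemma space_unit_len [simp]: "space unit_len = {0<..1}"
  by (simp add: space_restrict_space)

lemma space_E: "space E = V0 \<times> {0<..1}"
  by (simp add: edge_measure_def space_pair_measure)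

lemma space_E_points: "z \<in> space E \<Longrightarrow> z \<in> P" "z \<in> space E \<Longrightarrow> z \<noteq> origin_pt"
  by (auto simp: space_E points_def)

lemma measurable_edgeI:
  "(\<And>v. v \<in> V0 \<Longrightarrow> (\<lambda>t. F (v, t)) \<in> measurable unit_len N) \<Longrightarrow> F \<in> measurable E N"
  unfolding edge_measure_def by (rule measurable_pair_measure_countable1) auto

lemma measurable_edgeD:
  assumes "F \<in> measurable E N" "v \<in> V0"
  shows "(\<lambda>t. F (v, t)) \<in> measurable unit_len N"
proof -
  have "Pair v \<in> measurable unit_len E"
    unfolding edge_measure_def using assms(2) by (intro measurable_Pair1') simp
  from measurable_compose[OF this assms(1)] show ?thesis .
qed

lemma sets_E_I:
  assumes "A \<subseteq> space E" "\<And>v. v \<in> V0 \<Longrightarrow> {t \<in> {0<..1}. (v, t) \<in> A} \<in> sets lborel"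
  shows "A \<in> sets E"
proof -
  have "(\<lambda>z. z \<in> A) \<in> measurable E (count_space UNIV)"
  proof (rule measurable_edgeI)
    fix v assume "v \<in> V0"
    then have "{t \<in> space unit_len. (v, t) \<in> A} \<in> sets unit_len"
      using assms(2)[of v] by (auto simp: sets_restrict_space_iff)
    then show "(\<lambda>t. (v, t) \<in> A) \<in> measurable unit_len (count_space UNIV)"
      by (simp add: pred_def)
  qed
  then have "{z \<in> space E. z \<in> A} \<in> sets E" by simp
  also have "{z \<in> space E. z \<in> A} = A" using assms(1) by auto
  finally show ?thesis .
qed

lemma nn_integral_edges:
  assumes "F \<in> borel_measurable E"
  shows "(\<integral>\<^sup>+z. F z \<partial>E) = (\<integral>\<^sup>+v. (\<integral>\<^sup>+t\<in>{0<..1}. F (v, t) \<partial>lborel) \<partial>count_space V0)"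
proof -
  interpret sigma_finite_measure unit_len
    by (rule sigma_finite_measure_restrict_space) (auto intro: lborel.sigma_finite_measure_axioms)
  have "(\<integral>\<^sup>+z. F z \<partial>E) = (\<integral>\<^sup>+v. \<integral>\<^sup>+t. F (v, t) \<partial>unit_len \<partial>count_space V0)"
    using assms unfolding edge_measure_def by (subst nn_integral_fst) auto
  also have "\<dots> = (\<integral>\<^sup>+v. (\<integral>\<^sup>+t\<in>{0<..1}. F (v, t) \<partial>lborel) \<partial>count_space V0)"
    by (subst nn_integral_restrict_space) auto
  finally show ?thesis .
qed

lemma part_in_E:
  assumes "v \<in> V0" "B \<in> sets borel" "B \<subseteq> {0<..1}"
  shows "{v} \<times> B \<in> sets E"
proof (rule sets_E_I)
  fix w assume "w \<in> V0"
  have "{t \<in> {0<..1}. (w, t) \<in> {v} \<times> B} = (if w = v then B else {})" using assms by auto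
  then show "{t \<in> {0<..1}. (w, t) \<in> {v} \<times> B} \<in> sets lborel" using assms by simp
qed (use assms in \<open>auto simp: space_E\<close>)

lemma nn_integral_edge_part:
  assumes "F \<in> borel_measurable E" "v \<in> V0" "B \<in> sets borel" "B \<subseteq> {0<..1}"
  shows "(\<integral>\<^sup>+z. F z * indicator ({v} \<times> B) z \<partial>E) = (\<integral>\<^sup>+t\<in>B. F (v, t) \<partial>lborel)"
proof -
  note [measurable] = assms(1) part_in_E[OF assms(2-4)]
  have "(\<integral>\<^sup>+z. F z * indicator ({v} \<times> B) z \<partial>E)
      = (\<integral>\<^sup>+w. (\<integral>\<^sup>+t\<in>{0<..1}. F (w, t) * indicator ({v} \<times> B) (w, t) \<partial>lborel) \<partial>count_space V0)"
    by (rule nn_integral_edges) measurable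
  also have "\<dots> = (\<integral>\<^sup>+w. (\<integral>\<^sup>+t\<in>B. F (w, t) \<partial>lborel) * indicator {v} w \<partial>count_space V0)"
    using assms(4)
    by (intro nn_integral_cong) (auto split: split_indicator intro!: nn_integral_cong)
  also have "\<dots> = (\<integral>\<^sup>+t\<in>B. F (v, t) \<partial>lborel)" using assms(2) by simp
  finally show ?thesis .
qed

lemma AE_edgeI:
  assumes "{z \<in> space E. Q z} \<in> sets E"
    and "\<And>v. v \<in> V0 \<Longrightarrow> AE t in lborel. t \<in> {0<..1} \<longrightarrow> Q (v, t)"
  shows "AE z in E. Q z"
proof -
  let ?N = "space E - {z \<in> space E. Q z}"
  have N: "?N \<in> sets E" using assms(1) by blast
  have "emeasure E ?N = (\<integral>\<^sup>+z. indicator ?N z \<partial>E)" using N by simp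
  also have "\<dots> = (\<integral>\<^sup>+v. (\<integral>\<^sup>+t\<in>{0<..1}. indicator ?N (v, t) \<partial>lborel) \<partial>count_space V0)"
    using N by (intro nn_integral_edges) simp
  also have "\<dots> = (\<integral>\<^sup>+v. 0 \<partial>count_space V0)"
  proof (rule nn_integral_cong)
    fix v assume v: "v \<in> space (count_space V0)"
    have "(\<integral>\<^sup>+t\<in>{0<..1}. indicator ?N (v, t) \<partial>lborel) = (\<integral>\<^sup>+t. 0 \<partial>(lborel :: real measure))"
      using assms(2)[of v] v by (intro nn_integral_cong_AE) (auto split: split_indicator)
    then show "(\<integral>\<^sup>+t\<in>{0<..1}. indicator ?N (v, t) \<partial>lborel) = 0" by simp
  qed
  finally show ?thesis using N by (intro AE_I[of _ _ ?N]) auto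
qed

lemma AE_edge_neq: "AE z in E. z \<noteq> a"
proof (rule AE_edgeI)
  show "{z \<in> space E. z \<noteq> a} \<in> sets E"
  proof (rule sets_E_I)
    fix v
    have "{t \<in> {0<..1}. (v, t) \<in> {z \<in> space E. z \<noteq> a}} =
        {0<..1} \<inter> (if v \<in> V0 then - (if v = fst a then {snd a} else {}) else {})"
      by (auto simp: space_E prod_eq_iff)
    then show "{t \<in> {0<..1}. (v, t) \<in> {z \<in> space E. z \<noteq> a}} \<in> sets lborel" by simp
  qed auto
  fix v
  have "AE t in lborel. t \<noteq> snd a" by (rule AE_lborel_singleton)
  then show "AE t in lborel. t \<in> {0<..1} \<longrightarrow> (v, t) \<noteq> a" by eventually_elim auto
qed

lemma integral_edge_part:
  fixes F :: "'v point \<Rightarrow> real"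
  assumes "F \<in> borel_measurable E" "v \<in> V0" "B \<in> sets borel" "B \<subseteq> {0<..1}"
    and "set_integrable lborel B (\<lambda>t. F (v, t))"
  shows "set_integrable E ({v} \<times> B) F" "(LINT z:{v} \<times> B|E. F z) = (LINT t:B|lborel. F (v, t))"
proof -
  note [measurable] = assms(1) part_in_E[OF assms(2-4)]
  have *: "(\<integral>\<^sup>+z. ennreal (c * (indicator ({v} \<times> B) z *\<^sub>R F z)) \<partial>E)
      = (\<integral>\<^sup>+t. ennreal (c * (indicator B t *\<^sub>R F (v, t))) \<partial>lborel)" for c
  proof -
    have "(\<integral>\<^sup>+z. ennreal (c * (indicator ({v} \<times> B) z *\<^sub>R F z)) \<partial>E)
      = (\<integral>\<^sup>+z. ennreal (c * F z) * indicator ({v} \<times> B) z \<partial>E)"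
      by (intro nn_integral_cong) (auto split: split_indicator)
    also have "\<dots> = (\<integral>\<^sup>+t\<in>B. ennreal (c * F (v, t)) \<partial>lborel)"
      using assms by (intro nn_integral_edge_part) auto
    also have "\<dots> = (\<integral>\<^sup>+t. ennreal (c * (indicator B t *\<^sub>R F (v, t))) \<partial>lborel)"
      by (intro nn_integral_cong) (auto split: split_indicator)
    finally show ?thesis .
  qed
  have "(\<integral>\<^sup>+z. ennreal (norm (indicator ({v} \<times> B) z *\<^sub>R F z)) \<partial>E)
    = (\<integral>\<^sup>+z. ennreal \<bar>F z\<bar> * indicator ({v} \<times> B) z \<partial>E)"
    by (intro nn_integral_cong) (auto split: split_indicator)
  also have "\<dots> = (\<integral>\<^sup>+t\<in>B. ennreal \<bar>F (v, t)\<bar> \<partial>lborel)"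
    using assms by (intro nn_integral_edge_part) auto
  also have "\<dots> = (\<integral>\<^sup>+t. ennreal (norm (indicator B t *\<^sub>R F (v, t))) \<partial>lborel)"
    by (intro nn_integral_cong) (auto split: split_indicator)
  also have "\<dots> < \<infinity>" using assms(5) by (simp add: set_integrable_def integrable_iff_bounded)
  finally show int: "set_integrable E ({v} \<times> B) F"
    unfolding set_integrable_def integrable_iff_bounded by simp
  show "(LINT z:{v} \<times> B|E. F z) = (LINT t:B|lborel. F (v, t))"
    using int assms(5) *[of 1] *[of "-1"]
    by (simp add: set_integrable_def set_lebesgue_integral_def real_lebesgue_integral_def)
qed

text \<open>
  The fundamental theorem of calculus along the geodesic from the root: it suffices to know the
  increments of \<open>\<Phi>\<close> on each edge.
\<close>

lemma integral_stem:
  fixes F :: "'v point \<Rightarrow> real"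
  assumes F: "F \<in> borel_measurable E"
    and edge: "\<And>v s. (v, s) \<in> P \<Longrightarrow> v \<noteq> orig \<Longrightarrow> set_integrable lborel {0<..s} (\<lambda>t. F (v, t)) \<and>
      (LINT t:{0<..s}|lborel. F (v, t)) = \<Phi> (v, s) - \<Phi> (par v, 1)"
    and "x \<in> P"
  shows "set_integrable E (stem x) F \<and> (LINT z:stem x|E. F z) = \<Phi> x - \<Phi> origin_pt"
  using \<open>x \<in> P\<close>
proof (induction "lev (fst x)" arbitrary: x rule: less_induct)
  case less
  obtain v s where x: "x = (v, s)" by force
  note p = pointsD[OF less.prems, unfolded x, simplified]
  show ?case
  proof (cases "v = orig")
    case True
    then have "x = origin_pt" using p x by simp
    moreover have *: "indicator {origin_pt} z *\<^sub>R F z = 0" if "z \<in> space E" for z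
      using space_E_points(2)[OF that] by simp
    have "integrable E (\<lambda>z. indicator {origin_pt} z *\<^sub>R F z) \<longleftrightarrow> integrable E (\<lambda>z. 0 :: real)"
      "(\<integral>z. indicator {origin_pt} z *\<^sub>R F z \<partial>E) = (\<integral>z. 0 \<partial>E)"
      by (intro Bochner_Integration.integrable_cong Bochner_Integration.integral_cong refl *; assumption)+
    ultimately show ?thesis
      by (simp add: stem_origin set_integrable_def set_lebesgue_integral_def)
  next
    case False
    let ?B = "{v} \<times> {0<..s}" and ?A = "stem (par v, 1)"
    have pv: "par v \<in> V" "lev (par v) < lev v" using par[OF p(1) False] by auto
    then have IH: "set_integrable E ?A F" "(LINT z:?A|E. F z) = \<Phi> (par v, 1) - \<Phi> origin_pt"
      using less.hyps[of "(par v, 1)"] x by auto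
    have B: "set_integrable E ?B F" "(LINT z:?B|E. F z) = \<Phi> (v, s) - \<Phi> (par v, 1)"
    proof -
      have "{0<..s} \<subseteq> {0<..1}" using p by auto
      then show "set_integrable E ?B F" "(LINT z:?B|E. F z) = \<Phi> (v, s) - \<Phi> (par v, 1)"
        using integral_edge_part[OF F, of v "{0<..s}"] edge[of v s] False p less.prems x by auto
    qed
    have *: "indicator (stem x) z *\<^sub>R F z = indicator ?A z *\<^sub>R F z + indicator ?B z *\<^sub>R F z" for z
      using stem_step[of v s] less.prems x False by (auto split: split_indicator)
    show ?thesis using IH B
      unfolding set_integrable_def set_lebesgue_integral_def * by (simp add: x)
  qed
qed

section \<open>The metric of the tree\<close>

lemma hgt_par: "v \<in> V0 \<Longrightarrow> hgt (par v, 1) = real (lev v) - 1"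
  using par(2)[of v] by (simp add: hgt_def)

lemma measurable_hgt: "hgt \<in> borel_measurable E"
  by (rule measurable_edgeI) (simp add: hgt_def measurable_restrict_space1)

lemma integral_stem_weight:
  assumes "x \<in> P"
  shows "set_integrable E (stem x) (\<lambda>z. exp (- \<epsilon> * hgt z))"
    and "(LINT z:stem x|E. exp (- \<epsilon> * hgt z)) = (1 - exp (- \<epsilon> * hgt x)) / \<epsilon>"
proof -
  define \<Phi> where "\<Phi> x = - exp (- \<epsilon> * hgt x) / \<epsilon>" for x
  have "set_integrable E (stem x) (\<lambda>z. exp (- \<epsilon> * hgt z)) \<and>
      (LINT z:stem x|E. exp (- \<epsilon> * hgt z)) = \<Phi> x - \<Phi> origin_pt"
  proof (rule integral_stem[OF _ _ assms])
    show "(\<lambda>z. exp (- \<epsilon> * hgt z)) \<in> borel_measurable E" using measurable_hgt by measurable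
    fix v s assume vs: "(v, s) \<in> P" "v \<noteq> orig"
    note p = pointsD[OF vs(1), simplified]
    define c where "c = real (lev v) - 1"
    let ?f = "\<lambda>t. exp (- \<epsilon> * (c + t))" and ?F = "\<lambda>t. - exp (- \<epsilon> * (c + t)) / \<epsilon>"
    have "has_bochner_integral lborel (\<lambda>t. ?f t * indicator {0..s} t) (?F s - ?F 0)"
      using p eps by (intro has_bochner_integral_FTC_Icc_real) (auto intro!: derivative_eq_intros continuous_intros)
    then have "has_bochner_integral lborel (\<lambda>t. indicator {0<..s} t *\<^sub>R ?f t) (?F s - ?F 0)"
    proof (rule has_bochner_integralI_AE)
      have "AE t in lborel. t \<noteq> (0::real)" by (rule AE_lborel_singleton)
      then show "AE t in lborel. ?f t * indicator {0..s} t = indicator {0<..s} t *\<^sub>R ?f t"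
        by eventually_elim (auto split: split_indicator)
    qed auto
    moreover have "hgt (v, t) = c + t" for t by (simp add: hgt_def c_def)
    moreover have "hgt (par v, 1) = c" using hgt_par[of v] p vs by (simp add: c_def)
    ultimately show "set_integrable lborel {0<..s} (\<lambda>t. exp (- \<epsilon> * hgt (v, t))) \<and>
      (LINT t:{0<..s}|lborel. exp (- \<epsilon> * hgt (v, t))) = \<Phi> (v, s) - \<Phi> (par v, 1)"
      by (simp add: set_integrable_def set_lebesgue_integral_def has_bochner_integral_iff \<Phi>_def)
  qed
  then show "set_integrable E (stem x) (\<lambda>z. exp (- \<epsilon> * hgt z))"
    "(LINT z:stem x|E. exp (- \<epsilon> * hgt z)) = (1 - exp (- \<epsilon> * hgt x)) / \<epsilon>"
    using eps by (simp_all add: \<Phi>_def hgt_def diff_divide_distrib)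
qed

text \<open>
  The weight of a stem ending at height \<open>r\<close> is \<open>(1 - e\<^sup>-\<^sup>\<epsilon>\<^sup>r) / \<epsilon>\<close>. A segment is the symmetric difference of two
  stems, whose intersection is the stem of the branch point.
\<close>

lemma dX_eq:
  assumes "x \<in> P" "y \<in> P"
  shows "dX T \<epsilon> x y =
    (2 * exp (- \<epsilon> * gprod x y) - exp (- \<epsilon> * hgt x) - exp (- \<epsilon> * hgt y)) / \<epsilon>"
proof -
  define w where "w z = exp (- \<epsilon> * hgt z)" for z :: "'v point"
  let ?q = "meet x y"
  note q = meet_in[OF assms] hgt_meet[OF assms] stem_meet[OF assms]
  have I: "integrable E (\<lambda>z. indicator (stem u) z *\<^sub>R w z)"
    "(\<integral>z. indicator (stem u) z *\<^sub>R w z \<partial>E) = (1 - exp (- \<epsilon> * hgt u)) / \<epsilon>" if "u \<in> P" for u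
    using integral_stem_weight[OF that] by (simp_all add: set_integrable_def set_lebesgue_integral_def w_def)
  have "AE z in E. indicator {?q} z *\<^sub>R w z = 0"
    using AE_edge_neq[of ?q] by eventually_elim simp
  moreover have "(\<lambda>z. indicator {?q} z *\<^sub>R w z) \<in> borel_measurable E"
  proof -
    have "{z \<in> space E. z \<in> {?q}} \<in> sets E"
    proof (rule sets_E_I)
      fix v
      have "{t \<in> {0<..1}. (v, t) \<in> {z \<in> space E. z \<in> {?q}}} =
        {0<..1} \<inter> (if v \<in> V0 \<and> v = fst ?q then {snd ?q} else {})"
        by (auto simp: space_E prod_eq_iff)
      then show "{t \<in> {0<..1}. (v, t) \<in> {z \<in> space E. z \<in> {?q}}} \<in> sets lborel" by simp
    qed auto
    moreover have "w \<in> borel_measurable E"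
      unfolding w_def using measurable_hgt by measurable
    ultimately show ?thesis
      by (intro borel_measurable_scaleR borel_measurable_indicator') auto
  qed
  ultimately have Q: "integrable E (\<lambda>z. indicator {?q} z *\<^sub>R w z)"
    "(\<integral>z. indicator {?q} z *\<^sub>R w z \<partial>E) = 0"
    using integrable_cong_AE[of "\<lambda>z. indicator {?q} z *\<^sub>R w z" E "\<lambda>_. 0"]
    by (auto simp: integral_eq_zero_AE)
  have "dX T \<epsilon> x y = (\<integral>z. indicator (stem x) z *\<^sub>R w z + indicator (stem y) z *\<^sub>R w z
      - 2 * (indicator (stem ?q) z *\<^sub>R w z) + indicator {?q} z *\<^sub>R w z \<partial>E)"
    unfolding dX_def set_lebesgue_integral_def
  proof (rule Bochner_Integration.integral_cong)
    fix z assume "z \<in> space E"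
    then have "z \<in> P" using space_E_points by blast
    moreover have "?q \<in> stem x \<inter> stem y"
    proof -
      have "?q \<in> stem ?q" using q(1) gprod_self[OF q(1)] unfolding stem_def by blast
      then show ?thesis using q(3) by simp
    qed
    ultimately show "indicator (segment T x y) z *\<^sub>R exp (- \<epsilon> * height T z) =
      indicator (stem x) z *\<^sub>R w z + indicator (stem y) z *\<^sub>R w z
      - 2 * (indicator (stem ?q) z *\<^sub>R w z) + indicator {?q} z *\<^sub>R w z"
      unfolding segment_eq[OF assms] q(3)
      by (auto simp: height_eq w_def split: split_indicator)
  qed simp
  also have "\<dots> = (1 - exp (- \<epsilon> * hgt x)) / \<epsilon> + (1 - exp (- \<epsilon> * hgt y)) / \<epsilon>
      - 2 * ((1 - exp (- \<epsilon> * gprod x y)) / \<epsilon>)"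
    using I[OF assms(1)] I[OF assms(2)] I[OF q(1)] Q q(2) by simp
  also have "\<dots> = (2 * exp (- \<epsilon> * gprod x y) - exp (- \<epsilon> * hgt x) - exp (- \<epsilon> * hgt y)) / \<epsilon>"
    by (simp add: diff_divide_distrib)
  finally show ?thesis .
qed

lemma dX_ge:
  assumes "x \<in> P" "y \<in> P"
  shows "(exp (- \<epsilon> * gprod x y) - exp (- \<epsilon> * hgt x)) / \<epsilon> \<le> dX T \<epsilon> x y"
    and "(exp (- \<epsilon> * gprod x y) - exp (- \<epsilon> * hgt y)) / \<epsilon> \<le> dX T \<epsilon> x y"
  using gprod_le[of x y] eps unfolding dX_eq[OF assms] by (auto intro!: divide_right_mono)

sublocale X: Metric_space P "dX T \<epsilon>"
proof
  show "0 \<le> dX T \<epsilon> x y" for x y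
    unfolding dX_def set_lebesgue_integral_def by (rule integral_nonneg_AE) simp
  show "dX T \<epsilon> x y = dX T \<epsilon> y x" for x y
    by (simp add: dX_def segment_commute)
  have mono: "exp (- \<epsilon> * b) \<le> exp (- \<epsilon> * a) \<longleftrightarrow> a \<le> b" for a b using eps by simp
  show "dX T \<epsilon> x y = 0 \<longleftrightarrow> x = y" if "x \<in> P" "y \<in> P" for x y
  proof
    assume "dX T \<epsilon> x y = 0"
    then have "exp (- \<epsilon> * gprod x y) \<le> exp (- \<epsilon> * hgt x)" "exp (- \<epsilon> * gprod x y) \<le> exp (- \<epsilon> * hgt y)"
      using dX_ge[OF that] eps by (auto simp: field_simps)
    then have "gprod x y = hgt x" "gprod x y = hgt y" using gprod_le[of x y] unfolding mono by auto
    then show "x = y" using point_eqI that by blast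
  qed (use that in \<open>simp add: dX_eq gprod_self\<close>)
  fix x y z assume P: "x \<in> P" "y \<in> P" "z \<in> P"
  \<comment> \<open>One of \<open>gprod x y\<close> and \<open>gprod y z\<close> is at most \<open>gprod x z\<close>, the other one is at most \<open>hgt y\<close>.\<close>
  define \<phi> where "\<phi> r = exp (- \<epsilon> * r)" for r
  have anti: "\<phi> b \<le> \<phi> a" if "a \<le> b" for a b using that mono by (simp add: \<phi>_def)
  have "\<phi> (hgt y) + \<phi> (gprod x z) \<le> \<phi> (gprod x y) + \<phi> (gprod y z)"
    using gprod_ultra[OF P] gprod_le[of x y] gprod_le[of y z]
      anti[of "gprod x y" "gprod x z"] anti[of "gprod y z" "gprod x z"]
      anti[of "gprod x y" "hgt y"] anti[of "gprod y z" "hgt y"]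
    by (cases "gprod x y \<le> gprod y z") auto
  then show "dX T \<epsilon> x z \<le> dX T \<epsilon> x y + dX T \<epsilon> y z"
    using P eps unfolding dX_eq[OF P(1,2)] dX_eq[OF P(2,3)] dX_eq[OF P(1,3)] \<phi>_def add_divide_distrib[symmetric]
    by (intro divide_right_mono) auto
qed

section \<open>Borel sets of the tree\<close>

abbreviation "XB \<equiv> X_borel T \<epsilon>"

lemma space_XB [simp]: "space XB = P"
  unfolding X_borel_def by (rule space_measure_of) (auto dest: X.openin_mtopology[THEN iffD1])

lemma open_in_XB: "openin X.mtopology U \<Longrightarrow> U \<in> sets XB"
  unfolding X_borel_def by (subst sets_measure_of) (auto dest: X.openin_mtopology[THEN iffD1])

text \<open>
  Leaving \<open>{v} \<times> {a<..<b}\<close> from \<open>(v, s)\<close> means crossing one of the ends of this part of the edge,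
  whose distances from \<open>(v, s)\<close> are positive.
\<close>

lemma open_edge_part:
  assumes v: "v \<in> V0" and ab: "0 \<le> a" "b \<le> 1"
  shows "openin X.mtopology ({v} \<times> {a<..<b})"
  unfolding X.openin_mtopology
proof (intro conjI allI impI)
  show sub: "{v} \<times> {a<..<b} \<subseteq> P" using assms by (auto simp: points_def)
  fix x assume x: "x \<in> {v} \<times> {a<..<b}"
  then obtain s where s: "x = (v, s)" "a < s" "s < b" by auto
  define n where "n = real (lev v) - 1"
  define \<phi> where "\<phi> r = exp (- \<epsilon> * (n + r))" for r
  have anti: "\<phi> q < \<phi> r" if "r < q" for q r using that eps by (simp add: \<phi>_def)
  define r where "r = min (\<phi> a - \<phi> s) (\<phi> s - \<phi> b) / \<epsilon>"
  have "r > 0" using anti[OF s(2)] anti[OF s(3)] eps by (simp add: r_def)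
  moreover have "X.mball x r \<subseteq> {v} \<times> {a<..<b}"
  proof
    fix y assume "y \<in> X.mball x r"
    then have y: "x \<in> P" "y \<in> P" "dX T \<epsilon> x y < r" by auto
    obtain w t where wt: "y = (w, t)" by force
    note pw = pointsD[OF y(2), unfolded wt, simplified]
    have hx: "hgt x = n + s" by (simp add: hgt_def s n_def)
    have d: "(exp (- \<epsilon> * gprod x y) - \<phi> s) / \<epsilon> < (\<phi> a - \<phi> s) / \<epsilon>"
      "(exp (- \<epsilon> * gprod x y) - exp (- \<epsilon> * hgt y)) / \<epsilon> < (\<phi> s - \<phi> b) / \<epsilon>"
    proof -
      have "r \<le> (\<phi> a - \<phi> s) / \<epsilon>" "r \<le> (\<phi> s - \<phi> b) / \<epsilon>"
        using eps unfolding r_def by (auto intro!: divide_right_mono)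
      then show "(exp (- \<epsilon> * gprod x y) - \<phi> s) / \<epsilon> < (\<phi> a - \<phi> s) / \<epsilon>"
        "(exp (- \<epsilon> * gprod x y) - exp (- \<epsilon> * hgt y)) / \<epsilon> < (\<phi> s - \<phi> b) / \<epsilon>"
        using dX_ge[OF y(1,2)] y(3) unfolding hx \<phi>_def by linarith+
    qed
    have ga: "n + a < gprod x y"
      using d(1) eps unfolding \<phi>_def by (simp add: divide_less_cancel)
    have "exp (- \<epsilon> * gprod x y) \<ge> \<phi> s" using gprod_le(1)[of x y] hx eps by (simp add: \<phi>_def)
    then have "\<phi> b < exp (- \<epsilon> * hgt y)"
      using d(2) eps by (simp add: divide_less_cancel)
    then have hb: "hgt y < n + b" using eps by (simp add: \<phi>_def)
    have "n < real (meet_lev v w)" using ga ab by (auto simp: gprod_def s wt)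
    then have "lev v \<le> meet_lev v w" unfolding n_def by linarith
    then have m: "lev v \<le> lev w" "anc w (lev v) = v"
      using le_meet_lev_iff[of v w "lev v"] v pw by auto
    have "real (lev w) < real (lev v) + 1" using hb pw ab unfolding hgt_def wt n_def by simp
    then have "w = v" using m by (metis anc_lev le_antisym linorder_not_less of_nat_Suc of_nat_less_iff less_Suc_eq_le add.commute)
    moreover have "hgt y = n + t" using \<open>w = v\<close> by (simp add: wt hgt_def n_def)
    ultimately show "y \<in> {v} \<times> {a<..<b}" using hb ga gprod_le(2)[of x y] by (simp add: wt)
  qed
  ultimately show "\<exists>r>0. X.mball x r \<subseteq> {v} \<times> {a<..<b}" by blast
qed

text \<open>
  The sets \<open>{v} \<times> {a<..1}\<close> are Borel as unions of an open set and the closed point \<open>(v, 1)\<close>. So the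
  coordinate on the edge, extended by \<open>0\<close>, is a Borel function on \<open>X\<close>.
\<close>

lemma edge_part_in_XB:
  assumes v: "v \<in> V0" and B: "B \<in> sets borel" "B \<subseteq> {0<..1}"
  shows "{v} \<times> B \<in> sets XB"
proof -
  define f where "f x = (if fst x = v then snd x else 0)" for x :: "'v point"
  have top: "{(v, 1)} \<in> sets XB"
  proof -
    have "closedin X.mtopology {(v, 1)}" using v by (intro closedin_t1_singleton) (auto simp: X.t1_space_mtopology)
    then have "openin X.mtopology (P - {(v, 1)})" by (simp add: closedin_def)
    then have "P - (P - {(v, 1)}) \<in> sets XB"
      using sets.compl_sets[OF open_in_XB] by simp
    also have "P - (P - {(v, 1)}) = {(v, 1)}" using v by auto
    finally show ?thesis .
  qed
  have "f \<in> borel_measurable XB"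
    unfolding borel_measurable_iff_greater
  proof
    fix a :: real
    consider "a < 0" | "0 \<le> a" "a < 1" | "1 \<le> a" by linarith
    then show "{x \<in> space XB. a < f x} \<in> sets XB"
    proof cases
      case 1
      then have *: "{x \<in> space XB. a < f x} = space XB" by (auto simp: f_def points_def)
      show ?thesis unfolding * by (rule sets.top)
    next
      case 2
      then have "{x \<in> space XB. a < f x} = {v} \<times> {a<..<1} \<union> {(v, 1)}"
        using v by (auto simp: f_def points_def)
      then show ?thesis
        using sets.Un[OF open_in_XB[OF open_edge_part[OF v, of a 1]] top] 2 by simp
    next
      case 3
      then have "{x \<in> space XB. a < f x} = {}" by (auto simp: f_def points_def)
      then show ?thesis by (simp only: sets.empty_sets)
    qed
  qed
  from measurable_sets[OF this B(1)] have "f -` B \<inter> P \<in> sets XB" by simp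
  also have "f -` B \<inter> P = {v} \<times> B" using v B(2) by (auto simp: f_def points_def split: if_splits)
  finally show ?thesis .
qed

lemma origin_in_XB: "{origin_pt} \<in> sets XB"
proof -
  have "P - {origin_pt} = (\<Union>v\<in>V0. {v} \<times> {0<..1})" by (auto simp: points_def)
  also have "\<dots> \<in> sets XB"
    by (rule sets.countable_UN') (auto intro!: edge_part_in_XB)
  finally have "space XB - (P - {origin_pt}) \<in> sets XB" by blast
  also have "space XB - (P - {origin_pt}) = {origin_pt}" by auto
  finally show ?thesis .
qed

text \<open>
  As there are countably many edges, Borel measurability on \<open>X\<close> is a matter of the single edges.
\<close>

lemma measurable_XB_I:
  assumes "\<And>v. v \<in> V0 \<Longrightarrow> (\<lambda>t. f (v, t)) \<in> measurable unit_len N" "f origin_pt \<in> space N"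
  shows "f \<in> measurable XB N"
proof (rule measurableI)
  fix x assume "x \<in> space XB"
  then have "x = origin_pt \<or> (fst x \<in> V0 \<and> snd x \<in> {0<..1})" by (auto simp: points_def)
  then show "f x \<in> space N"
    using assms measurable_space[OF assms(1), of "fst x" "snd x"] by auto
next
  fix A assume A: "A \<in> sets N"
  let ?S = "\<lambda>v. {t \<in> {0<..1}. f (v, t) \<in> A}"
  have eq: "f -` A \<inter> space XB = (\<Union>v\<in>V0. {v} \<times> ?S v) \<union> (if f origin_pt \<in> A then {origin_pt} else {})"
    by (auto simp: points_def split: if_splits)
  moreover have "{v} \<times> ?S v \<in> sets XB" if v: "v \<in> V0" for v
  proof -
    have "(\<lambda>t. f (v, t)) -` A \<inter> space unit_len \<in> sets unit_len"
      using assms(1)[OF v] A by (rule measurable_sets)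
    also have "(\<lambda>t. f (v, t)) -` A \<inter> space unit_len = ?S v" by auto
    finally have "?S v \<in> sets borel" by (simp add: sets_restrict_space_iff)
    then show ?thesis by (rule edge_part_in_XB[OF v]) auto
  qed
  ultimately have "(\<Union>v\<in>V0. {v} \<times> ?S v) \<in> sets XB"
    by (intro sets.countable_UN') auto
  then have "(\<Union>v\<in>V0. {v} \<times> ?S v) \<union> (if f origin_pt \<in> A then {origin_pt} else {}) \<in> sets XB"
    using origin_in_XB by (intro sets.Un) auto
  then show "f -` A \<inter> space XB \<in> sets XB" unfolding eq .
qed

lemma dX_edge_le:
  assumes "v \<in> V0" "s \<in> {0<..1}" "t \<in> {0<..1}"
  shows "dX T \<epsilon> (v, s) (v, t) \<le> \<bar>s - t\<bar>"
proof -
  have *: "(exp (- \<epsilon> * a) - exp (- \<epsilon> * b)) / \<epsilon> \<le> b - a" if "0 \<le> a" "a \<le> b" for a b :: real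
  proof -
    have "1 - \<epsilon> * (b - a) \<le> exp (- \<epsilon> * (b - a))" using exp_ge_add_one_self[of "- \<epsilon> * (b - a)"] by simp
    then have "1 - exp (- \<epsilon> * (b - a)) \<le> \<epsilon> * (b - a)" by simp
    moreover have "exp (- \<epsilon> * a) \<le> 1" using that eps by simp
    moreover have "0 \<le> 1 - exp (- \<epsilon> * (b - a))" using that eps by simp
    ultimately have "exp (- \<epsilon> * a) * (1 - exp (- \<epsilon> * (b - a))) \<le> \<epsilon> * (b - a)"
      using mult_left_le_one_le[of "1 - exp (- \<epsilon> * (b - a))" "exp (- \<epsilon> * a)"] by simp
    also have "exp (- \<epsilon> * a) * (1 - exp (- \<epsilon> * (b - a))) = exp (- \<epsilon> * a) - exp (- \<epsilon> * b)"
      by (simp add: right_diff_distrib mult_exp_exp)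
    finally show ?thesis using eps by (simp add: field_simps)
  qed
  have P: "(v, s) \<in> P" "(v, t) \<in> P" using assms by (auto simp: points_def)
  have g: "gprod (v, s) (v, t) = min (hgt (v, s)) (hgt (v, t))"
    using assms by (auto simp: gprod_def hgt_def meet_lev_self)
  show ?thesis
    using *[of "hgt (v, s)" "hgt (v, t)"] *[of "hgt (v, t)" "hgt (v, s)"] hgt_nonneg[OF P(1)] hgt_nonneg[OF P(2)]
    unfolding dX_eq[OF P] g by (cases "s \<le> t") (auto simp: hgt_def)
qed

lemma id_measurable: "(\<lambda>x. x) \<in> measurable E XB"
  unfolding X_borel_def
proof (rule measurable_measure_of)
  fix U assume "U \<in> {U. openin X.mtopology U}"
  then have U: "openin X.mtopology U" by simp
  show "(\<lambda>x. x) -` U \<inter> space E \<in> sets E"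
  proof (rule sets_E_I)
    fix v assume v: "v \<in> V0"
    let ?S = "{t \<in> {0<..1}. (v, t) \<in> U}"
    have "openin (top_of_set {0<..1}) ?S"
      unfolding openin_euclidean_subtopology_iff
    proof (intro conjI ballI)
      fix s assume s: "s \<in> ?S"
      then obtain r where r: "r > 0" "X.mball (v, s) r \<subseteq> U" using U X.openin_mtopology by blast
      have vs: "(v, s) \<in> P" using s v by (auto simp: points_def)
      have "t \<in> ?S" if t: "t \<in> {0<..1}" "dist t s < r" for t
      proof -
        have "dX T \<epsilon> (v, s) (v, t) < r"
          using dX_edge_le[OF v, of s t] s t by (auto simp: dist_real_def abs_minus_commute)
        moreover have "(v, t) \<in> P" using v t by (auto simp: points_def)
        ultimately have "(v, t) \<in> X.mball (v, s) r" using vs by simp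
        then show ?thesis using r t by blast
      qed
      then show "\<exists>r>0. \<forall>t\<in>{0<..1}. dist t s < r \<longrightarrow> t \<in> ?S" using r by blast
    qed auto
    then obtain G where "open G" "?S = {0<..1} \<inter> G" by (auto simp: openin_open)
    then have "?S \<in> sets lborel" by auto
    also have "?S = {t \<in> {0<..1}. (v, t) \<in> (\<lambda>x. x) -` U \<inter> space E}" using v by (auto simp: space_E)
    finally show "{t \<in> {0<..1}. (v, t) \<in> (\<lambda>x. x) -` U \<inter> space E} \<in> sets lborel" .
  qed auto
next
  show "{U. openin X.mtopology U} \<subseteq> Pow P" using X.openin_mtopology by blast
  show "(\<lambda>x. x) \<in> space E \<rightarrow> P" using space_E_points by blast
qed

lemma measurable_XB_E: "f \<in> measurable XB N \<Longrightarrow> f \<in> measurable E N"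
  using measurable_compose[OF id_measurable] by blast

lemma nn_integral_length:
  "f \<in> borel_measurable XB \<Longrightarrow> (\<integral>\<^sup>+z. f z \<partial>length_measure T \<epsilon>) = (\<integral>\<^sup>+z. f z \<partial>E)"
  unfolding length_measure_def by (rule nn_integral_distr[OF id_measurable]) simp

lemma sets_length [simp]: "sets (length_measure T \<epsilon>) = sets XB" "space (length_measure T \<epsilon>) = P"
  by (simp_all add: length_measure_def)

lemma measurable_hgt_XB: "hgt \<in> borel_measurable XB"
  by (rule measurable_XB_I) (simp_all add: hgt_def measurable_restrict_space1)

lemma measurable_height_XB [measurable]: "height T \<in> borel_measurable XB"
  using measurable_hgt_XB by (rule measurable_cong[THEN iffD1, rotated]) (simp add: height_eq)

lemma measurable_length: "f \<in> measurable XB N \<Longrightarrow> f \<in> measurable (length_measure T \<epsilon>) N"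
  using measurable_cong_sets[OF sets_length(1) refl] by blast

lemma measurable_mu: "f \<in> measurable XB N \<Longrightarrow> f \<in> measurable (mu T \<epsilon> \<beta>) N"
  unfolding mu_def
  by (rule measurable_completion) (use measurable_cong_sets[of "density _ _" XB N N] in force)

text \<open>
  The edges that end at level \<open>n + 1\<close> cover the heights from \<open>n\<close> to \<open>n + 1\<close>.
\<close>

lemma nn_integral_mu:
  assumes [measurable]: "f \<in> borel_measurable XB"
  shows "(\<integral>\<^sup>+z. f z \<partial>mu T \<epsilon> \<beta>) = (\<Sum>n. \<Sum>v\<in>level (Suc n).
    \<integral>\<^sup>+t\<in>{0<..1}. ennreal (exp (- \<beta> * (real n + t))) * f (v, t) \<partial>lborel)"
proof -
  let ?w = "\<lambda>z. ennreal (exp (- \<beta> * height T z))"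
  have l: "f \<in> borel_measurable (length_measure T \<epsilon>)" "?w \<in> borel_measurable (length_measure T \<epsilon>)"
    by (rule measurable_length, measurable)+
  have "(\<integral>\<^sup>+z. f z \<partial>mu T \<epsilon> \<beta>) = (\<integral>\<^sup>+z. ?w z * f z \<partial>length_measure T \<epsilon>)"
    unfolding mu_def nn_integral_completion by (rule nn_integral_density) fact+
  also have "\<dots> = (\<integral>\<^sup>+z. ?w z * f z \<partial>E)" by (rule nn_integral_length) measurable
  also have "\<dots> = (\<integral>\<^sup>+v. (\<integral>\<^sup>+t\<in>{0<..1}. ?w (v, t) * f (v, t) \<partial>lborel) \<partial>count_space V0)"
    by (rule nn_integral_edges, rule measurable_XB_E) measurable
  also have "\<dots> = (\<Sum>n. \<Sum>v\<in>level (Suc n). \<integral>\<^sup>+t\<in>{0<..1}. ?w (v, t) * f (v, t) \<partial>lborel)"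
    by (rule nn_integral_V0)
  also have "\<dots> = (\<Sum>n. \<Sum>v\<in>level (Suc n).
    \<integral>\<^sup>+t\<in>{0<..1}. ennreal (exp (- \<beta> * (real n + t))) * f (v, t) \<partial>lborel)"
  proof (intro suminf_cong sum.cong nn_integral_cong refl)
    fix n v t assume v: "v \<in> level (Suc n)"
    have "v \<in> V0" using v V0_levels by blast
    then have "height T (v, t) = real n + t" if "t \<in> {0<..1}"
      using that levelD[OF v] by (subst height_eq) (auto simp: hgt_def points_def)
    then show "?w (v, t) * f (v, t) * indicator {0<..1} t =
        ennreal (exp (- \<beta> * (real n + t))) * f (v, t) * indicator {0<..1} t"
      by (auto split: split_indicator)
  qed
  finally show ?thesis .
qed

lemma AE_mu_I:
  assumes "{x \<in> P. Q x} \<in> sets XB"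
    and "\<And>v. v \<in> V0 \<Longrightarrow> AE t in lborel. t \<in> {0<..1} \<longrightarrow> Q (v, t)"
  shows "AE x in mu T \<epsilon> \<beta>. Q x"
proof -
  have "AE x in E. Q x"
  proof (rule AE_edgeI[OF _ assms(2)])
    have "(\<lambda>x. x) -` {x \<in> P. Q x} \<inter> space E \<in> sets E"
      using id_measurable assms(1) by (rule measurable_sets)
    also have "(\<lambda>x. x) -` {x \<in> P. Q x} \<inter> space E = {z \<in> space E. Q z}"
      using space_E_points by auto
    finally show "{z \<in> space E. Q z} \<in> sets E" .
  qed
  then have "AE x in length_measure T \<epsilon>. Q x"
    unfolding length_measure_def using assms(1) by (subst AE_distr_iff[OF id_measurable]) auto
  then have "AE x in density (length_measure T \<epsilon>) (\<lambda>x. ennreal (exp (- \<beta> * height T x))). Q x"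
  proof (subst AE_density)
    show "(\<lambda>x. ennreal (exp (- \<beta> * height T x))) \<in> borel_measurable (length_measure T \<epsilon>)"
      by (rule measurable_length) measurable
  qed (auto elim: eventually_mono)
  then show ?thesis unfolding mu_def by (rule AE_completion)
qed

end

section \<open>Hausdorff measure as an outer measure\<close>

lemma enn_powr_ennreal: "0 \<le> x \<Longrightarrow> enn_powr (ennreal x) a = ennreal (x powr a)"
  by (simp add: enn_powr_def)

lemma enn_powr_0 [simp]: "enn_powr 0 a = 0"
  by (simp add: enn_powr_def)

lemma set_diam_empty [simp]: "set_diam d {} = 0"
  by (simp add: set_diam_def bot_ennreal)

lemma hausdorff_pre_le:
  assumes "\<And>i. U i \<subseteq> M" "\<And>i. set_diam d (U i) \<le> ennreal \<delta>" "A \<subseteq> (\<Union>i::nat. U i)"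
  shows "hausdorff_pre M d Q \<delta> A \<le> (\<Sum>i. enn_powr (set_diam d (U i)) Q)"
  unfolding hausdorff_pre_def by (rule INF_lower) (use assms in auto)

lemma hausdorff_pre_greatest:
  assumes "\<And>U. (\<And>i::nat. U i \<subseteq> M) \<Longrightarrow> (\<And>i. set_diam d (U i) \<le> ennreal \<delta>) \<Longrightarrow> A \<subseteq> (\<Union>i. U i) \<Longrightarrow>
    c \<le> (\<Sum>i. enn_powr (set_diam d (U i)) Q)"
  shows "c \<le> hausdorff_pre M d Q \<delta> A"
  unfolding hausdorff_pre_def by (rule INF_greatest) (use assms in auto)

lemma hausdorff_pre_mono: "A \<subseteq> A' \<Longrightarrow> hausdorff_pre M d Q \<delta> A \<le> hausdorff_pre M d Q \<delta> A'"
  by (rule hausdorff_pre_greatest, rule hausdorff_pre_le) auto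

lemma hausdorff_pre_antimono:
  "\<delta> \<le> \<delta>' \<Longrightarrow> hausdorff_pre M d Q \<delta>' A \<le> hausdorff_pre M d Q \<delta> A"
proof (rule hausdorff_pre_greatest)
  fix U :: "nat \<Rightarrow> 'a set"
  assume le: "\<delta> \<le> \<delta>'" and U: "\<And>i. U i \<subseteq> M" "\<And>i. set_diam d (U i) \<le> ennreal \<delta>" "A \<subseteq> (\<Union>i. U i)"
  have "set_diam d (U i) \<le> ennreal \<delta>'" for i
    using U(2) ennreal_leI[OF le] by (rule order_trans)
  then show "hausdorff_pre M d Q \<delta>' A \<le> (\<Sum>i. enn_powr (set_diam d (U i)) Q)"
    using U by (intro hausdorff_pre_le)
qed

lemma hausdorff_pre_empty [simp]: "hausdorff_pre M d Q \<delta> {} = 0"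
  using hausdorff_pre_le[of "\<lambda>_. {}" M d \<delta> "{}" Q] by simp

lemma hausdorff_pre_approx:
  assumes "hausdorff_pre M d Q \<delta> A < a"
  obtains U where "\<And>i::nat. U i \<subseteq> M" "\<And>i. set_diam d (U i) \<le> ennreal \<delta>" "A \<subseteq> (\<Union>i. U i)"
    "(\<Sum>i. enn_powr (set_diam d (U i)) Q) < a"
  using assms unfolding hausdorff_pre_def INF_less_iff by auto

lemma suminf_half: "0 \<le> e \<Longrightarrow> (\<Sum>i. ennreal (e * (1 / 2) ^ Suc i)) = ennreal e"
  using sums_mult[OF power_half_series, of e] by (intro suminf_ennreal_eq) auto

lemma hausdorff_pre_subadditive:
  "hausdorff_pre M d Q \<delta> (\<Union>i::nat. A i) \<le> (\<Sum>i. hausdorff_pre M d Q \<delta> (A i))"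
proof (rule ennreal_le_epsilon)
  fix e :: real
  let ?h = "hausdorff_pre M d Q \<delta>" and ?s = "\<lambda>U. enn_powr (set_diam d U) Q"
  assume fin: "(\<Sum>i. ?h (A i)) < top" and e: "0 < e"
  have "\<exists>U. (\<forall>j::nat. U j \<subseteq> M \<and> set_diam d (U j) \<le> ennreal \<delta>) \<and> A i \<subseteq> (\<Union>j. U j) \<and>
      (\<Sum>j. ?s (U j)) \<le> ?h (A i) + ennreal (e * (1 / 2) ^ Suc i)" for i
  proof -
    have "?h (A i) < top" using fin ennreal_suminf_lessD by blast
    moreover have "0 < ennreal (e * (1 / 2) ^ Suc i)" using e by simp
    ultimately have "?h (A i) < ?h (A i) + ennreal (e * (1 / 2) ^ Suc i)"
      using ennreal_add_left_cancel_less[of "?h (A i)" 0] by simp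
    from hausdorff_pre_approx[OF this] show ?thesis by (metis less_imp_le)
  qed
  then obtain U where U: "\<And>i j. U i j \<subseteq> M" "\<And>i j. set_diam d (U i j) \<le> ennreal \<delta>"
      "\<And>i. A i \<subseteq> (\<Union>j::nat. U i j)" "\<And>i. (\<Sum>j. ?s (U i j)) \<le> ?h (A i) + ennreal (e * (1 / 2) ^ Suc i)"
    by metis
  define W where "W n = case_prod U (prod_decode n)" for n
  have "(\<Union>i. A i) \<subseteq> (\<Union>n. W n)"
  proof
    fix x assume "x \<in> (\<Union>i. A i)"
    then obtain i j where "x \<in> U i j" using U(3) by blast
    then have "x \<in> W (prod_encode (i, j))" by (simp add: W_def)
    then show "x \<in> (\<Union>n. W n)" by blast
  qed
  then have "?h (\<Union>i. A i) \<le> (\<Sum>n. ?s (W n))"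
    using U(1,2) by (intro hausdorff_pre_le) (auto simp: W_def split: prod.splits)
  also have "\<dots> = (\<Sum>i. \<Sum>j. ?s (U i j))"
    unfolding W_def using suminf_ennreal_2dimen[of "\<lambda>i. \<Sum>j. ?s (U i j)" "\<lambda>(i, j). ?s (U i j)"]
    by (simp add: case_prod_beta)
  also have "\<dots> \<le> (\<Sum>i. ?h (A i) + ennreal (e * (1 / 2) ^ Suc i))"
    by (intro suminf_le U(4)) auto
  also have "\<dots> = (\<Sum>i. ?h (A i)) + (\<Sum>i. ennreal (e * (1 / 2) ^ Suc i))"
    by (intro suminf_add[symmetric]) auto
  also have "(\<Sum>i. ennreal (e * (1 / 2) ^ Suc i)) = ennreal e"
    using e by (intro suminf_half) simp
  finally show "?h (\<Union>i. A i) \<le> (\<Sum>i. ?h (A i)) + ennreal e" .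
qed

lemma hausdorff_pre_Un:
  "hausdorff_pre M d Q \<delta> (X \<union> Y) \<le> hausdorff_pre M d Q \<delta> X + hausdorff_pre M d Q \<delta> Y"
proof -
  let ?Z = "\<lambda>i::nat. if i = 0 then X else if i = 1 then Y else {}"
  have "X \<union> Y = (\<Union>i. ?Z i)" by (auto split: if_splits)
  then have "hausdorff_pre M d Q \<delta> (X \<union> Y) \<le> (\<Sum>i. hausdorff_pre M d Q \<delta> (?Z i))"
    using hausdorff_pre_subadditive[of M d Q \<delta> ?Z] by simp
  also have "\<dots> = (\<Sum>i\<in>{0, 1}. hausdorff_pre M d Q \<delta> (?Z i))"
    by (rule suminf_finite) auto
  finally show ?thesis by simp
qed

lemma hausdorff_pre_subadditive_finite:
  "finite I \<Longrightarrow> hausdorff_pre M d Q \<delta> (\<Union>i\<in>I. A i) \<le> (\<Sum>i\<in>I. hausdorff_pre M d Q \<delta> (A i))"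
proof (induction rule: finite_induct)
  case (insert x F)
  then show ?case
    using hausdorff_pre_Un[of M d Q \<delta> "A x" "\<Union>i\<in>F. A i"] by (auto intro: order_trans add_left_mono)
qed simp

section \<open>The ultrametric boundary\<close>

context kary_tree
begin

abbreviation "B \<equiv> boundary T"
abbreviation "d \<equiv> boundary_dist \<epsilon>"

definition cyl :: "'v \<Rightarrow> (nat \<Rightarrow> 'v) set" where
  "cyl v = {\<zeta> \<in> B. \<zeta> (lev v) = v}"

text \<open>The distances that occur between distinct boundary points.\<close>

definition rad :: "nat \<Rightarrow> real" where
  "rad n = 2 / \<epsilon> * exp (- \<epsilon> * real n)"

lemma rad_pos [simp]: "0 < rad n" and rad_le_iff [simp]: "rad m \<le> rad n \<longleftrightarrow> n \<le> m"
  and rad_less_iff [simp]: "rad m < rad n \<longleftrightarrow> n < m"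
  using eps by (auto simp: rad_def divide_le_cancel divide_less_cancel)

lemma rad_nonneg [simp]: "0 \<le> rad n"
  using rad_pos[of n] by linarith

lemma rad_tendsto: "rad \<longlonglongrightarrow> 0"
proof -
  have "(\<lambda>n. 2 / \<epsilon> * exp (- \<epsilon>) ^ n) \<longlonglongrightarrow> 2 / \<epsilon> * 0"
    using eps by (intro tendsto_mult LIMSEQ_power_zero tendsto_const) simp
  then show ?thesis by (simp add: rad_def[abs_def] mult.commute flip: exp_of_nat_mult)
qed

lemma ex_rad_less: "0 < e \<Longrightarrow> \<exists>n. rad n < e"
  using order_tendstoD(2)[OF rad_tendsto] by (auto simp: eventually_sequentially)

lemma boundary_agree:
  assumes "\<zeta> \<in> B" "\<xi> \<in> B" "\<zeta> \<noteq> \<xi>"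
  shows "\<exists>k. boundary_dist \<epsilon> \<zeta> \<xi> = rad k \<and> (\<forall>n. \<zeta> n = \<xi> n \<longleftrightarrow> n \<le> k)"
proof -
  define k where "k = (LEAST k. \<zeta> (Suc k) \<noteq> \<xi> (Suc k))"
  obtain m where "\<zeta> m \<noteq> \<xi> m" using assms(3) by blast
  moreover have "\<zeta> 0 = \<xi> 0" using assms by (simp add: boundary_def)
  ultimately have "\<exists>k. \<zeta> (Suc k) \<noteq> \<xi> (Suc k)" by (metis not0_implies_Suc)
  then have k: "\<zeta> (Suc k) \<noteq> \<xi> (Suc k)" unfolding k_def by (rule LeastI_ex)
  have "\<zeta> n = \<xi> n" if "n \<le> k" for n
    using that not_less_Least[of "n - 1" "\<lambda>k. \<zeta> (Suc k) \<noteq> \<xi> (Suc k)"] \<open>\<zeta> 0 = \<xi> 0\<close>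
    by (cases n) (auto simp: k_def)
  moreover have "\<zeta> n \<noteq> \<xi> n" if "k < n" for n
    using k boundary_anc[OF assms(1), of "Suc k" n] boundary_anc[OF assms(2), of "Suc k" n] that
    by auto
  ultimately have "\<forall>n. \<zeta> n = \<xi> n \<longleftrightarrow> n \<le> k" by (metis linorder_not_le)
  moreover have "boundary_dist \<epsilon> \<zeta> \<xi> = rad k" using assms by (simp add: boundary_dist_def rad_def k_def)
  ultimately show ?thesis by blast
qed

lemma dist_le_rad_iff:
  assumes "\<zeta> \<in> B" "\<xi> \<in> B"
  shows "d \<zeta> \<xi> \<le> rad n \<longleftrightarrow> \<zeta> n = \<xi> n"
proof (cases "\<zeta> = \<xi>")
  case True
  then show ?thesis by (simp add: boundary_dist_def)
next
  case False
  then obtain k where "d \<zeta> \<xi> = rad k" "\<forall>n. \<zeta> n = \<xi> n \<longleftrightarrow> n \<le> k"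
    using boundary_agree[OF assms] by blast
  then show ?thesis by simp
qed

sublocale bd: Metric_space B d
proof
  show "0 \<le> d \<zeta> \<xi>" for \<zeta> \<xi> :: "nat \<Rightarrow> 'v" using eps by (simp add: boundary_dist_def)
  show "d \<zeta> \<xi> = d \<xi> \<zeta>" for \<zeta> \<xi> :: "nat \<Rightarrow> 'v" by (simp add: boundary_dist_def eq_commute)
  show "d \<zeta> \<xi> = 0 \<longleftrightarrow> \<zeta> = \<xi>" if "\<zeta> \<in> B" "\<xi> \<in> B" for \<zeta> \<xi>
    using eps by (simp add: boundary_dist_def)
  fix x y z assume B: "x \<in> B" "y \<in> B" "z \<in> B"
  have nn: "0 \<le> d a b" for a b :: "nat \<Rightarrow> 'v" using eps by (simp add: boundary_dist_def)
  show "d x z \<le> d x y + d y z"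
  proof (cases "x = y \<or> y = z")
    case True
    then show ?thesis using nn by auto
  next
    case False
    then obtain k l where kl: "d x y = rad k" "\<forall>n. x n = y n \<longleftrightarrow> n \<le> k" "d y z = rad l" "\<forall>n. y n = z n \<longleftrightarrow> n \<le> l"
      using boundary_agree B by metis
    then have "x (min k l) = z (min k l)" by (metis min.cobounded1 min.cobounded2)
    then have "d x z \<le> rad (min k l)" using dist_le_rad_iff B by blast
    also have "\<dots> \<le> rad k + rad l" by (simp add: min_def)
    finally show ?thesis using kl by simp
  qed
qed

lemma cyl_vertex: "\<zeta> \<in> B \<Longrightarrow> \<zeta> \<in> cyl (\<zeta> n)"
  by (simp add: cyl_def)

lemma cyl_origin: "cyl orig = B"
  by (auto simp: cyl_def boundary_def)

lemma cyl_subset: "cyl v \<subseteq> B"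
  by (auto simp: cyl_def)

lemma boundary_level: "\<zeta> \<in> B \<Longrightarrow> \<zeta> n \<in> level n"
  by (simp add: level_def boundary_in)

lemma cyl_level: "v \<in> level n \<Longrightarrow> cyl v = {\<zeta> \<in> B. \<zeta> n = v}"
  by (auto simp: cyl_def level_def)

lemma boundary_levels: "B = (\<Union>v\<in>level n. cyl v)"
  using cyl_level boundary_level by fastforce

lemma cyl_children:
  assumes "v \<in> level n"
  shows "cyl v = (\<Union>w\<in>children T v. cyl w)"
proof -
  have "\<zeta> (Suc n) \<in> children T v \<longleftrightarrow> \<zeta> n = v" if "\<zeta> \<in> B" for \<zeta>
    using that boundary_iff[of \<zeta>] boundary_level[OF that, of "Suc n"] child_iff[OF assms] by auto
  moreover have "cyl w = {\<zeta> \<in> B. \<zeta> (Suc n) = w}" if "w \<in> children T v" for w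
    using that child_iff[OF assms] cyl_level by blast
  ultimately show ?thesis unfolding cyl_level[OF assms] by auto
qed

text \<open>
  The radii between two successive values of \<open>rad\<close> give the same ball; for \<open>n = 0\<close> there is no larger
  value, and the ball is the whole boundary.
\<close>

lemma mball_eq_cyl:
  assumes "\<zeta> \<in> B" "rad n < t" "n = 0 \<or> t \<le> rad (n - 1)"
  shows "bd.mball \<zeta> t = cyl (\<zeta> n)"
proof -
  have "d \<zeta> \<xi> < t \<longleftrightarrow> \<zeta> n = \<xi> n" if xB: "\<xi> \<in> B" for \<xi>
  proof
    assume "\<zeta> n = \<xi> n"
    then show "d \<zeta> \<xi> < t" using dist_le_rad_iff[OF assms(1) that, of n] assms(2) by linarith
  next
    assume l: "d \<zeta> \<xi> < t"
    show "\<zeta> n = \<xi> n"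
    proof (cases "\<zeta> = \<xi> \<or> n = 0")
      case True
      then show ?thesis using assms that by (auto simp: boundary_def)
    next
      case False
      then obtain k where k: "d \<zeta> \<xi> = rad k" "\<forall>n. \<zeta> n = \<xi> n \<longleftrightarrow> n \<le> k"
        using boundary_agree[OF assms(1) xB] by blast
      have "n \<noteq> 0" using False by simp
      then have "t \<le> rad (n - 1)" "rad k < t" using assms(3) l k by auto
      then have "rad k < rad (n - 1)" by linarith
      then show ?thesis using k \<open>n \<noteq> 0\<close> by (simp add: rad_less_iff)
    qed
  qed
  then show ?thesis using assms(1) by (auto simp: cyl_def boundary_lev)
qed

lemma open_cyl: "openin bd.mtopology (cyl v)"
  unfolding bd.openin_mtopology
proof (intro conjI allI impI)
  fix \<zeta> assume z: "\<zeta> \<in> cyl v"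
  let ?r = "if lev v = 0 then rad 0 + 1 else rad (lev v - 1)"
  have "bd.mball \<zeta> ?r = cyl (\<zeta> (lev v))"
    using z by (intro mball_eq_cyl) (auto simp: cyl_def)
  then have "bd.mball \<zeta> ?r \<subseteq> cyl v" using z by (simp add: cyl_def)
  moreover have "0 < ?r" using rad_pos[of 0] rad_pos[of "lev v - 1"] by (simp del: rad_pos)
  ultimately show "\<exists>r>0. bd.mball \<zeta> r \<subseteq> cyl v" by blast
qed (rule cyl_subset)

lemma open_union_cyl:
  assumes "openin bd.mtopology U"
  shows "U = (\<Union>v\<in>{v\<in>V. cyl v \<subseteq> U}. cyl v)"
proof
  show "U \<subseteq> (\<Union>v\<in>{v\<in>V. cyl v \<subseteq> U}. cyl v)"
  proof
    fix \<zeta> assume z: "\<zeta> \<in> U"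
    then obtain r where r: "r > 0" "bd.mball \<zeta> r \<subseteq> U" and zB: "\<zeta> \<in> B"
      using assms bd.openin_mtopology by blast
    obtain n where n: "rad n < r" using ex_rad_less r by blast
    have "cyl (\<zeta> n) \<subseteq> bd.mball \<zeta> r"
    proof
      fix \<xi> assume "\<xi> \<in> cyl (\<zeta> n)"
      then have "\<xi> \<in> B" "\<zeta> n = \<xi> n" using zB by (auto simp: cyl_def)
      then show "\<xi> \<in> bd.mball \<zeta> r" using dist_le_rad_iff[OF zB, of \<xi> n] zB n by simp
    qed
    then have "\<zeta> n \<in> {v \<in> V. cyl v \<subseteq> U}" using r boundary_in[OF zB] by simp
    then show "\<zeta> \<in> (\<Union>v\<in>{v\<in>V. cyl v \<subseteq> U}. cyl v)" using cyl_vertex[OF zB] by blast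
  qed
qed auto

text \<open>The cylinder masses before normalization.\<close>

abbreviation "Q \<equiv> ln (real K) / \<epsilon>"

definition mass :: "nat \<Rightarrow> ennreal" where
  "mass n = ennreal (rad n powr Q)"

lemma K_pos: "0 < real K" "1 < real K"
  using K_ge_2 by auto

lemma Q_pos: "0 < Q"
  using K_pos eps by simp

lemma mass_eq: "mass n = ennreal (rad 0 powr Q) * ennreal ((1 / real K) ^ n)"
proof -
  have "rad n powr Q = (2 / \<epsilon>) powr Q * exp (- \<epsilon> * real n) powr Q"
    unfolding rad_def using eps by (subst powr_mult) auto
  also have "exp (- \<epsilon> * real n) powr Q = exp (- (real n * ln (real K)))"
    using eps by (simp add: exp_powr_real)
  also have "\<dots> = (1 / real K) ^ n"
    using K_pos by (simp add: exp_minus exp_of_nat_mult power_one_over inverse_eq_divide)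
  finally show ?thesis using eps K_pos by (simp add: mass_def ennreal_mult rad_def)
qed

lemma mass_0_pos: "0 < mass 0" "mass 0 < top"
  using rad_pos[of 0] unfolding mass_def by (simp_all del: rad_pos)

lemma mass_Suc: "of_nat K * mass (Suc n) = mass n"
proof -
  have "of_nat K * mass (Suc n) = ennreal (rad 0 powr Q) * (ennreal (real K) * ennreal ((1 / real K) ^ Suc n))"
    by (simp add: mass_eq ennreal_of_nat_eq_real_of_nat mult_ac)
  also have "ennreal (real K) * ennreal ((1 / real K) ^ Suc n) = ennreal ((1 / real K) ^ n)"
    using K_pos by (subst ennreal_mult[symmetric]) auto
  finally show ?thesis by (simp add: mass_eq)
qed

lemma set_diam_cyl: "v \<in> level n \<Longrightarrow> set_diam d (cyl v) \<le> ennreal (rad n)"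
  unfolding set_diam_def cyl_level
  by (rule SUP_least) (auto intro!: ennreal_leI simp: dist_le_rad_iff)

lemma set_diam_ge: "\<zeta> \<in> U \<Longrightarrow> \<xi> \<in> U \<Longrightarrow> ennreal (d \<zeta> \<xi>) \<le> set_diam d U"
  unfolding set_diam_def by (rule SUP_upper2[of "(\<zeta>, \<xi>)"]) auto

lemma diam_le_rad:
  assumes "U \<subseteq> B" "set_diam d U \<le> ennreal (rad n)" "\<zeta> \<in> U" "\<xi> \<in> U"
  shows "\<zeta> n = \<xi> n"
proof -
  have "ennreal (d \<zeta> \<xi>) \<le> ennreal (rad n)" using set_diam_ge assms order_trans by blast
  then have "d \<zeta> \<xi> \<le> rad n" by (simp add: ennreal_le_iff)
  then show ?thesis using dist_le_rad_iff assms by blast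
qed

lemma boundary_nonempty: "B \<noteq> {}"
proof -
  have "\<exists>w. w \<in> children T v" if "v \<in> V" for v
    using card_children[OF that] K_ge_2 by (metis card.empty ex_in_conv not_numeral_le_zero)
  then have "\<exists>\<zeta>. \<forall>n. (\<zeta> n \<in> V \<and> (n = 0 \<longrightarrow> \<zeta> n = orig)) \<and> \<zeta> (Suc n) \<in> children T (\<zeta> n)"
    by (intro dependent_nat_choice) (auto simp: children_iff)
  then show ?thesis unfolding ex_in_conv[symmetric] boundary_iff by (metis children_iff)
qed

text \<open>
  Two points of \<open>U\<close> at the largest distance span a cylinder that contains \<open>U\<close> and has the same
  diameter; a set without two points lies in arbitrarily small cylinders. So covers may be replaced
  by covers with cylinders at little extra cost.
\<close>

lemma enclosing_cylinder:
  assumes "U \<subseteq> B" "0 < e"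
  shows "\<exists>v\<in>V. U \<subseteq> cyl v \<and> mass (lev v) \<le> enn_powr (set_diam d U) Q + ennreal e"
proof (cases "\<exists>\<zeta>\<in>U. \<exists>\<xi>\<in>U. \<zeta> \<noteq> \<xi>")
  case True
  have agree: "\<exists>k. d \<zeta> \<xi> = rad k \<and> (\<forall>n. \<zeta> n = \<xi> n \<longleftrightarrow> n \<le> k)"
    if "\<zeta> \<in> U" "\<xi> \<in> U" "\<zeta> \<noteq> \<xi>" for \<zeta> \<xi>
    using that assms(1) by (intro boundary_agree) auto
  \<comment> \<open>The smallest level at which two elements of \<open>U\<close> separate; it belongs to their largest distance.\<close>
  define L where "L = (LEAST k. \<exists>\<zeta>\<in>U. \<exists>\<xi>\<in>U. \<zeta> \<noteq> \<xi> \<and> d \<zeta> \<xi> = rad k)"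
  have "\<exists>k. \<exists>\<zeta>\<in>U. \<exists>\<xi>\<in>U. \<zeta> \<noteq> \<xi> \<and> d \<zeta> \<xi> = rad k"
    using True agree by meson
  then obtain \<zeta> \<xi> where z: "\<zeta> \<in> U" "\<xi> \<in> U" "d \<zeta> \<xi> = rad L" using LeastI_ex[of "\<lambda>k. \<exists>\<zeta>\<in>U. \<exists>\<xi>\<in>U. \<zeta> \<noteq> \<xi> \<and> d \<zeta> \<xi> = rad k"]
    unfolding L_def[symmetric] by blast
  have "\<zeta> L = \<eta> L" if eU: "\<eta> \<in> U" for \<eta>
  proof (cases "\<zeta> = \<eta>")
    case False
    then obtain k where k: "d \<zeta> \<eta> = rad k" "\<forall>n. \<zeta> n = \<eta> n \<longleftrightarrow> n \<le> k"
      using agree[OF z(1) eU] by blast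
    then have "L \<le> k" unfolding L_def using False eU z(1) by (intro Least_le bexI[of _ \<zeta>] bexI[of _ \<eta>] conjI)
    then show ?thesis using k by blast
  qed simp
  moreover have zB: "\<zeta> \<in> B" using assms(1) z by blast
  ultimately have "U \<subseteq> cyl (\<zeta> L)" using assms(1) by (auto simp: cyl_def)
  moreover have "mass (lev (\<zeta> L)) \<le> enn_powr (set_diam d U) Q + ennreal e"
  proof (rule order_trans)
  show "mass (lev (\<zeta> L)) \<le> enn_powr (set_diam d U) Q"
  proof -
    have le: "ennreal (rad L) \<le> set_diam d U" using set_diam_ge[OF z(1,2)] z(3) by simp
    have "ennreal (rad L powr Q) \<le> enn_powr (set_diam d U) Q"
    proof (cases "set_diam d U")
      case (real r)
      then have "rad L powr Q \<le> r powr Q" using le Q_pos by (intro powr_mono2) auto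
      then show ?thesis using real by (simp add: enn_powr_ennreal ennreal_leI)
    qed (simp add: enn_powr_def)
    then show ?thesis using z assms(1) by (simp add: mass_def zB)
  qed
  qed simp
  ultimately show ?thesis using boundary_in[OF zB] by blast
next
  case False
  have "\<exists>\<zeta>\<in>B. U \<subseteq> {\<zeta>}"
  proof (cases "U = {}")
    case True
    then show ?thesis using boundary_nonempty by blast
  next
    case nonempty: False
    then obtain \<zeta> where "\<zeta> \<in> U" by blast
    then have "\<zeta> \<in> B" "U \<subseteq> {\<zeta>}" using False assms(1) by auto
    then show ?thesis by blast
  qed
  then obtain \<zeta> where z: "\<zeta> \<in> B" "U \<subseteq> {\<zeta>}" by blast
  have "(\<lambda>n. rad n powr Q) \<longlonglongrightarrow> 0 powr Q"
    using Q_pos by (intro tendsto_powr' rad_tendsto tendsto_const) (simp_all add: less_imp_le)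
  then have "\<forall>\<^sub>F n in sequentially. rad n powr Q < e"
    using order_tendstoD(2)[of "\<lambda>n. rad n powr Q" 0 sequentially e] assms(2) by simp
  then obtain n where "rad n powr Q < e" by (auto simp: eventually_sequentially)
  then have "mass n \<le> ennreal e" by (simp add: mass_def ennreal_leI)
  then have "mass n \<le> enn_powr (set_diam d U) Q + ennreal e" by (simp add: add_increasing)
  moreover have "U \<subseteq> cyl (\<zeta> n)" using z cyl_vertex[OF z(1), of n] by blast
  ultimately show ?thesis using z(1) boundary_in[OF z(1), of n]
    by (intro bexI[of _ "\<zeta> n"]) simp_all
qed

text \<open>
  Cylinders of total mass smaller than that of \<open>\<partial>X\<close> miss a branch: at each vertex, the
  cylinders below some child again have total mass smaller than that of the child.
\<close>

lemma cylinder_cover_mass: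
  assumes v: "\<And>i::nat. v i \<in> V" and cover: "B \<subseteq> (\<Union>i. cyl (v i))"
  shows "mass 0 \<le> (\<Sum>i. mass (lev (v i)))"
proof (rule ccontr)
  assume "\<not> ?thesis"
  then have less: "(\<Sum>i. mass (lev (v i))) < mass 0" by simp
  \<comment> \<open>The contribution of \<open>v i\<close> to the total \<open>f w\<close> of the cylinders contained in \<open>cyl w\<close>.\<close>
  define b where "b w i = (if lev w \<le> lev (v i) \<and> anc (v i) (lev w) = w then mass (lev (v i)) else 0)" for w i
  define f where "f w = (\<Sum>i. b w i)" for w
  have f0: "f orig < mass 0" using less v by (simp add: f_def b_def)
  have step: "\<exists>w'. w' \<in> children T w \<and> f w' < mass (Suc (lev w))" if w: "w \<in> V" "f w < mass (lev w)" for w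
  proof (rule ccontr)
    assume "\<not> ?thesis"
    then have ge: "mass (Suc (lev w)) \<le> f w'" if "w' \<in> children T w" for w' using that by (meson not_le)
    have "mass (lev w) = (\<Sum>w'\<in>children T w. mass (Suc (lev w)))"
      using card_children w mass_Suc by simp
    also have "\<dots> \<le> (\<Sum>w'\<in>children T w. f w')" by (intro sum_mono ge)
    also have "\<dots> = (\<Sum>i. \<Sum>w'\<in>children T w. b w' i)"
      unfolding f_def by (rule suminf_sum[symmetric]) simp
    also have "\<dots> \<le> (\<Sum>i. b w i)"
    proof (rule suminf_le)
      fix i
      have lw: "w \<in> level (lev w)" using w by (simp add: level_def)
      have lw': "lev w' = Suc (lev w)" "par w' = w" "w' \<in> V" if "w' \<in> children T w" for w'
        using child_iff[OF lw, of w'] that by (auto simp: level_def)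
      show "(\<Sum>w'\<in>children T w. b w' i) \<le> b w i"
      proof (cases "\<exists>w'\<in>children T w. b w' i \<noteq> 0")
        case True
        then obtain w' where w': "w' \<in> children T w" "b w' i \<noteq> 0" by blast
        then have l: "lev w < lev (v i)" "anc (v i) (Suc (lev w)) = w'"
          using lw'[OF w'(1)] by (auto simp: b_def split: if_splits)
        then have "anc (v i) (lev w) = w" using par_anc[of "v i" "lev w"] v lw'[OF w'(1)] by simp
        then have bw: "b w i = mass (lev (v i))" using l by (simp add: b_def)
        have "b u i = 0" if "u \<in> children T w - {w'}" for u
          using that l lw'[of u] by (auto simp: b_def)
        then have "(\<Sum>w'\<in>children T w. b w' i) = b w' i"
          using w' w finite_children by (simp add: sum.remove[of _ w'])
        also have "\<dots> \<le> b w i" unfolding bw by (simp add: b_def)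
        finally show ?thesis .
      qed simp
    qed auto
    finally show False using w(2) by (simp add: f_def)
  qed
  have "\<exists>\<zeta>. \<forall>n. (\<zeta> n \<in> level n \<and> f (\<zeta> n) < mass n) \<and> \<zeta> (Suc n) \<in> children T (\<zeta> n)"
  proof (rule dependent_nat_choice)
    show "\<exists>x. x \<in> level 0 \<and> f x < mass 0" using f0 by (simp add: level_0)
    fix x n assume x: "x \<in> level n \<and> f x < mass n"
    then have "lev x = n" "x \<in> V" by (auto simp: level_def)
    then obtain w where "w \<in> children T x" "f w < mass (Suc n)" using step x by blast
    then show "\<exists>y. (y \<in> level (Suc n) \<and> f y < mass (Suc n)) \<and> y \<in> children T x"
      using child_iff x by blast
  qed
  then obtain \<zeta> where z: "\<And>n. \<zeta> n \<in> level n" "\<And>n. f (\<zeta> n) < mass n" "\<And>n. \<zeta> (Suc n) \<in> children T (\<zeta> n)"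
    by blast
  have "\<zeta> (Suc n) \<noteq> orig" for n using z(1)[of "Suc n"] by (auto simp: level_def)
  moreover have "\<zeta> 0 = orig" using z(1)[of 0] by (simp add: level_0)
  ultimately have "\<zeta> \<in> B" unfolding boundary_iff
    using z child_iff[OF z(1)] by (auto simp: level_def)
  then obtain i where "\<zeta> \<in> cyl (v i)" using cover by blast
  then have zi: "\<zeta> (lev (v i)) = v i" by (simp add: cyl_def)
  have "b (v i) i \<le> f (v i)"
    unfolding f_def using sum_le_suminf[of "b (v i)" "{i}"] by simp
  moreover have "f (v i) < mass (lev (v i))" using z(2)[of "lev (v i)"] zi by simp
  ultimately show False by (simp add: b_def)
qed

section \<open>The measure on the boundary\<close>

abbreviation "h n \<equiv> hausdorff_pre B d Q (rad n)"
abbreviation "H \<equiv> hausdorff_outer B d Q"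

lemma h_mono: "m \<le> n \<Longrightarrow> h m A \<le> h n A"
  by (rule hausdorff_pre_antimono) simp

lemma incseq_h: "incseq (\<lambda>n. h n A)"
  by (simp add: incseq_def h_mono)

lemma H_eq: "H A = (SUP n. h n A)"
  unfolding hausdorff_outer_def
proof (rule antisym)
  show "(SUP \<delta>\<in>{0<..}. hausdorff_pre B d Q \<delta> A) \<le> (SUP n. h n A)"
  proof (rule SUP_least)
    fix \<delta> :: real assume "\<delta> \<in> {0<..}"
    then obtain n where "rad n < \<delta>" using ex_rad_less by auto
    then have "hausdorff_pre B d Q \<delta> A \<le> h n A" by (intro hausdorff_pre_antimono) simp
    then show "hausdorff_pre B d Q \<delta> A \<le> (SUP n. h n A)" by (rule SUP_upper2[rotated]) simp
  qed
  show "(SUP n. h n A) \<le> (SUP \<delta>\<in>{0<..}. hausdorff_pre B d Q \<delta> A)"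
    by (rule SUP_least) (auto intro: SUP_upper)
qed

lemma h_le_H: "h n A \<le> H A"
  unfolding H_eq by (rule SUP_upper) simp

lemma H_outer: "outer_measure_space (Pow B) H"
  unfolding outer_measure_space_def positive_def increasing_def countably_subadditive_def
proof (intro conjI ballI allI impI)
  show "H {} = 0" by (simp add: H_eq)
  show "H x \<le> H y" if "x \<subseteq> y" for x y
    unfolding H_eq by (intro SUP_mono) (use hausdorff_pre_mono[OF that] in blast)
  fix A :: "nat \<Rightarrow> (nat \<Rightarrow> 'v) set"
  show "H (\<Union>i. A i) \<le> (\<Sum>i. H (A i))"
    unfolding H_eq[of "\<Union>i. A i"]
  proof (rule SUP_least)
    fix n
    have "h n (\<Union>i. A i) \<le> (\<Sum>i. h n (A i))" by (rule hausdorff_pre_subadditive)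
    also have "\<dots> \<le> (\<Sum>i. H (A i))" by (intro suminf_le h_le_H) auto
    finally show "h n (\<Union>i. A i) \<le> (\<Sum>i. H (A i))" .
  qed
qed

text \<open>
  Points in different cylinders of level \<open>n\<close> are more than \<open>rad n\<close> apart, so a cover with sets of
  diameter at most \<open>rad n\<close> splits into a cover of a cylinder and a cover of its complement.
\<close>

lemma h_split:
  assumes "v \<in> level n" "A \<subseteq> B" "n \<le> m"
  shows "h m (A \<inter> cyl v) + h m (A - cyl v) \<le> h m A"
proof (rule hausdorff_pre_greatest)
  fix U :: "nat \<Rightarrow> (nat \<Rightarrow> 'v) set"
  let ?s = "\<lambda>U. enn_powr (set_diam d U) Q"
  assume U: "\<And>i. U i \<subseteq> B" "\<And>i. set_diam d (U i) \<le> ennreal (rad m)" "A \<subseteq> (\<Union>i. U i)"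
  have Un: "set_diam d (U i) \<le> ennreal (rad n)" for i
    using U(2)[of i] assms(3) by (auto intro: order_trans ennreal_leI)
  define I where "I i \<longleftrightarrow> U i \<inter> cyl v \<noteq> {}" for i
  have I: "U i \<subseteq> cyl v" if "I i" for i
    using that diam_le_rad[OF U(1) Un] U(1) unfolding I_def cyl_level[OF assms(1)] by blast
  have "h m (A \<inter> cyl v) \<le> (\<Sum>i. ?s (if I i then U i else {}))"
  proof (rule hausdorff_pre_le)
    show "A \<inter> cyl v \<subseteq> (\<Union>i. if I i then U i else {})"
    proof
      fix x assume x: "x \<in> A \<inter> cyl v"
      then obtain i where "x \<in> U i" using U(3) by blast
      then have "x \<in> (if I i then U i else {})" using x by (auto simp: I_def)
      then show "x \<in> (\<Union>i. if I i then U i else {})" by blast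
    qed
  qed (use U in auto)
  moreover have "h m (A - cyl v) \<le> (\<Sum>i. ?s (if I i then {} else U i))"
  proof (rule hausdorff_pre_le)
    show "A - cyl v \<subseteq> (\<Union>i. if I i then {} else U i)"
    proof
      fix x assume x: "x \<in> A - cyl v"
      then obtain i where "x \<in> U i" using U(3) by blast
      then have "x \<in> (if I i then {} else U i)" using x I[of i] by auto
      then show "x \<in> (\<Union>i. if I i then {} else U i)" by blast
    qed
  qed (use U in auto)
  ultimately have "h m (A \<inter> cyl v) + h m (A - cyl v) \<le>
      (\<Sum>i. ?s (if I i then U i else {})) + (\<Sum>i. ?s (if I i then {} else U i))" by (rule add_mono)
  also have "\<dots> = (\<Sum>i. ?s (if I i then U i else {}) + ?s (if I i then {} else U i))"
    by (intro suminf_add) auto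
  also have "\<dots> = (\<Sum>i. ?s (U i))" by (intro suminf_cong) auto
  finally show "h m (A \<inter> cyl v) + h m (A - cyl v) \<le> (\<Sum>i. ?s (U i))" .
qed

abbreviation "L \<equiv> lambda_system B (Pow B) H"

lemma measure_space_H: "measure_space B L H"
  using sigma_algebra.caratheodory_lemma[OF sigma_algebra_Pow H_outer] .

lemma sigma_algebra_L: "sigma_algebra B L"
  using measure_space_H by (simp add: measure_space_def)

text \<open>
  Caratheodory's criterion for a cylinder follows from the splitting of covers at all small scales, as
  both sides are limits of increasing sequences.
\<close>

lemma cyl_in_L:
  assumes "v \<in> V"
  shows "cyl v \<in> L"
proof -
  let ?n = "lev v"
  have vl: "v \<in> level ?n" using assms by (simp add: level_def)
  have two: "H (X \<union> Y) \<le> H X + H Y" for X Y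
    unfolding H_eq[of "X \<union> Y"]
  proof (rule SUP_least)
    fix n
    have "h n (X \<union> Y) \<le> h n X + h n Y" by (rule hausdorff_pre_Un)
    also have "\<dots> \<le> H X + H Y" by (intro add_mono h_le_H)
    finally show "h n (X \<union> Y) \<le> H X + H Y" .
  qed
  have "H (cyl v \<inter> A) + H ((B - cyl v) \<inter> A) = H A" if A: "A \<subseteq> B" for A
  proof (rule antisym)
    have "cyl v \<inter> A \<union> (B - cyl v) \<inter> A = A" using A by blast
    then show "H A \<le> H (cyl v \<inter> A) + H ((B - cyl v) \<inter> A)"
      using two[of "cyl v \<inter> A" "(B - cyl v) \<inter> A"] by simp
    have e: "cyl v \<inter> A = A \<inter> cyl v" "(B - cyl v) \<inter> A = A - cyl v" using A by auto
    have "H (A \<inter> cyl v) + H (A - cyl v) = (SUP n. h n (A \<inter> cyl v) + h n (A - cyl v))"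
      unfolding H_eq by (rule ennreal_SUP_add[symmetric]) (rule incseq_h)+
    also have "\<dots> \<le> H A"
    proof (rule SUP_least)
      fix n
      let ?m = "max n ?n"
      have "h n (A \<inter> cyl v) + h n (A - cyl v) \<le> h ?m (A \<inter> cyl v) + h ?m (A - cyl v)"
        by (intro add_mono h_mono) auto
      also have "\<dots> \<le> h ?m A" using h_split[OF vl A] by simp
      also have "\<dots> \<le> H A" by (rule h_le_H)
      finally show "h n (A \<inter> cyl v) + h n (A - cyl v) \<le> H A" .
    qed
    finally show "H (cyl v \<inter> A) + H ((B - cyl v) \<inter> A) \<le> H A" unfolding e .
  qed
  then show ?thesis using cyl_subset by (simp add: lambda_system_def)
qed

text \<open>
  At scale \<open>rad m\<close>, a cylinder of level \<open>m\<close> covers itself, and a cylinder of level \<open>n < m\<close> is the union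
  of those of its \<open>K\<close> children, whose masses add up to its own.
\<close>

lemma H_cyl_le:
  assumes "v \<in> level n"
  shows "H (cyl v) \<le> mass n"
proof -
  have "h m (cyl v) \<le> mass n" if "n \<le> m" "v \<in> level n" for m n v
    using that
  proof (induction "m - n" arbitrary: n v)
    case 0
    then have vm: "v \<in> level m" by simp
    let ?U = "\<lambda>i::nat. if i = 0 then cyl v else {}"
    have "h m (cyl v) \<le> (\<Sum>i. enn_powr (set_diam d (?U i)) Q)"
    proof (rule hausdorff_pre_le)
      show "cyl v \<subseteq> (\<Union>i. ?U i)" by auto
    qed (use cyl_subset set_diam_cyl[OF vm] in auto)
    also have "\<dots> = (\<Sum>i\<in>{0}. enn_powr (set_diam d (?U i)) Q)"
      by (rule suminf_finite) auto
    also have "\<dots> \<le> mass m"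
    proof (cases "set_diam d (cyl v)")
      case (real r)
      then have "r \<le> rad m" using set_diam_cyl[OF vm] by (simp add: ennreal_le_iff)
      then have "r powr Q \<le> rad m powr Q" using real Q_pos by (intro powr_mono2) auto
      then show ?thesis using real by (simp add: enn_powr_ennreal mass_def ennreal_leI)
    qed (use set_diam_cyl[OF vm] in \<open>simp add: top_unique\<close>)
    finally show ?case using 0 by simp
  next
    case (Suc k)
    have v: "v \<in> V" using Suc.prems by (simp add: level_def)
    have "h m (cyl v) \<le> (\<Sum>w\<in>children T v. h m (cyl w))"
      unfolding cyl_children[OF Suc.prems(2)]
      by (rule hausdorff_pre_subadditive_finite) (rule finite_children[OF v])
    also have "\<dots> \<le> (\<Sum>w\<in>children T v. mass (Suc n))"
    proof (rule sum_mono)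
      fix w assume "w \<in> children T v"
      then have "w \<in> level (Suc n)" using child_iff[OF Suc.prems(2)] by blast
      then show "h m (cyl w) \<le> mass (Suc n)" using Suc.hyps by (intro Suc.hyps(1)) auto
    qed
    also have "\<dots> = mass n" using card_children[OF v] mass_Suc by simp
    finally show ?case .
  qed
  then have "h m (cyl v) \<le> mass n" for m
    using assms h_mono[of m "max m n" "cyl v"] by (meson max.cobounded1 max.cobounded2 order_trans)
  then show ?thesis unfolding H_eq by (intro SUP_least)
qed

text \<open>
  A cover by arbitrary sets is replaced by a cover with cylinders at total extra cost \<open>e\<close>, which then
  has at least the mass of the boundary.
\<close>

lemma H_boundary_ge: "mass 0 \<le> H B"
proof -
  have "mass 0 \<le> h 0 B"
  proof (rule hausdorff_pre_greatest)
    fix U :: "nat \<Rightarrow> (nat \<Rightarrow> 'v) set"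
    let ?s = "\<lambda>U. enn_powr (set_diam d U) Q"
    assume U: "\<And>i. U i \<subseteq> B" "\<And>i. set_diam d (U i) \<le> ennreal (rad 0)" "B \<subseteq> (\<Union>i. U i)"
    show "mass 0 \<le> (\<Sum>i. ?s (U i))"
    proof (rule ennreal_le_epsilon)
      fix e :: real assume e: "0 < e"
      have "\<forall>i. \<exists>v\<in>V. U i \<subseteq> cyl v \<and> mass (lev v) \<le> ?s (U i) + ennreal (e * (1 / 2) ^ Suc i)"
        using enclosing_cylinder[OF U(1)] e by simp
      then obtain v where v: "\<And>i. v i \<in> V" "\<And>i. U i \<subseteq> cyl (v i)"
          "\<And>i. mass (lev (v i)) \<le> ?s (U i) + ennreal (e * (1 / 2) ^ Suc i)"
        by metis
      have "B \<subseteq> (\<Union>i. cyl (v i))" using U(3) v(2) by blast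
      then have "mass 0 \<le> (\<Sum>i. mass (lev (v i)))" by (rule cylinder_cover_mass[OF v(1)])
      also have "\<dots> \<le> (\<Sum>i. ?s (U i) + ennreal (e * (1 / 2) ^ Suc i))"
        by (intro suminf_le v(3)) auto
      also have "\<dots> = (\<Sum>i. ?s (U i)) + (\<Sum>i. ennreal (e * (1 / 2) ^ Suc i))"
        by (intro suminf_add[symmetric]) auto
      also have "(\<Sum>i. ennreal (e * (1 / 2) ^ Suc i)) = ennreal e"
        using e by (intro suminf_half) simp
      finally show "mass 0 \<le> (\<Sum>i. ?s (U i)) + ennreal e" .
    qed
  qed
  then show ?thesis using h_le_H order_trans by blast
qed

lemma H_boundary: "H B = mass 0"
  using H_boundary_ge H_cyl_le[of orig 0] cyl_origin level_0 by (intro antisym) auto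

definition nu0 :: "(nat \<Rightarrow> 'v) measure" where
  "nu0 = measure_of B {U. openin bd.mtopology U} (\<lambda>A. H A / H B)"

lemma nu_eq: "nu K T \<epsilon> = completion nu0"
  by (simp add: nu_def nu0_def Let_def)

lemma opens_subset: "{U. openin bd.mtopology U} \<subseteq> Pow B"
  using bd.openin_mtopology by blast

lemma space_nu0 [simp]: "space nu0 = B"
  unfolding nu0_def by (rule space_measure_of[OF opens_subset])

lemma sets_nu0: "sets nu0 = sigma_sets B {U. openin bd.mtopology U}"
  unfolding nu0_def by (rule sets_measure_of[OF opens_subset])

lemma sets_nu0_subset: "sets nu0 \<subseteq> L"
proof -
  interpret L: sigma_algebra B L by (rule sigma_algebra_L)
  have "U \<in> L" if U: "openin bd.mtopology U" for U
  proof -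
    have "countable {v \<in> V. cyl v \<subseteq> U}" by (rule countable_subset[OF _ countable_V]) auto
    then have "(\<Union>v\<in>{v\<in>V. cyl v \<subseteq> U}. cyl v) \<in> L"
      by (intro L.countable_UN') (use cyl_in_L in auto)
    then show ?thesis using open_union_cyl[OF U] by simp
  qed
  then show ?thesis unfolding sets_nu0 by (intro L.sigma_sets_subset) auto
qed

lemma emeasure_nu0:
  assumes "A \<in> sets nu0"
  shows "emeasure nu0 A = H A / H B"
proof (rule emeasure_measure_of[OF nu0_def opens_subset _ _ assms])
  have ms: "positive L H" "countably_additive L H" using measure_space_H by (auto simp: measure_space_def)
  show "positive (sets nu0) (\<lambda>A. H A / H B)"
    using ms(1) by (simp add: positive_def)
  show "countably_additive (sets nu0) (\<lambda>A. H A / H B)"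
    unfolding countably_additive_def
  proof (intro allI impI)
    fix A :: "nat \<Rightarrow> (nat \<Rightarrow> 'v) set"
    assume "range A \<subseteq> sets nu0" "disjoint_family A" "(\<Union>i. A i) \<in> sets nu0"
    then have "(\<Sum>i. H (A i)) = H (\<Union>i. A i)"
      using ms(2) sets_nu0_subset unfolding countably_additive_def by blast
    then show "(\<Sum>i. H (A i) / H B) = H (\<Union>i. A i) / H B" by simp
  qed
qed

lemma cyl_in_nu0: "cyl v \<in> sets nu0"
  unfolding sets_nu0 using open_cyl by (intro sigma_sets.Basic) simp

lemma emeasure_nu0_boundary: "emeasure nu0 B = 1"
  using emeasure_nu0[OF sets.top[of nu0]] mass_0_pos by (simp add: H_boundary)

text \<open>The \<open>K\<^sup>n\<close> cylinders of level \<open>n\<close> have at most the mass they should have, and they add up to \<open>1\<close>.\<close>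

lemma emeasure_nu0_cyl:
  assumes v: "v \<in> level n"
  shows "emeasure nu0 (cyl v) = ennreal ((1 / real K) ^ n)"
proof (rule antisym)
  let ?q = "ennreal ((1 / real K) ^ n)"
  have le: "emeasure nu0 (cyl w) \<le> ?q" if w: "w \<in> level n" for w
  proof -
    have "emeasure nu0 (cyl w) \<le> mass n / mass 0"
      unfolding emeasure_nu0[OF cyl_in_nu0] H_boundary by (intro divide_right_mono_ennreal H_cyl_le w)
    also have "\<dots> = ?q"
      using mass_0_pos mass_eq[of n] mass_eq[of 0] by (simp add: mult.commute ennreal_mult_divide_eq)
    finally show ?thesis .
  qed
  then show "emeasure nu0 (cyl v) \<le> ?q" using v by blast
  have "1 = (\<Sum>w\<in>level n. emeasure nu0 (cyl w))"
    unfolding emeasure_nu0_boundary[symmetric] boundary_levels[of n]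
  proof (rule sum_emeasure[symmetric])
    show "cyl ` level n \<subseteq> sets nu0" using cyl_in_nu0 by blast
    show "disjoint_family_on cyl (level n)" by (auto simp: disjoint_family_on_def cyl_level)
  qed simp
  also have "\<dots> = emeasure nu0 (cyl v) + (\<Sum>w\<in>level n - {v}. emeasure nu0 (cyl w))"
    using v by (intro sum.remove) auto
  also have "\<dots> \<le> emeasure nu0 (cyl v) + (\<Sum>w\<in>level n - {v}. ?q)"
    by (intro add_left_mono sum_mono le) auto
  finally have a: "1 \<le> emeasure nu0 (cyl v) + (\<Sum>w\<in>level n - {v}. ?q)" .
  have "ennreal (real (K ^ n)) * ?q = 1"
    using K_pos by (subst ennreal_mult[symmetric]) (auto simp: power_one_over)
  moreover have "ennreal (real (K ^ n)) * ?q = (\<Sum>w\<in>level n. ?q)"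
    by (simp add: card_level ennreal_of_nat_eq_real_of_nat)
  moreover have "(\<Sum>w\<in>level n. ?q) = ?q + (\<Sum>w\<in>level n - {v}. ?q)"
    using v by (intro sum.remove) auto
  ultimately have "1 = ?q + (\<Sum>w\<in>level n - {v}. ?q)" by metis
  then have "?q + (\<Sum>w\<in>level n - {v}. ?q) \<le> emeasure nu0 (cyl v) + (\<Sum>w\<in>level n - {v}. ?q)"
    using a by simp
  moreover have "(\<Sum>w\<in>level n - {v}. ?q) < top" by (simp add: ennreal_mult_less_top of_nat_less_top)
  ultimately show "?q \<le> emeasure nu0 (cyl v)" using ennreal_add_left_cancel_le by (metis add.commute infinity_ennreal_def less_irrefl)
qed

abbreviation "N \<equiv> nu K T \<epsilon>"

lemma space_N [simp]: "space N = B"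
  by (simp add: nu_eq space_completion)

lemma cyl_in_N [simp, measurable]: "cyl v \<in> sets N"
  unfolding nu_eq by (rule sets_completionI_sets[OF cyl_in_nu0])

lemma emeasure_cyl: "v \<in> level n \<Longrightarrow> emeasure N (cyl v) = ennreal ((1 / real K) ^ n)"
  unfolding nu_eq using cyl_in_nu0 by (simp add: emeasure_nu0_cyl)

lemma emeasure_N: "emeasure N B = 1"
  using emeasure_cyl[of orig 0] cyl_origin level_0 by simp

sublocale N: finite_measure N
  by standard (simp add: emeasure_N)

end

section \<open>Densities bounded below on intervals\<close>

text \<open>
  A connected open set is an interval up to its end points. The assumption concerns intervals that
  stay away from \<open>0\<close> and \<open>1\<close>, so the interval is exhausted from inside.
\<close>

lemma nn_integral_bounded_component:
  fixes k :: "real \<Rightarrow> ennreal"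
  assumes k: "k \<in> borel_measurable borel" and c: "0 \<le> c"
    and ge: "\<And>a b. 0 < a \<Longrightarrow> a < b \<Longrightarrow> b < 1 \<Longrightarrow> ennreal (c * (b - a)) \<le> (\<integral>\<^sup>+t\<in>{a<..b}. k t \<partial>lborel)"
    and S: "open S" "connected S" "S \<subseteq> {0<..<1}"
  shows "ennreal c * emeasure lborel S \<le> (\<integral>\<^sup>+t\<in>S. k t \<partial>lborel)"
proof (cases "S = {}")
  case False
  have bd: "bdd_below S" "bdd_above S" using S(3) by (auto intro!: bdd_belowI[of _ 0] bdd_aboveI[of _ 1])
  define x y where "x = Inf S" and "y = Sup S"
  have sub: "S \<subseteq> {x..y}" using bd by (auto simp: x_def y_def intro: cInf_lower cSup_upper)
  have ab: "ennreal (c * (b - a)) \<le> (\<integral>\<^sup>+t\<in>S. k t \<partial>lborel)" if l: "x < a" "a < b" "b < y" for a b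
  proof -
    obtain s where s: "s \<in> S" "s < a" using l(1) bd False unfolding x_def by (meson cInf_less_iff)
    obtain t where t: "t \<in> S" "b < t" using l(3) bd False unfolding y_def by (meson less_cSup_iff)
    have "{s..t} \<subseteq> S" using S(2) s t connected_contains_Icc by blast
    then have "{a<..b} \<subseteq> S" using s t by auto
    then have "(\<integral>\<^sup>+t\<in>{a<..b}. k t \<partial>lborel) \<le> (\<integral>\<^sup>+t\<in>S. k t \<partial>lborel)" by (rule nn_set_integral_set_mono)
    moreover have "0 < a" "b < 1" using s t S(3) by force+
    ultimately show ?thesis using ge[of a b] l by simp
  qed
  have "emeasure lborel S \<le> emeasure lborel {x..y}" by (intro emeasure_mono sub) simp
  also have "\<dots> \<le> ennreal (y - x)"
    using False sub by (auto simp: emeasure_lborel_Icc_eq)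
  finally have le: "emeasure lborel S \<le> ennreal (y - x)" .
  have "ennreal c * ennreal (y - x) \<le> (\<integral>\<^sup>+t\<in>S. k t \<partial>lborel)"
  proof (cases "x < y")
    case True
    have "((\<lambda>r. ennreal (c * ((y - r) - (x + r)))) \<longlongrightarrow> ennreal (c * ((y - 0) - (x + 0)))) (at_right 0)"
      by (intro tendsto_intros)
    moreover have "\<forall>\<^sub>F r in at_right 0. ennreal (c * ((y - r) - (x + r))) \<le> (\<integral>\<^sup>+t\<in>S. k t \<partial>lborel)"
    proof -
      have "0 < (y - x) / 2" using True by simp
      from eventually_at_right_real[OF this] show ?thesis
      proof eventually_elim
        case (elim r)
        then show ?case using ab[of "x + r" "y - r"] by simp
      qed
    qed
    ultimately have "ennreal (c * ((y - 0) - (x + 0))) \<le> (\<integral>\<^sup>+t\<in>S. k t \<partial>lborel)"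
      by (rule tendsto_upperbound) simp
    then show ?thesis using c True by (simp add: ennreal_mult)
  next
    case False
    then show ?thesis by (simp add: ennreal_neg)
  qed
  then show ?thesis using le by (meson mult_left_mono order_trans zero_le)
qed simp

text \<open>
  The inequality of integrals passes from intervals to open sets componentwise, and from open sets to
  Borel sets by outer regularity of the finite measure with density \<open>k\<close>. On the set where \<open>k < c\<close>, it
  says that the integral of \<open>c - k\<close> vanishes.
\<close>

lemma AE_ge_if_interval_integrals_ge:
  fixes k :: "real \<Rightarrow> ennreal"
  assumes k[measurable]: "k \<in> borel_measurable borel" and c: "0 \<le> c"
    and fin: "(\<integral>\<^sup>+t\<in>{0<..<1}. k t \<partial>lborel) < \<infinity>"
    and ge: "\<And>a b. 0 < a \<Longrightarrow> a < b \<Longrightarrow> b < 1 \<Longrightarrow> ennreal (c * (b - a)) \<le> (\<integral>\<^sup>+t\<in>{a<..b}. k t \<partial>lborel)"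
  shows "AE t in lborel. t \<in> {0<..<1} \<longrightarrow> ennreal c \<le> k t"
proof -
  let ?I = "{0<..<1 :: real}"
  define M where "M = density lborel (\<lambda>t. k t * indicator ?I t)"
  have [simp]: "sets M = sets borel" by (simp add: M_def)
  have M: "emeasure M A = (\<integral>\<^sup>+t\<in>A \<inter> ?I. k t \<partial>lborel)" if "A \<in> sets borel" for A
    unfolding M_def using that
    by (subst emeasure_density) (auto simp: indicator_inter_arith mult_ac intro!: nn_integral_cong)
  have finM: "emeasure M A < \<infinity>" if "A \<in> sets borel" for A
  proof -
    have "emeasure M A \<le> (\<integral>\<^sup>+t\<in>?I. k t \<partial>lborel)"
      unfolding M[OF that] by (rule nn_set_integral_set_mono) simp
    then show ?thesis using fin by simp
  qed
  define A where "A = {t \<in> ?I. k t < ennreal c}"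
  have A[measurable]: "A \<in> sets borel" unfolding A_def by measurable
  have "ennreal c * emeasure lborel A \<le> emeasure M U" if U: "open U" "A \<subseteq> U" for U
  proof -
    let ?V = "U \<inter> ?I"
    have V: "open ?V" using U by auto
    let ?C = "components ?V"
    have C: "open S \<and> connected S \<and> S \<subseteq> ?V" if "S \<in> ?C" for S
      using that open_components[OF V] in_components_connected in_components_subset by blast
    have disj: "disjoint_family_on (\<lambda>S. S) ?C"
      using pairwise_disjoint_components[of ?V] by (auto simp: pairwise_def disjoint_family_on_def)
    have cnt: "countable ?C"
      using C pairwise_disjoint_components[of ?V]
      by (intro countable_disjoint_open_subsets) (auto simp: pairwise_def disjnt_def)
    have un: "?V = (\<Union>S\<in>?C. S)" using Union_components[of ?V] by simp
    have "ennreal c * emeasure lborel A \<le> ennreal c * emeasure lborel ?V"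
      using U V by (intro mult_left_mono emeasure_mono) (auto simp: A_def)
    also have "\<dots> = ennreal c * (\<integral>\<^sup>+S. emeasure lborel S \<partial>count_space ?C)"
      using emeasure_UN_countable[OF _ cnt disj, of lborel] C un by auto
    also have "\<dots> = (\<integral>\<^sup>+S. ennreal c * emeasure lborel S \<partial>count_space ?C)"
      by (subst nn_integral_cmult) auto
    also have "\<dots> \<le> (\<integral>\<^sup>+S. emeasure M S \<partial>count_space ?C)"
    proof (rule nn_integral_mono)
      fix S assume "S \<in> space (count_space ?C)"
      then have S: "open S" "connected S" "S \<subseteq> ?I" using C[of S] by auto
      then have "S \<inter> ?I = S" by blast
      then show "ennreal c * emeasure lborel S \<le> emeasure M S"
        using nn_integral_bounded_component[OF k c ge S] M[of S] S(1) by simp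
    qed
    also have "\<dots> = emeasure M ?V"
      using emeasure_UN_countable[OF _ cnt disj, of M] C un by auto
    also have "\<dots> \<le> emeasure M U" using U V by (intro emeasure_mono) auto
    finally show ?thesis .
  qed
  then have "ennreal c * emeasure lborel A \<le> (INF U\<in>{U. A \<subseteq> U \<and> open U}. emeasure M U)"
    by (intro INF_greatest) auto
  also have "\<dots> = emeasure M A"
    using finM[of "space M"] by (intro outer_regular[symmetric]) (auto simp: M_def)
  finally have le: "ennreal c * emeasure lborel A \<le> emeasure M A" .
  have "(\<integral>\<^sup>+t. (ennreal c - k t) * indicator A t \<partial>lborel) = 0"
  proof -
    have eA: "emeasure M A = (\<integral>\<^sup>+t\<in>A. k t \<partial>lborel)"
      using M[OF A] by (simp add: A_def Int_absorb2 subset_iff)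
    have "(\<integral>\<^sup>+t. (ennreal c - k t) * indicator A t \<partial>lborel) + emeasure M A
      = (\<integral>\<^sup>+t. (ennreal c - k t) * indicator A t + k t * indicator A t \<partial>lborel)"
      unfolding eA by (intro nn_integral_add[symmetric]) measurable
    also have "\<dots> = (\<integral>\<^sup>+t. ennreal c * indicator A t \<partial>lborel)"
      by (intro nn_integral_cong)
        (auto simp: A_def split: split_indicator intro: diff_add_cancel_ennreal)
    also have "\<dots> \<le> emeasure M A" using le by (simp add: nn_integral_cmult_indicator)
    finally have "emeasure M A + (\<integral>\<^sup>+t. (ennreal c - k t) * indicator A t \<partial>lborel) \<le> emeasure M A + 0"
      by (simp add: add.commute)
    then show ?thesis using finM[OF A] unfolding ennreal_add_left_cancel_le by auto
  qed
  then have "AE t in lborel. (ennreal c - k t) * indicator A t = 0"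
    by (subst (asm) nn_integral_0_iff_AE) auto
  then show ?thesis
  proof eventually_elim
    case (elim t)
    show ?case
    proof (rule impI, rule ccontr)
      assume t: "t \<in> ?I" "\<not> ennreal c \<le> k t"
      then have "t \<in> A" by (simp add: A_def)
      then have "ennreal c - k t = 0" using elim by simp
      moreover have "k t < ennreal c" using t by simp
      ultimately show False by (simp add: diff_eq_0_iff_ennreal)
    qed
  qed
qed

section \<open>Jensen's inequality for powers\<close>

lemma powr_tangent:
  fixes a y p :: real
  assumes "1 \<le> p" "0 < a" "0 \<le> y"
  shows "a powr p + p * a powr (p - 1) * (y - a) \<le> y powr p"
proof (cases "y = 0")
  case True
  have "a powr p = a powr (p - 1) * a" using assms by (simp add: powr_diff)
  then have "a powr p + p * a powr (p - 1) * (y - a) = (1 - p) * a powr p"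
    using True by (simp add: algebra_simps)
  also have "\<dots> \<le> 0" using assms by (intro mult_nonpos_nonneg) auto
  finally show ?thesis using True by simp
next
  case False
  have "y powr p - a powr p \<ge> (p * a powr (p - 1)) * (y - a)"
    using assms False
    by (intro convex_on_imp_above_tangent[of "{0<..}"] powr_convex)
      (auto simp: interior_open intro!: derivative_eq_intros)
  then show ?thesis by simp
qed

text \<open>
  The oscillation of \<open>f\<close> around \<open>c\<close> bounds that of its mean: integrate the tangent line of \<open>y \<mapsto> y\<^sup>p\<close> at
  the mean \<open>a\<close> of \<open>\<bar>f - c\<bar>\<close>.
\<close>

lemma powr_mean_le:
  fixes f :: "'a \<Rightarrow> real"
  assumes "finite_measure M" and A: "A \<in> sets M" "0 < measure M A"
    and f: "set_integrable M A f" "f \<in> borel_measurable M" and p: "1 \<le> p"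
  shows "ennreal (\<bar>(LINT x:A|M. f x) / measure M A - c\<bar> powr p) * emeasure M A
    \<le> (\<integral>\<^sup>+x\<in>A. ennreal (\<bar>f x - c\<bar> powr p) \<partial>M)"
proof -
  interpret finite_measure M by fact
  note [measurable] = A(1) f(2)
  let ?m = "measure M A" and ?g = "\<lambda>x. \<bar>f x - c\<bar>"
  have const: "set_integrable M A (\<lambda>x. b)" for b :: real
    unfolding set_integrable_def using A(1)
    by (intro integrable_scaleR_left integrable_real_indicator) (auto simp: emeasure_eq_measure)
  have diff: "set_integrable M A (\<lambda>x. f x - c)" by (intro set_integral_diff f const)
  have g: "set_integrable M A ?g" using set_integrable_abs[OF diff] .
  define a where "a = (LINT x:A|M. ?g x) / ?m"
  have "(LINT x:A|M. f x) / ?m - c = (LINT x:A|M. f x - c) / ?m"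
    using A(2) f const by (simp add: set_integral_diff set_integral_const field_simps)
  also have "\<bar>\<dots>\<bar> \<le> a"
    unfolding a_def abs_divide using A(2) set_integral_norm_bound[OF diff] by (simp add: divide_right_mono)
  finally have le: "\<bar>(LINT x:A|M. f x) / ?m - c\<bar> \<le> a" .
  show ?thesis
  proof (cases "a \<le> 0 \<or> (\<integral>\<^sup>+x\<in>A. ennreal (?g x powr p) \<partial>M) = \<infinity>")
    case True
    then show ?thesis
    proof
      assume "a \<le> 0"
      then have "\<bar>(LINT x:A|M. f x) / ?m - c\<bar> = 0" using le by linarith
      then show ?thesis by simp
    qed simp
  next
    case False
    then have a: "0 < a" and fin: "(\<integral>\<^sup>+x\<in>A. ennreal (?g x powr p) \<partial>M) < \<infinity>" by (auto simp: less_top)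
    have gp: "set_integrable M A (\<lambda>x. ?g x powr p)"
      unfolding set_integrable_def
    proof (rule integrableI_nonneg)
      have "(\<integral>\<^sup>+x. ennreal (indicat_real A x *\<^sub>R ?g x powr p) \<partial>M) = (\<integral>\<^sup>+x\<in>A. ennreal (?g x powr p) \<partial>M)"
        by (intro nn_integral_cong) (auto split: split_indicator)
      then show "(\<integral>\<^sup>+x. ennreal (indicat_real A x *\<^sub>R ?g x powr p) \<partial>M) < \<infinity>" using fin by simp
    qed auto
    let ?L = "\<lambda>x. a powr p + p * a powr (p - 1) * (?g x - a)"
    have gd: "set_integrable M A (\<lambda>x. ?g x - a)" by (intro set_integral_diff g const)
    have L: "set_integrable M A ?L"
      by (intro set_integral_add const set_integrable_mult_right gd)
    have "a powr p * ?m = (LINT x:A|M. ?L x)"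
    proof -
      have "(LINT x:A|M. ?L x) = a powr p * ?m + p * a powr (p - 1) * ((LINT x:A|M. ?g x) - a * ?m)"
        using g gd const by (simp add: set_integral_add set_integral_diff set_integral_const mult.commute)
      moreover have "(LINT x:A|M. ?g x) = a * ?m" using A(2) by (simp add: a_def)
      ultimately show ?thesis by simp
    qed
    also have "\<dots> \<le> (LINT x:A|M. ?g x powr p)"
      by (intro set_integral_mono L gp powr_tangent p a) auto
    finally have "ennreal (a powr p * ?m) \<le> ennreal (LINT x:A|M. ?g x powr p)" by (rule ennreal_leI)
    also have "\<dots> = (\<integral>\<^sup>+x\<in>A. ennreal (?g x powr p) \<partial>M)"
      using gp unfolding set_integrable_def set_lebesgue_integral_def
      by (subst nn_integral_eq_integral[symmetric]) (auto intro!: nn_integral_cong split: split_indicator)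
    finally have "ennreal (a powr p * ?m) \<le> (\<integral>\<^sup>+x\<in>A. ennreal (?g x powr p) \<partial>M)" .
    moreover have "ennreal (\<bar>(LINT x:A|M. f x) / ?m - c\<bar> powr p) * emeasure M A \<le> ennreal (a powr p * ?m)"
      using le p a by (simp add: emeasure_eq_measure flip: ennreal_mult) (intro ennreal_leI mult_right_mono powr_mono2; simp)
    ultimately show ?thesis by (rule order_trans[rotated])
  qed
qed

section \<open>Interpolation of vertex functions\<close>

context kary_tree
begin

definition interp :: "('v \<Rightarrow> real) \<Rightarrow> 'v point \<Rightarrow> real" where
  "interp U x = (if fst x = orig then U orig
     else (1 - snd x) * U (par (fst x)) + snd x * U (fst x))"

definition incr :: "('v \<Rightarrow> real) \<Rightarrow> 'v \<Rightarrow> real" where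
  "incr U v = U v - U (par v)"

text \<open>
  The slope of the interpolation with respect to \<open>d\<^sub>X\<close>. The exponential factor is the inverse of the
  density of \<open>d\<^sub>X\<close> with respect to length.
\<close>

definition slope :: "('v \<Rightarrow> real) \<Rightarrow> 'v point \<Rightarrow> ennreal" where
  "slope U x = ennreal (\<bar>incr U (fst x)\<bar> * exp (\<epsilon> * hgt x))"

lemma interp_measurable: "interp U \<in> borel_measurable XB"
  by (rule measurable_XB_I) (simp_all add: interp_def measurable_restrict_space1)

lemma slope_measurable: "slope U \<in> borel_measurable XB"
proof (rule measurable_XB_I)
  fix v
  have "(\<lambda>t. ennreal (\<bar>incr U v\<bar> * exp (\<epsilon> * (real (lev v) + t - 1)))) \<in> borel_measurable lborel" by measurable
  then show "(\<lambda>t. slope U (v, t)) \<in> borel_measurable unit_len"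
    by (simp add: slope_def hgt_def measurable_restrict_space1)
qed simp

lemma stem_in_XB: assumes "x \<in> P" shows "stem x \<in> sets XB"
proof -
  obtain w s where x: "x = (w, s)" by force
  have "(\<lambda>z. z \<in> stem x) \<in> measurable XB (count_space UNIV)"
  proof (rule measurable_XB_I)
    fix v assume v: "v \<in> V0"
    have "(v, t) \<in> stem x \<longleftrightarrow> (if v = w then t \<le> s else lev v < lev w \<and> anc w (lev v) = v)"
      if "t \<in> {0<..1}" for t
      using stem_iff[of w s v t] assms x v that by (auto simp: points_def)
    then have "(\<lambda>t. (v, t) \<in> stem x) \<in> measurable unit_len (count_space UNIV) \<longleftrightarrow>
      (\<lambda>t. if v = w then t \<le> s else lev v < lev w \<and> anc w (lev v) = v) \<in> measurable unit_len (count_space UNIV)"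
      by (intro measurable_cong) simp
    then show "(\<lambda>t. (v, t) \<in> stem x) \<in> measurable unit_len (count_space UNIV)"
      by (simp add: measurable_restrict_space1)
  qed simp
  then have "{z \<in> space XB. z \<in> stem x} \<in> sets XB" by (simp only: pred_def)
  also have "{z \<in> space XB. z \<in> stem x} = stem x" by (auto simp: stem_def)
  finally show ?thesis .
qed

lemma point_in_XB: assumes "x \<in> P" shows "{x} \<in> sets XB"
proof (cases "fst x = orig")
  case True
  then show ?thesis using origin_in_XB pointsD(4)[OF assms] by (metis prod.collapse)
next
  case False
  then have "{fst x} \<times> {snd x} \<in> sets XB" using pointsD[OF assms] by (intro edge_part_in_XB) auto
  then show ?thesis by simp
qed

lemma segment_in_XB: "x \<in> P \<Longrightarrow> y \<in> P \<Longrightarrow> segment T x y \<in> sets XB"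
  unfolding segment_eq by (intro sets.Un sets.Diff stem_in_XB point_in_XB meet_in)

lemma nn_integral_segment:
  assumes [measurable]: "g \<in> borel_measurable XB" and "z \<in> P" "y \<in> P"
  shows "(\<integral>\<^sup>+x\<in>segment T z y. g x * ennreal (exp (- \<epsilon> * height T x)) \<partial>length_measure T \<epsilon>)
    = (\<integral>\<^sup>+x. g x * ennreal (exp (- \<epsilon> * hgt x)) * indicator (segment T z y) x \<partial>E)"
proof -
  note [measurable] = segment_in_XB[OF assms(2,3)]
  have "(\<integral>\<^sup>+x\<in>segment T z y. g x * ennreal (exp (- \<epsilon> * height T x)) \<partial>length_measure T \<epsilon>)
      = (\<integral>\<^sup>+x\<in>segment T z y. g x * ennreal (exp (- \<epsilon> * height T x)) \<partial>E)"
    by (rule nn_integral_length) measurable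
  also have "\<dots> = (\<integral>\<^sup>+x. g x * ennreal (exp (- \<epsilon> * hgt x)) * indicator (segment T z y) x \<partial>E)"
    by (intro nn_integral_cong) (simp add: height_eq space_E_points)
  finally show ?thesis .
qed

lemma incr_measurable: "(\<lambda>x. incr U (fst x)) \<in> borel_measurable E"
  by (rule measurable_edgeI) simp

lemma interp_integral:
  assumes "x \<in> P"
  shows "set_integrable E (stem x) (\<lambda>z. incr U (fst z)) \<and>
    (LINT z:stem x|E. incr U (fst z)) = interp U x - interp U origin_pt"
proof (rule integral_stem[OF incr_measurable _ assms])
  fix v s assume "(v, s) \<in> P" "v \<noteq> orig"
  then have s: "0 < s" and "interp U (v, s) - interp U (par v, 1) = s * incr U v"
    by (auto simp: points_def interp_def incr_def algebra_simps)
  then show "set_integrable lborel {0<..s} (\<lambda>t. incr U (fst (v, t))) \<and>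
      (LBINT t:{0<..s}. incr U (fst (v, t))) = interp U (v, s) - interp U (par v, 1)"
    by (simp add: set_integrable_def set_integral_const)
qed

text \<open>
  The interpolation is the integral of the increments along stems. So a difference of two values is the
  integral of the increments over one stem minus that over another one, and the common part cancels.
\<close>

lemma slope_upper_gradient: "upper_gradient T \<epsilon> (interp U) (slope U)"
  unfolding upper_gradient_def
proof (intro conjI ballI)
  fix z y assume zy: "z \<in> P" "y \<in> P"
  let ?F = "\<lambda>x. incr U (fst x)"
  let ?f = "\<lambda>x. indicator (stem z) x *\<^sub>R ?F x - indicator (stem y) x *\<^sub>R ?F x"
  note I = interp_integral[of _ U, unfolded set_integrable_def set_lebesgue_integral_def]
  note Iz = conjunct1[OF I[OF zy(1)]] conjunct2[OF I[OF zy(1)]]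
  note Iy = conjunct1[OF I[OF zy(2)]] conjunct2[OF I[OF zy(2)]]
  have int: "integrable E ?f" using Iz(1) Iy(1) by (rule Bochner_Integration.integrable_diff)
  have "(\<integral>x. ?f x \<partial>E) = interp U z - interp U y"
    unfolding Bochner_Integration.integral_diff[OF Iz(1) Iy(1)] Iz(2) Iy(2) by simp
  then have "ennreal \<bar>interp U z - interp U y\<bar> \<le> (\<integral>\<^sup>+x. ennreal (norm (?f x)) \<partial>E)"
    using integral_norm_bound_ennreal[OF int] by (metis real_norm_def)
  also have "\<dots> \<le> (\<integral>\<^sup>+x. slope U x * ennreal (exp (- \<epsilon> * hgt x)) * indicator (segment T z y) x \<partial>E)"
  proof (rule nn_integral_mono)
    fix x
    have "slope U x * ennreal (exp (- \<epsilon> * hgt x)) = ennreal \<bar>?F x\<bar>"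
      by (simp add: slope_def mult.assoc mult_exp_exp flip: ennreal_mult)
    then show "ennreal (norm (?f x)) \<le> slope U x * ennreal (exp (- \<epsilon> * hgt x)) * indicator (segment T z y) x"
      unfolding segment_eq[OF zy] by (auto split: split_indicator)
  qed
  also have "\<dots> = (\<integral>\<^sup>+x\<in>segment T z y. slope U x * ennreal (exp (- \<epsilon> * height T x)) \<partial>length_measure T \<epsilon>)"
    by (rule nn_integral_segment[symmetric, OF slope_measurable zy])
  finally show "ennreal \<bar>interp U z - interp U y\<bar> \<le> \<dots>" .
qed (rule slope_measurable)

lemma upper_gradient_edge:
  assumes "upper_gradient T \<epsilon> (interp U) g" "v \<in> V0" "0 < a" "a < b" "b \<le> 1"
  shows "ennreal (\<bar>incr U v\<bar> * (b - a)) \<le> (\<integral>\<^sup>+t\<in>{a<..b}. g (v, t) * ennreal (exp (- \<epsilon> * hgt (v, t))) \<partial>lborel)"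
proof -
  have g: "g \<in> borel_measurable XB" using assms(1) by (simp add: upper_gradient_def)
  have P: "(v, a) \<in> P" "(v, b) \<in> P" using assms by (auto simp: points_def)
  let ?G = "\<lambda>x. g x * ennreal (exp (- \<epsilon> * hgt x))"
  have G: "?G \<in> borel_measurable E"
    using measurable_XB_E[OF g] measurable_hgt by measurable
  have "gprod (v, a) (v, b) = hgt (v, a)"
    using assms by (auto simp: gprod_def hgt_def meet_lev_self)
  then have m: "meet (v, a) (v, b) = (v, a)" by (simp add: meet_def)
  have sub: "{v} \<times> {a<..b} \<union> {(v, a)} \<supseteq> segment T (v, a) (v, b)"
    unfolding segment_eq[OF P] m using P assms by (auto simp: stem_iff split: if_splits)
  have "interp U (v, b) - interp U (v, a) = incr U v * (b - a)"
    using assms by (simp add: interp_def incr_def algebra_simps)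
  then have "ennreal (\<bar>incr U v\<bar> * (b - a)) = ennreal \<bar>interp U (v, a) - interp U (v, b)\<bar>"
    using assms abs_minus_commute[of "interp U (v, a)" "interp U (v, b)"] by (simp add: abs_mult)
  also have "\<dots> \<le> (\<integral>\<^sup>+x. ?G x * indicator (segment T (v, a) (v, b)) x \<partial>E)"
    using assms(1) P unfolding upper_gradient_def nn_integral_segment[OF g P, symmetric] by blast
  also have "\<dots> \<le> (\<integral>\<^sup>+x. ?G x * indicator ({v} \<times> {a<..b}) x \<partial>E)"
  proof (rule nn_integral_mono_AE)
    show "AE x in E. ?G x * indicator (segment T (v, a) (v, b)) x \<le> ?G x * indicator ({v} \<times> {a<..b}) x"
      using AE_edge_neq[of "(v, a)"]
    proof eventually_elim
      case (elim x)
      then show ?case using sub by (auto split: split_indicator)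
    qed
  qed
  also have "\<dots> = (\<integral>\<^sup>+t\<in>{a<..b}. ?G (v, t) \<partial>lborel)"
    using assms by (intro nn_integral_edge_part G) auto
  finally show ?thesis .
qed

text \<open>
  On an edge, the slope times the density of \<open>d\<^sub>X\<close> is the constant \<open>\<bar>incr U v\<bar>\<close>, and the integrals of
  \<open>f\<close> times this density over all subintervals are at least those of this constant. Integrability of \<open>f\<close>
  on the edge comes from \<open>f \<le> 1 + f\<^sup>p\<close>, as the density of \<open>\<mu>\<close> is bounded below there.
\<close>

lemma slope_minimal:
  assumes f: "upper_gradient T \<epsilon> (interp U) f" and fin: "(\<integral>\<^sup>+x. enn_powr (f x) p \<partial>mu T \<epsilon> \<beta>) < \<infinity>"
    and p: "1 \<le> p" and \<beta>: "0 \<le> \<beta>"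
  shows "AE x in mu T \<epsilon> \<beta>. slope U x \<le> f x"
proof (rule AE_mu_I)
  have hm: "f \<in> borel_measurable XB" using f by (simp add: upper_gradient_def)
  then show "{x \<in> P. slope U x \<le> f x} \<in> sets XB"
    using borel_measurable_le[OF slope_measurable hm] by simp
  fix v assume v: "v \<in> V0"
  let ?k = "\<lambda>t. f (v, t) * ennreal (exp (- \<epsilon> * hgt (v, t)))"
  define k where "k t = ?k t * indicator {0<..1} t" for t
  have hv: "(\<lambda>t. f (v, t)) \<in> borel_measurable unit_len"
    using measurable_edgeD[OF measurable_XB_E[OF hm] v] .
  have "(\<lambda>t. ennreal (exp (- \<epsilon> * (real (lev v) + t - 1)))) \<in> borel_measurable lborel" by measurable
  then have "?k \<in> borel_measurable unit_len"
    using hv by (intro borel_measurable_times_ennreal) (simp_all add: hgt_def measurable_restrict_space1)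
  then have km: "k \<in> borel_measurable borel"
    unfolding k_def by (subst (asm) borel_measurable_restrict_space_iff_ennreal) auto
  have "AE t in lborel. t \<in> {0<..<1} \<longrightarrow> ennreal \<bar>incr U v\<bar> \<le> k t"
  proof (rule AE_ge_if_interval_integrals_ge[OF km])
    fix a b :: real assume ab: "0 < a" "a < b" "b < 1"
    have "(\<integral>\<^sup>+t\<in>{a<..b}. ?k t \<partial>lborel) = (\<integral>\<^sup>+t\<in>{a<..b}. k t \<partial>lborel)"
      using ab by (intro nn_integral_cong) (auto simp: k_def split: split_indicator)
    then show "ennreal (\<bar>incr U v\<bar> * (b - a)) \<le> (\<integral>\<^sup>+t\<in>{a<..b}. k t \<partial>lborel)"
      using upper_gradient_edge[OF f v, of a b] ab by simp
  next
    obtain n where n: "v \<in> level (Suc n)" using v V0_levels by blast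
    let ?w = "\<lambda>t. ennreal (exp (- \<beta> * (real n + t)))"
    let ?c = "ennreal (exp (\<beta> * (real n + 1)))"
    have hp: "(\<lambda>x. enn_powr (f x) p) \<in> borel_measurable XB"
      using hm unfolding enn_powr_def by measurable
    have Wm: "(\<lambda>t. ?w t * enn_powr (f (v, t)) p * indicator {0<..1} t) \<in> borel_measurable lborel"
    proof -
      have "(\<lambda>t. enn_powr (f (v, t)) p) \<in> borel_measurable unit_len"
        using measurable_edgeD[OF measurable_XB_E[OF hp] v] .
      then have "(\<lambda>t. ?w t * enn_powr (f (v, t)) p) \<in> borel_measurable unit_len"
        by (intro borel_measurable_times_ennreal) (simp_all add: measurable_restrict_space1)
      then show ?thesis by (subst (asm) borel_measurable_restrict_space_iff_ennreal) auto
    qed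
    have W: "(\<integral>\<^sup>+t\<in>{0<..1}. ?w t * enn_powr (f (v, t)) p \<partial>lborel) < \<infinity>"
    proof -
      let ?J = "\<lambda>n v. \<integral>\<^sup>+t\<in>{0<..1}. ennreal (exp (- \<beta> * (real n + t))) * enn_powr (f (v, t)) p \<partial>lborel"
      have "?J n v \<le> (\<Sum>v\<in>level (Suc n). ?J n v)"
        using n by (intro member_le_sum) auto
      also have "\<dots> \<le> (\<Sum>n. \<Sum>v\<in>level (Suc n). ?J n v)"
        using sum_le_suminf[of "\<lambda>n. \<Sum>v\<in>level (Suc n). ?J n v" "{n}"] by simp
      also have "\<dots> < \<infinity>" using fin nn_integral_mu[OF hp] by simp
      finally show ?thesis .
    qed
    have "(\<integral>\<^sup>+t\<in>{0<..<1}. k t \<partial>lborel) \<le>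
      (\<integral>\<^sup>+t. indicator {0<..1} t + ?c * (?w t * enn_powr (f (v, t)) p * indicator {0<..1} t) \<partial>lborel)"
    proof (rule nn_integral_mono)
      fix t :: real
      show "k t * indicator {0<..<1} t \<le> indicator {0<..1} t + ?c * (?w t * enn_powr (f (v, t)) p * indicator {0<..1} t)"
      proof (cases "t \<in> {0<..<1}")
        case True
        have "?k t \<le> f (v, t) * 1"
          using v True hgt_nonneg[of "(v, t)"] eps
          by (intro mult_left_mono) (auto simp: points_def)
        also have "\<dots> \<le> 1 + enn_powr (f (v, t)) p"
        proof (cases "f (v, t)")
          case (real r)
          have "r \<le> 1 + r powr p"
            using real p powr_mono[of 1 p r] by (cases "r \<le> 1") (auto simp: add_increasing2)
          then have "ennreal r \<le> ennreal (1 + r powr p)" by (rule ennreal_leI)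
          also have "\<dots> = 1 + ennreal (r powr p)" by (simp add: ennreal_plus)
          finally show ?thesis using real by (simp add: enn_powr_ennreal)
        qed (simp add: enn_powr_def)
        also have "enn_powr (f (v, t)) p \<le> (?c * ?w t) * enn_powr (f (v, t)) p"
        proof -
          have "1 \<le> exp (\<beta> * (real n + 1)) * exp (- \<beta> * (real n + t))"
            using \<beta> True by (simp add: mult_exp_exp algebra_simps mult_left_le)
          then have "1 \<le> ?c * ?w t" by (simp flip: ennreal_mult ennreal_1)
          then show ?thesis using mult_right_mono[of 1 "?c * ?w t" "enn_powr (f (v, t)) p"] by simp
        qed
        finally show ?thesis using True by (simp add: k_def mult.assoc)
      qed simp
    qed
    also have "\<dots> = emeasure lborel {0<..1::real} +
        ?c * (\<integral>\<^sup>+t\<in>{0<..1}. ?w t * enn_powr (f (v, t)) p \<partial>lborel)"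
    proof (subst nn_integral_add)
      show "(\<integral>\<^sup>+t. indicator {0<..1 :: real} t \<partial>lborel) +
          (\<integral>\<^sup>+t. ?c * (?w t * enn_powr (f (v, t)) p * indicator {0<..1} t) \<partial>lborel) =
          emeasure lborel {0<..1::real} + ?c * (\<integral>\<^sup>+t\<in>{0<..1}. ?w t * enn_powr (f (v, t)) p \<partial>lborel)"
        unfolding nn_integral_cmult[OF Wm] by (subst nn_integral_indicator) auto
    qed (use Wm in auto)
    also have "\<dots> < \<infinity>" using W by (simp add: ennreal_mult_less_top)
    finally show "(\<integral>\<^sup>+t\<in>{0<..<1}. k t \<partial>lborel) < \<infinity>" .
  qed simp
  moreover have "AE t in lborel. t \<noteq> (1 :: real)" by (rule AE_lborel_singleton)
  ultimately show "AE t in lborel. t \<in> {0<..1} \<longrightarrow> slope U (v, t) \<le> f (v, t)"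
  proof eventually_elim
    case (elim t)
    show ?case
    proof
      assume t: "t \<in> {0<..1}"
      let ?e = "ennreal (exp (\<epsilon> * hgt (v, t)))"
      have "ennreal \<bar>incr U v\<bar> * ?e \<le> ?k t * ?e"
        using elim t by (intro mult_right_mono) (auto simp: k_def)
      also have "\<dots> = f (v, t)"
        by (simp add: mult.assoc mult_exp_exp flip: ennreal_mult)
      finally show "slope U (v, t) \<le> f (v, t)" by (simp add: slope_def ennreal_mult)
    qed
  qed
qed

end

section \<open>Limits at the boundary\<close>

context kary_tree
begin

lemma vertex_point_eq: "vertex_point v = (v, 1)"
  by (simp add: vertex_point_def)

text \<open>The Gromov product of a point and a boundary point.\<close>

definition bprod :: "'v point \<Rightarrow> (nat \<Rightarrow> 'v) \<Rightarrow> real" where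
  "bprod x \<zeta> = min (hgt x) (real (meet_lev (fst x) (\<zeta> (lev (fst x)))))"

text \<open>
  The vertices of the ray to \<open>\<zeta>\<close> beyond the level of \<open>x\<close> see \<open>x\<close> branch off at the same height. So the limit
  that defines the distance to the boundary can be computed.
\<close>

lemma gprod_boundary:
  assumes "\<zeta> \<in> B" "x \<in> P" "lev (fst x) \<le> m"
  shows "gprod x (vertex_point (\<zeta> m)) = bprod x \<zeta>"
proof -
  note p = pointsD[OF assms(2)]
  have "meet_lev (fst x) (\<zeta> m) = meet_lev (fst x) (\<zeta> (lev (fst x)))"
    by (rule eq_nat_if_le_iff)
      (use assms p boundary_in[OF assms(1)] in \<open>auto simp: le_meet_lev_iff boundary_anc\<close>)
  moreover have "hgt x \<le> real m" using assms(3) p by (simp add: hgt_def)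
  ultimately show ?thesis
    using boundary_vertex(2)[OF assms(1), of m] by (simp add: gprod_def bprod_def vertex_point_def)
qed

lemma dist_to_boundary_eq:
  assumes "\<zeta> \<in> B" "x \<in> P"
  shows "dist_to_boundary T \<epsilon> x \<zeta> = (2 * exp (- \<epsilon> * bprod x \<zeta>) - exp (- \<epsilon> * hgt x)) / \<epsilon>"
proof -
  let ?r = "2 * exp (- \<epsilon> * bprod x \<zeta>) - exp (- \<epsilon> * hgt x)"
  have "(\<lambda>n. exp (- \<epsilon>) ^ n) \<longlonglongrightarrow> 0" using eps by (intro LIMSEQ_power_zero) simp
  then have "(\<lambda>n. (?r - exp (- \<epsilon>) ^ n) / \<epsilon>) \<longlonglongrightarrow> (?r - 0) / \<epsilon>"
    using eps by (intro tendsto_intros) auto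
  moreover have "\<forall>\<^sub>F n in sequentially. (?r - exp (- \<epsilon>) ^ n) / \<epsilon> = dX T \<epsilon> x (vertex_point (\<zeta> n))"
    using eventually_ge_at_top[of "lev (fst x)"]
  proof eventually_elim
    case (elim n)
    then show ?case
      using gprod_boundary[OF assms elim] boundary_vertex[OF assms(1), of n] assms
      by (simp add: dX_eq mult.commute flip: exp_of_nat_mult)
  qed
  ultimately have "(\<lambda>n. dX T \<epsilon> x (vertex_point (\<zeta> n))) \<longlonglongrightarrow> ?r / \<epsilon>"
    by (simp add: tendsto_cong)
  then show ?thesis unfolding dist_to_boundary_def by (rule limI)
qed

lemma bprod_le: "bprod x \<zeta> \<le> hgt x"
  by (simp add: bprod_def)

lemma bprod_gt_if_dist_less:
  assumes "\<zeta> \<in> B" "x \<in> P" "dist_to_boundary T \<epsilon> x \<zeta> < exp (- \<epsilon> * R) / \<epsilon>"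
  shows "R < bprod x \<zeta>"
proof -
  have "exp (- \<epsilon> * hgt x) \<le> exp (- \<epsilon> * bprod x \<zeta>)" using bprod_le eps by simp
  then have "exp (- \<epsilon> * bprod x \<zeta>) / \<epsilon> \<le> dist_to_boundary T \<epsilon> x \<zeta>"
    unfolding dist_to_boundary_eq[OF assms(1,2)] using eps by (intro divide_right_mono) auto
  then have "exp (- \<epsilon> * bprod x \<zeta>) / \<epsilon> < exp (- \<epsilon> * R) / \<epsilon>" using assms(3) by simp
  then show ?thesis using eps by (simp add: divide_less_cancel)
qed

lemma ray_vertex:
  assumes z: "\<zeta> \<in> B" and x: "x \<in> ray T \<zeta>"
  shows "x \<in> P" "fst x = \<zeta> (lev (fst x))"
proof -
  obtain n where n: "x \<in> segment T origin_pt (\<zeta> n, 1)"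
    using x by (auto simp: ray_def vertex_point_eq)
  have zP: "(\<zeta> n, 1) \<in> P" "origin_pt \<in> P" using boundary_in[OF z] by auto
  have "meet origin_pt (\<zeta> n, 1) = origin_pt"
    using gprod_nonneg[OF zP(2,1)] gprod_le(1)[of origin_pt "(\<zeta> n, 1)"] by (simp add: meet_def hgt_def)
  then have xs: "x \<in> stem (\<zeta> n, 1) \<or> x = origin_pt"
    using n unfolding segment_eq[OF zP(2,1)] stem_origin by auto
  then show "x \<in> P" using zP(2) by (auto simp: stem_def)
  have z0: "\<zeta> 0 = orig" using z by (simp add: boundary_def)
  obtain w t where wt: "x = (w, t)" by force
  show "fst x = \<zeta> (lev (fst x))"
    using xs
  proof
    assume "x \<in> stem (\<zeta> n, 1)"
    then have "w = \<zeta> n \<or> lev w < n \<and> anc (\<zeta> n) (lev w) = w"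
      using stem_iff[OF zP(1), of w t] z unfolding wt by (auto split: if_splits)
    then show ?thesis using boundary_anc[OF z, of "lev w" n] z unfolding wt by auto
  qed (use z0 in simp)
qed

lemma vertex_in_ray:
  assumes "\<zeta> \<in> B"
  shows "vertex_point (\<zeta> n) \<in> ray T \<zeta>"
proof -
  have zP: "(\<zeta> n, 1) \<in> P" using boundary_in[OF assms] by auto
  have "(\<zeta> n, 1) \<in> stem (\<zeta> n, 1)" using zP by (simp add: stem_iff)
  moreover have "(\<zeta> n, 1) \<in> segment T origin_pt (\<zeta> n, 1)" if "\<zeta> n = orig"
  proof -
    have "meet origin_pt origin_pt = origin_pt" by (simp add: meet_def gprod_self)
    then show ?thesis using that by (simp add: segment_eq)
  qed
  ultimately have "(\<zeta> n, 1) \<in> segment T origin_pt (\<zeta> n, 1)"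
    using segment_eq[of origin_pt "(\<zeta> n, 1)"] zP by (cases "\<zeta> n = orig") (auto simp: stem_origin)
  then show ?thesis by (auto simp: ray_def vertex_point_eq)
qed

lemma interp_near_boundary:
  assumes z: "\<zeta> \<in> B" and lim: "(\<lambda>n. U (\<zeta> n)) \<longlonglongrightarrow> l" and e: "0 < e"
  shows "\<exists>R. \<forall>x\<in>P. fst x = \<zeta> (lev (fst x)) \<longrightarrow> R < hgt x \<longrightarrow> \<bar>interp U x - l\<bar> < e"
proof -
  obtain M where M: "\<And>n. M \<le> n \<Longrightarrow> \<bar>U (\<zeta> n) - l\<bar> < e"
    using lim e by (auto simp: LIMSEQ_iff)
  have "\<bar>interp U x - l\<bar> < e" if x: "x \<in> P" "fst x = \<zeta> (lev (fst x))" "real M + 1 < hgt x" for x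
  proof -
    note p = pointsD[OF x(1)]
    obtain k where k: "lev (fst x) = k" by blast
    have "real M + 1 < real k" using x(3) p k by (simp add: hgt_def)
    then obtain j where j: "k = Suc j" "M \<le> j" by (cases k) auto
    have f: "fst x = \<zeta> (Suc j)" "par (\<zeta> (Suc j)) = \<zeta> j" "fst x \<noteq> orig"
      using x(2) k j z boundary_iff by auto
    let ?s = "snd x"
    have "interp U x - l = (1 - ?s) * (U (\<zeta> j) - l) + ?s * (U (\<zeta> (Suc j)) - l)"
      using f by (simp add: interp_def algebra_simps)
    also have "\<bar>\<dots>\<bar> \<le> (1 - ?s) * \<bar>U (\<zeta> j) - l\<bar> + ?s * \<bar>U (\<zeta> (Suc j)) - l\<bar>"
      using p by (intro order_trans[OF abs_triangle_ineq]) (simp add: abs_mult)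
    also have "\<dots> < (1 - ?s) * e + ?s * e"
      using p M[of j] M[of "Suc j"] j
      by (intro add_le_less_mono mult_left_mono mult_strict_left_mono) auto
    finally show ?thesis by (simp add: algebra_simps)
  qed
  then show ?thesis by blast
qed

lemma eventually_radial_height:
  assumes "\<zeta> \<in> B"
  shows "\<forall>\<^sub>F x in radial T \<epsilon> \<zeta>. x \<in> P \<and> fst x = \<zeta> (lev (fst x)) \<and> R < hgt x"
proof -
  have "\<forall>\<^sub>F y :: real in nhds 0. y < exp (- \<epsilon> * R) / \<epsilon>"
    using eps by (intro eventually_nhds_in_open[of "{..<_}", simplified]) auto
  then have "\<forall>\<^sub>F x in filtercomap (\<lambda>x. dist_to_boundary T \<epsilon> x \<zeta>) (nhds 0).
      dist_to_boundary T \<epsilon> x \<zeta> < exp (- \<epsilon> * R) / \<epsilon>"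
    by (rule eventually_filtercomapI)
  then show ?thesis
    unfolding radial_def eventually_inf_principal
  proof eventually_elim
    case (elim x)
    show ?case
    proof
      assume "x \<in> ray T \<zeta>"
      note x = ray_vertex[OF assms this]
      have "R < bprod x \<zeta>" using bprod_gt_if_dist_less[OF assms x(1) elim] .
      then show "x \<in> P \<and> fst x = \<zeta> (lev (fst x)) \<and> R < hgt x" using x bprod_le[of x \<zeta>] by auto
    qed
  qed
qed

lemma radial_not_bot:
  assumes "\<zeta> \<in> B"
  shows "radial T \<epsilon> \<zeta> \<noteq> bot"
proof
  assume "radial T \<epsilon> \<zeta> = bot"
  then have "\<forall>\<^sub>F x in radial T \<epsilon> \<zeta>. False" by simp
  then obtain Q' where Q': "\<forall>\<^sub>F y in nhds 0. Q' y" "\<And>x. Q' (dist_to_boundary T \<epsilon> x \<zeta>) \<Longrightarrow> x \<notin> ray T \<zeta>"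
    unfolding radial_def eventually_inf_principal eventually_filtercomap by auto
  have "dist_to_boundary T \<epsilon> (vertex_point (\<zeta> n)) \<zeta> = exp (- \<epsilon>) ^ n / \<epsilon>" for n
  proof -
    have "fst (vertex_point (\<zeta> n)) = \<zeta> n" by (simp add: vertex_point_def)
    then have "bprod (vertex_point (\<zeta> n)) \<zeta> = n"
      using assms boundary_vertex[OF assms, of n] boundary_in[OF assms]
      by (simp add: bprod_def meet_lev_self)
    then show ?thesis
      using dist_to_boundary_eq[OF assms boundary_vertex(1)[OF assms, of n]] boundary_vertex(2)[OF assms, of n]
      by (simp add: mult.commute flip: exp_of_nat_mult)
  qed
  moreover have "(\<lambda>n. exp (- \<epsilon>) ^ n / \<epsilon>) \<longlonglongrightarrow> 0 / \<epsilon>"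
    using eps by (intro tendsto_divide LIMSEQ_power_zero tendsto_const) auto
  ultimately have "filterlim (\<lambda>n. dist_to_boundary T \<epsilon> (vertex_point (\<zeta> n)) \<zeta>) (nhds 0) sequentially" by simp
  with Q'(1) have "\<forall>\<^sub>F n in sequentially. Q' (dist_to_boundary T \<epsilon> (vertex_point (\<zeta> n)) \<zeta>)"
    by (simp add: filterlim_iff)
  then have "\<forall>\<^sub>F n in sequentially. vertex_point (\<zeta> n) \<notin> ray T \<zeta>"
    by eventually_elim (rule Q'(2))
  then show False using vertex_in_ray[OF assms] by simp
qed

lemma interp_radial_limit:
  assumes z: "\<zeta> \<in> B" and lim: "(\<lambda>n. U (\<zeta> n)) \<longlonglongrightarrow> l"
  shows "(interp U \<longlongrightarrow> l) (radial T \<epsilon> \<zeta>)" "boundary_trace T \<epsilon> (interp U) \<zeta> = l"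
proof -
  show tl: "(interp U \<longlongrightarrow> l) (radial T \<epsilon> \<zeta>)"
    unfolding tendsto_iff
  proof (intro allI impI)
    fix e :: real assume "0 < e"
    then obtain R where "\<And>x. x \<in> P \<Longrightarrow> fst x = \<zeta> (lev (fst x)) \<Longrightarrow> R < hgt x \<Longrightarrow> \<bar>interp U x - l\<bar> < e"
      using interp_near_boundary[OF z lim] by blast
    then show "\<forall>\<^sub>F x in radial T \<epsilon> \<zeta>. dist (interp U x) l < e"
      using eventually_radial_height[OF z, of R] by (auto simp: dist_real_def elim!: eventually_mono)
  qed
  show "boundary_trace T \<epsilon> (interp U) \<zeta> = l"
    unfolding boundary_trace_def by (rule tendsto_Lim[OF radial_not_bot[OF z] tl])
qed

text \<open>
  The point \<open>\<gamma> s\<close> branches off the ray to \<open>\<zeta>\<close> at height \<open>bprod (\<gamma> s) \<zeta>\<close>. For large \<open>t\<close>, the distance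
  of \<open>\<gamma> s\<close> and \<open>\<gamma> t\<close> is thus \<open>hgt (\<gamma> s) + hgt (\<gamma> t) - 2 * bprod (\<gamma> s) \<zeta>\<close>, and it is also \<open>t - s\<close>. With
  \<open>s = 0\<close> this says that \<open>hgt (\<gamma> t) - t\<close> is eventually constant, and then with large \<open>s\<close> that
  \<open>hgt (\<gamma> s) = bprod (\<gamma> s) \<zeta>\<close>.
\<close>

lemma geodesic_to_ray:
  assumes z: "\<zeta> \<in> B" and g: "geodesic_to T \<epsilon> \<gamma> \<zeta>"
  shows "\<exists>c. \<forall>\<^sub>F t in at_top. \<gamma> t \<in> P \<and> fst (\<gamma> t) = \<zeta> (lev (fst (\<gamma> t))) \<and> hgt (\<gamma> t) = t + c"
proof -
  have gP: "\<gamma> t \<in> P" if "0 \<le> t" for t using g that by (simp add: geodesic_to_def)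
  have gd: "len_dist T (\<gamma> s) (\<gamma> t) = \<bar>s - t\<bar>" if "0 \<le> s" "0 \<le> t" for s t
    using g that by (simp add: geodesic_to_def)
  define m where "m t = bprod (\<gamma> t) \<zeta>" for t
  have m_large: "\<forall>\<^sub>F t in at_top. R < m t" for R
  proof -
    have "\<forall>\<^sub>F t in at_top. dist_to_boundary T \<epsilon> (\<gamma> t) \<zeta> < exp (- \<epsilon> * R) / \<epsilon>"
      using g eps by (intro order_tendstoD(2)[of _ 0]) (auto simp: geodesic_to_def)
    moreover have "\<forall>\<^sub>F t in at_top. (0::real) \<le> t" by (rule eventually_ge_at_top)
    ultimately show ?thesis
      by eventually_elim (simp add: m_def bprod_gt_if_dist_less[OF z] gP)
  qed
  have key: "\<bar>s - t\<bar> = hgt (\<gamma> s) + hgt (\<gamma> t) - 2 * m s"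
    if st: "0 \<le> s" "0 \<le> t" "hgt (\<gamma> s) < m t" for s t
  proof -
    let ?x = "\<gamma> s" and ?y = "\<gamma> t"
    note P = gP[OF st(1)] gP[OF st(2)]
    obtain M where M: "lev (fst ?x) \<le> M" "lev (fst ?y) \<le> M" by (meson max.cobounded1 max.cobounded2)
    let ?w = "vertex_point (\<zeta> M)"
    note w = boundary_vertex(1)[OF z, of M]
    have b: "gprod ?x ?w = m s" "gprod ?y ?w = m t"
      using gprod_boundary[OF z] P M by (auto simp: m_def)
    have "gprod ?x ?y = m s"
      using gprod_ultra[OF P(1) w P(2)] gprod_ultra[OF P w] gprod_le[of ?x ?y] bprod_le[of ?x \<zeta>]
        gprod_commute[OF w P(2)] b st(3) unfolding m_def by linarith
    then show ?thesis using gd[OF st(1,2)] len_dist_eq[OF P] by simp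
  qed
  define c where "c = 2 * m 0 - hgt (\<gamma> 0)"
  have h: "hgt (\<gamma> t) = t + c" if "0 \<le> t" "hgt (\<gamma> 0) < m t" for t
    using key[of 0 t] that by (simp add: c_def)
  have "\<forall>\<^sub>F s in at_top. 0 \<le> s \<and> hgt (\<gamma> 0) < m s"
    using m_large[of "hgt (\<gamma> 0)"] eventually_ge_at_top[of "0 :: real"] by eventually_elim simp
  then have "\<forall>\<^sub>F s in at_top. \<gamma> s \<in> P \<and> fst (\<gamma> s) = \<zeta> (lev (fst (\<gamma> s))) \<and> hgt (\<gamma> s) = s + c"
  proof eventually_elim
    case (elim s)
    have "\<forall>\<^sub>F t in at_top. hgt (\<gamma> s) < m t \<and> hgt (\<gamma> 0) < m t \<and> s \<le> t"
      using m_large[of "hgt (\<gamma> s)"] m_large[of "hgt (\<gamma> 0)"] eventually_ge_at_top[of s]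
      by eventually_elim simp
    then obtain t where t: "hgt (\<gamma> s) < m t" "hgt (\<gamma> 0) < m t" "s \<le> t"
      by (auto simp: eventually_at_top_linorder)
    then have "t - s = hgt (\<gamma> s) + hgt (\<gamma> t) - 2 * m s" using key[of s t] elim by simp
    then have ms: "m s = hgt (\<gamma> s)" using h[of s] h[of t] elim t by simp
    note P = gP[of s]
    note p = pointsD[OF P]
    let ?v = "fst (\<gamma> s)"
    have "real (lev ?v) < real (meet_lev ?v (\<zeta> (lev ?v))) + 1"
      using ms p elim unfolding m_def bprod_def hgt_def by linarith
    then have "lev ?v \<le> meet_lev ?v (\<zeta> (lev ?v))" by linarith
    then have "anc ?v (lev ?v) = anc (\<zeta> (lev ?v)) (lev ?v)"
      using le_meet_lev_iff p elim boundary_in[OF z] by blast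
    then have "?v = \<zeta> (lev ?v)" using boundary_anc[OF z, of "lev ?v" "lev ?v"] by simp
    then show ?case using P h[of s] elim by simp
  qed
  then show ?thesis by blast
qed

lemma interp_geodesic_limit:
  assumes z: "\<zeta> \<in> B" and lim: "(\<lambda>n. U (\<zeta> n)) \<longlonglongrightarrow> l" and g: "geodesic_to T \<epsilon> \<gamma> \<zeta>"
  shows "((\<lambda>t. interp U (\<gamma> t)) \<longlongrightarrow> l) at_top"
  unfolding tendsto_iff
proof (intro allI impI)
  fix e :: real assume "0 < e"
  then obtain R where R: "\<And>x. x \<in> P \<Longrightarrow> fst x = \<zeta> (lev (fst x)) \<Longrightarrow> R < hgt x \<Longrightarrow> \<bar>interp U x - l\<bar> < e"
    using interp_near_boundary[OF z lim] by blast
  obtain c where c: "\<forall>\<^sub>F t in at_top. \<gamma> t \<in> P \<and> fst (\<gamma> t) = \<zeta> (lev (fst (\<gamma> t))) \<and> hgt (\<gamma> t) = t + c"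
    using geodesic_to_ray[OF z g] by blast
  show "\<forall>\<^sub>F t in at_top. dist (interp U (\<gamma> t)) l < e"
    using c eventually_gt_at_top[of "R - c"]
    by eventually_elim (simp add: dist_real_def R)
qed

end

section \<open>Oscillation on cylinders and the Besov seminorm\<close>

lemma enn_powr_mono: "0 < a \<Longrightarrow> x \<le> y \<Longrightarrow> enn_powr x a \<le> enn_powr y a"
  by (cases x; cases y) (auto simp: enn_powr_ennreal enn_powr_def top_unique ennreal_le_iff intro!: ennreal_leI powr_mono2)

lemma enn_powr_top: "enn_powr top a = top"
  by (simp add: enn_powr_def)

lemma enn_powr_mult:
  assumes "0 < a"
  shows "enn_powr (x * y) a = enn_powr x a * enn_powr y a"
proof -
  have *: "enn_powr (ennreal r * top) a = enn_powr (ennreal r) a * top" if "0 \<le> r" for r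
  proof (cases "r = 0")
    case False
    then have "ennreal r \<noteq> 0" "ennreal (r powr a) \<noteq> 0" using that by auto
    then show ?thesis using that by (simp add: ennreal_mult_top enn_powr_top enn_powr_ennreal)
  qed simp
  show ?thesis
  proof (cases x)
    case (real r)
    show ?thesis
    proof (cases y)
      case (real s)
      then show ?thesis using \<open>x = ennreal r\<close> \<open>0 \<le> r\<close>
        by (simp add: enn_powr_ennreal powr_mult flip: ennreal_mult)
    qed (use real * in \<open>simp add: enn_powr_top\<close>)
  next
    case top
    then show ?thesis using * by (cases y) (simp_all add: enn_powr_top mult.commute)
  qed
qed

lemma enn_powr_inverse: "0 < a \<Longrightarrow> enn_powr (enn_powr x a) (1 / a) = x" "0 < a \<Longrightarrow> enn_powr (enn_powr x (1 / a)) a = x"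
  by (cases x; simp add: enn_powr_ennreal enn_powr_top powr_powr)+

lemma enn_powr_measurable [measurable (raw)]:
  assumes [measurable]: "f \<in> borel_measurable M"
  shows "(\<lambda>x. enn_powr (f x) a) \<in> borel_measurable M"
  unfolding enn_powr_def by measurable

lemma ennreal_le_mult_power:
  fixes x y :: ennreal
  assumes "0 < r" "x * ennreal ((1 / r) ^ n) \<le> y"
  shows "x \<le> ennreal (r ^ n) * y"
proof -
  have "ennreal (r ^ n) * ennreal ((1 / r) ^ n) = 1"
    using assms(1) by (simp add: power_one_over flip: ennreal_mult)
  then have "x = ennreal (r ^ n) * (x * ennreal ((1 / r) ^ n))" by (simp add: mult_ac)
  also have "\<dots> \<le> ennreal (r ^ n) * y" using assms(2) by (intro mult_left_mono) auto
  finally show ?thesis .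
qed

lemma abs_convex_powr_le:
  fixes a b s p :: real
  assumes "0 \<le> s" "s \<le> 1" "0 \<le> p"
  shows "\<bar>(1 - s) * a + s * b\<bar> powr p \<le> \<bar>a\<bar> powr p + \<bar>b\<bar> powr p"
proof -
  let ?m = "max \<bar>a\<bar> \<bar>b\<bar>"
  have "\<bar>(1 - s) * a + s * b\<bar> \<le> (1 - s) * \<bar>a\<bar> + s * \<bar>b\<bar>"
    using assms by (intro order_trans[OF abs_triangle_ineq]) (simp add: abs_mult)
  also have "\<dots> \<le> (1 - s) * ?m + s * ?m"
    using assms by (intro add_mono mult_left_mono) auto
  also have "\<dots> = ?m" by (simp add: algebra_simps)
  finally have "\<bar>(1 - s) * a + s * b\<bar> powr p \<le> ?m powr p" using assms by (intro powr_mono2) auto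
  also have "\<dots> \<le> \<bar>a\<bar> powr p + \<bar>b\<bar> powr p" by (simp add: max_def)
  finally show ?thesis .
qed

context kary_tree
begin

definition osc :: "real \<Rightarrow> ((nat \<Rightarrow> 'v) \<Rightarrow> real) \<Rightarrow> nat \<Rightarrow> (nat \<Rightarrow> 'v) \<Rightarrow> ennreal" where
  "osc p u n \<zeta> = (\<integral>\<^sup>+\<xi>\<in>cyl (\<zeta> n). ennreal (\<bar>u \<zeta> - u \<xi>\<bar> powr p) \<partial>N) / emeasure N (cyl (\<zeta> n))"

definition mean_osc :: "real \<Rightarrow> ((nat \<Rightarrow> 'v) \<Rightarrow> real) \<Rightarrow> nat \<Rightarrow> ennreal" where
  "mean_osc p u n = (\<integral>\<^sup>+\<zeta>. osc p u n \<zeta> \<partial>N)"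

definition besov_series :: "real \<Rightarrow> real \<Rightarrow> ((nat \<Rightarrow> 'v) \<Rightarrow> real) \<Rightarrow> ennreal" where
  "besov_series p \<theta> u = (\<Sum>n. ennreal (exp (\<epsilon> * \<theta> * p * real n)) * mean_osc p u n)"

lemma besov_E_eq:
  assumes t: "rad n < t" "t \<le> rad n * exp \<epsilon>"
  shows "besov_E K T \<epsilon> p u t = enn_powr (mean_osc p u n) (1 / p)"
proof -
  have "boundary_ball T \<epsilon> \<zeta> t = cyl (\<zeta> n)" if "\<zeta> \<in> B" for \<zeta>
    unfolding boundary_ball_def
  proof (rule mball_eq_cyl[OF that t(1)])
    have "rad n * exp \<epsilon> = rad (n - 1)" if "n \<noteq> 0"
      using that by (cases n) (simp_all add: rad_def mult_exp_exp algebra_simps)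
    then show "n = 0 \<or> t \<le> rad (n - 1)" using t by (cases "n = 0") fastforce+
  qed
  then show ?thesis unfolding besov_E_def mean_osc_def osc_def
    by (intro arg_cong2[where f = enn_powr] nn_integral_cong refl) simp
qed

text \<open>
  On the interval from \<open>rad n\<close> to \<open>rad n * exp \<epsilon>\<close> the balls of radius \<open>t\<close> are the cylinders of
  level \<open>n\<close>, so the integral defining the seminorm dominates a series.
\<close>

lemma besov_series_le:
  assumes p: "1 \<le> p" and \<theta>: "0 < \<theta>"
  shows "\<exists>\<kappa>>0. \<forall>u. ennreal \<kappa> * besov_series p \<theta> u \<le>
    (\<integral>\<^sup>+t\<in>{0<..}. enn_powr (besov_E K T \<epsilon> p u t / ennreal (t powr \<theta>)) p / ennreal t \<partial>lborel)"
proof -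
  \<comment> \<open>The length of the interval times the smallest value of \<open>t powr (- \<theta> * p - 1)\<close> on it, without
    the factor that depends on \<open>n\<close>.\<close>
  define \<kappa> where "\<kappa> = rad 0 powr (- \<theta> * p) * exp (- \<epsilon> * (\<theta> * p + 1)) * (exp \<epsilon> - 1)"
  have "0 < \<kappa>" unfolding \<kappa>_def using eps rad_pos[of 0] by (intro mult_pos_pos) (simp_all del: rad_pos)
  moreover have "ennreal \<kappa> * besov_series p \<theta> u \<le>
    (\<integral>\<^sup>+t\<in>{0<..}. enn_powr (besov_E K T \<epsilon> p u t / ennreal (t powr \<theta>)) p / ennreal t \<partial>lborel)" for u
  proof -
    define G where "G t = enn_powr (besov_E K T \<epsilon> p u t / ennreal (t powr \<theta>)) p / ennreal t" for t
    define I where "I n = {rad n<..rad n * exp \<epsilon>}" for n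
    define c where "c n = ennreal ((rad n * exp \<epsilon>) powr (- \<theta> * p - 1)) * mean_osc p u n" for n
    have G: "c n \<le> G t" if t: "t \<in> I n" for n t
    proof -
      have tp: "rad n < t" "t \<le> rad n * exp \<epsilon>" "0 < t" using t rad_pos[of n] by (auto simp: I_def simp del: rad_pos)
      have inv: "x / ennreal y = x * ennreal (1 / y)" if "0 < y" for x y
        using that by (simp add: divide_ennreal_def inverse_ennreal inverse_eq_divide)
      have "G t = enn_powr (enn_powr (mean_osc p u n) (1 / p)) p * enn_powr (ennreal (1 / t powr \<theta>)) p * ennreal (1 / t)"
        unfolding G_def besov_E_eq[OF tp(1,2)] using tp p by (simp add: inv enn_powr_mult)
      also have "enn_powr (ennreal (1 / t powr \<theta>)) p = ennreal (t powr (- \<theta> * p))"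
        using tp by (simp add: enn_powr_ennreal powr_minus_divide[symmetric] powr_powr)
      also have "enn_powr (enn_powr (mean_osc p u n) (1 / p)) p = mean_osc p u n"
        using p by (intro enn_powr_inverse) simp
      also have "mean_osc p u n * ennreal (t powr (- \<theta> * p)) * ennreal (1 / t) =
          ennreal (t powr (- \<theta> * p) * (1 / t)) * mean_osc p u n"
      proof -
        have "ennreal (t powr (- \<theta> * p) * (1 / t)) = ennreal (t powr (- \<theta> * p)) * ennreal (1 / t)"
          using tp by (intro ennreal_mult) auto
        then show ?thesis by (simp only: mult_ac)
      qed
      also have "t powr (- \<theta> * p) * (1 / t) = t powr (- \<theta> * p - 1)"
        using tp by (simp add: powr_diff)
      finally have Gt: "G t = ennreal (t powr (- \<theta> * p - 1)) * mean_osc p u n" .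
      have "(rad n * exp \<epsilon>) powr (- \<theta> * p - 1) \<le> t powr (- \<theta> * p - 1)"
      proof (rule powr_mono2')
        show "- \<theta> * p - 1 \<le> 0" using p \<theta> by (simp add: order_trans[of "-1" 0])
      qed (use tp in auto)
      then show ?thesis unfolding Gt c_def by (intro mult_right_mono ennreal_leI) auto
    qed
    have disj: "m = n" if "t \<in> I m" "t \<in> I n" for m n t
    proof (rule ccontr)
      assume "m \<noteq> n"
      have *: False if "m < n" "t \<in> I m" "t \<in> I n" for m n
      proof -
        have "rad n * exp \<epsilon> = rad (n - 1)"
          using that(1) by (cases n) (simp_all add: rad_def mult_exp_exp algebra_simps)
        also have "\<dots> \<le> rad m" using that(1) by simp
        finally show False using that by (auto simp: I_def)
      qed
      then show False using that \<open>m \<noteq> n\<close> by (metis linorder_neqE_nat)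
    qed
    have summand: "ennreal \<kappa> * (ennreal (exp (\<epsilon> * \<theta> * p * real n)) * mean_osc p u n) = c n * emeasure lborel (I n)" for n
    proof -
      have e: "rad n = rad 0 * exp (- \<epsilon> * real n)" by (simp add: rad_def)
      have 1: "1 \<le> exp \<epsilon>" using eps by simp
      have em: "emeasure lborel (I n) = ennreal (rad n * (exp \<epsilon> - 1))"
        using 1 mult_left_mono[OF 1, of "rad n"] by (simp add: I_def algebra_simps)
      have "(rad n * exp \<epsilon>) powr (- \<theta> * p - 1) * (rad n * (exp \<epsilon> - 1)) = \<kappa> * exp (\<epsilon> * \<theta> * p * real n)"
      proof -
        have "(rad n * exp \<epsilon>) powr (- \<theta> * p - 1) = (rad n * exp \<epsilon>) powr (- \<theta> * p) / (rad n * exp \<epsilon>)"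
          using rad_pos[of n] by (simp add: powr_diff del: rad_pos)
        then have "(rad n * exp \<epsilon>) powr (- \<theta> * p - 1) * (rad n * (exp \<epsilon> - 1))
            = (rad n * exp \<epsilon>) powr (- \<theta> * p) * exp (- \<epsilon>) * (exp \<epsilon> - 1)"
          using rad_pos[of n] by (simp add: exp_minus field_simps del: rad_pos)
        also have "(rad n * exp \<epsilon>) powr (- \<theta> * p) =
            rad 0 powr (- \<theta> * p) * (exp (- \<epsilon> * real n) powr (- \<theta> * p) * exp \<epsilon> powr (- \<theta> * p))"
          unfolding e using rad_pos[of 0] by (simp add: powr_mult mult.assoc del: rad_pos)
        also have "exp (- \<epsilon> * real n) powr (- \<theta> * p) = exp (\<epsilon> * \<theta> * p * real n)"
          by (simp add: exp_powr_real mult_ac)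
        also have "exp \<epsilon> powr (- \<theta> * p) = exp (- \<epsilon> * (\<theta> * p))"
          by (simp add: exp_powr_real)
        finally have eq: "(rad n * exp \<epsilon>) powr (- \<theta> * p - 1) * (rad n * (exp \<epsilon> - 1)) =
          rad 0 powr (- \<theta> * p) * (exp (\<epsilon> * \<theta> * p * real n) * exp (- \<epsilon> * (\<theta> * p))) * exp (- \<epsilon>) * (exp \<epsilon> - 1)" .
        have "exp (- \<epsilon> * (\<theta> * p + 1)) = exp (- \<epsilon> * (\<theta> * p)) * exp (- \<epsilon>)"
          by (simp add: mult_exp_exp algebra_simps)
        then show ?thesis unfolding eq \<kappa>_def by (simp only: mult_ac)
      qed
      then have "ennreal ((rad n * exp \<epsilon>) powr (- \<theta> * p - 1)) * ennreal (rad n * (exp \<epsilon> - 1))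
          = ennreal \<kappa> * ennreal (exp (\<epsilon> * \<theta> * p * real n))"
        using 1 \<open>0 < \<kappa>\<close> by (simp flip: ennreal_mult)
      then show ?thesis unfolding em c_def by (simp add: mult_ac)
    qed
    have "ennreal \<kappa> * besov_series p \<theta> u = (\<Sum>n. c n * emeasure lborel (I n))"
      unfolding besov_series_def ennreal_suminf_cmult[symmetric] by (intro suminf_cong summand)
    also have "\<dots> = (\<Sum>n. \<integral>\<^sup>+t. c n * indicator (I n) t \<partial>lborel)"
      by (intro suminf_cong nn_integral_cmult_indicator[symmetric]) (simp add: I_def)
    also have "\<dots> = (\<integral>\<^sup>+t. (\<Sum>n. c n * indicator (I n) t) \<partial>lborel)"
      by (rule nn_integral_suminf[symmetric]) (simp add: I_def)
    also have "\<dots> \<le> (\<integral>\<^sup>+t\<in>{0<..}. G t \<partial>lborel)"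
    proof (rule nn_integral_mono)
      fix t :: real
      show "(\<Sum>n. c n * indicator (I n) t) \<le> G t * indicator {0<..} t"
      proof (cases "\<exists>n. t \<in> I n")
        case True
        then obtain n where n: "t \<in> I n" by blast
        then have "(\<Sum>m. c m * indicator (I m) t) = (\<Sum>m\<in>{n}. c m * indicator (I m) t)"
          using disj[of t] by (intro suminf_finite) (auto split: split_indicator)
        moreover have "0 < t" using n rad_pos[of n] by (auto simp: I_def simp del: rad_pos)
        ultimately show ?thesis using G[OF n] n by simp
      qed simp
    qed
    finally show ?thesis by (simp add: G_def)
  qed
  ultimately show ?thesis by blast
qed

section \<open>Cylinder averages\<close>

definition avg :: "((nat \<Rightarrow> 'v) \<Rightarrow> real) \<Rightarrow> 'v \<Rightarrow> real" where
  "avg u v = (LINT \<zeta>:cyl v|N. u \<zeta>) / measure N (cyl v)"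

lemma measure_cyl: "v \<in> level n \<Longrightarrow> measure N (cyl v) = (1 / real K) ^ n"
  using emeasure_cyl[of v n] K_pos by (simp add: measure_def)

lemma measure_cyl_pos: "v \<in> level n \<Longrightarrow> 0 < measure N (cyl v)"
  using measure_cyl[of v n] K_pos by simp

lemma integrable_if_Lp:
  assumes [measurable]: "u \<in> borel_measurable N" and fin: "(\<integral>\<^sup>+\<zeta>. ennreal (\<bar>u \<zeta>\<bar> powr p) \<partial>N) < \<infinity>" and p: "1 \<le> p"
  shows "set_integrable N (cyl v) u"
proof -
  have "integrable N u"
    unfolding integrable_iff_bounded
  proof
    have "(\<integral>\<^sup>+\<zeta>. ennreal (norm (u \<zeta>)) \<partial>N) \<le> (\<integral>\<^sup>+\<zeta>. 1 + ennreal (\<bar>u \<zeta>\<bar> powr p) \<partial>N)"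
    proof (rule nn_integral_mono)
      fix \<zeta>
      have "\<bar>u \<zeta>\<bar> \<le> 1 + \<bar>u \<zeta>\<bar> powr p"
        using p powr_mono[of 1 p "\<bar>u \<zeta>\<bar>"] by (cases "\<bar>u \<zeta>\<bar> \<le> 1") (auto simp: add_increasing2)
      then have "ennreal (norm (u \<zeta>)) \<le> ennreal (1 + \<bar>u \<zeta>\<bar> powr p)" by (intro ennreal_leI) simp
      then show "ennreal (norm (u \<zeta>)) \<le> 1 + ennreal (\<bar>u \<zeta>\<bar> powr p)" by (simp add: ennreal_plus)
    qed
    also have "\<dots> = 1 + (\<integral>\<^sup>+\<zeta>. ennreal (\<bar>u \<zeta>\<bar> powr p) \<partial>N)"
      by (subst nn_integral_add) (auto simp: emeasure_N)
    also have "\<dots> < \<infinity>" using fin by simp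
    finally show "(\<integral>\<^sup>+\<zeta>. ennreal (norm (u \<zeta>)) \<partial>N) < \<infinity>" .
  qed simp
  then show ?thesis
    unfolding set_integrable_def by (intro integrable_mult_indicator) auto
qed

lemma avg_linear:
  assumes "set_integrable N (cyl v) u" "set_integrable N (cyl v) w"
  shows "avg (\<lambda>\<zeta>. a * u \<zeta> + b * w \<zeta>) v = a * avg u v + b * avg w v"
  using assms by (simp add: avg_def set_integral_add set_integrable_mult_right add_divide_distrib)

lemma sum_cyl_integrals:
  assumes [measurable]: "f \<in> borel_measurable N"
  shows "(\<Sum>v\<in>level n. \<integral>\<^sup>+\<zeta>\<in>cyl v. f \<zeta> \<partial>N) = (\<integral>\<^sup>+\<zeta>. f \<zeta> \<partial>N)"
proof -
  have "(\<Sum>v\<in>level n. \<integral>\<^sup>+\<zeta>\<in>cyl v. f \<zeta> \<partial>N) = (\<integral>\<^sup>+\<zeta>. (\<Sum>v\<in>level n. f \<zeta> * indicator (cyl v) \<zeta>) \<partial>N)"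
    by (rule nn_integral_sum[symmetric]) measurable
  also have "\<dots> = (\<integral>\<^sup>+\<zeta>. f \<zeta> \<partial>N)"
  proof (rule nn_integral_cong)
    fix \<zeta> assume "\<zeta> \<in> space N"
    then have z: "\<zeta> \<in> B" by simp
    have "(\<Sum>v\<in>level n. f \<zeta> * indicator (cyl v) \<zeta>) = (\<Sum>v\<in>level n. if v = \<zeta> n then f \<zeta> else 0)"
      using z by (intro sum.cong refl) (auto simp: cyl_level split: split_indicator)
    then show "(\<Sum>v\<in>level n. f \<zeta> * indicator (cyl v) \<zeta>) = f \<zeta>"
      using boundary_level[OF z] by simp
  qed
  finally show ?thesis .
qed

lemma osc_measurable:
  assumes [measurable]: "u \<in> borel_measurable N"
  shows "osc p u n \<in> borel_measurable N"
proof -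
  let ?f = "\<lambda>v \<zeta>. (\<integral>\<^sup>+\<xi>. ennreal (\<bar>u \<zeta> - u \<xi>\<bar> powr p) * indicator (cyl v) \<xi> \<partial>N) / emeasure N (cyl v)"
  have "(\<lambda>\<zeta>. \<Sum>v\<in>level n. ?f v \<zeta> * indicator (cyl v) \<zeta>) \<in> borel_measurable N" by measurable
  moreover have "osc p u n \<zeta> = (\<Sum>v\<in>level n. ?f v \<zeta> * indicator (cyl v) \<zeta>)" if "\<zeta> \<in> space N" for \<zeta>
  proof -
    have z: "\<zeta> \<in> B" using that by simp
    have "(\<Sum>v\<in>level n. ?f v \<zeta> * indicator (cyl v) \<zeta>) = (\<Sum>v\<in>level n. if v = \<zeta> n then ?f v \<zeta> else 0)"
      using z by (intro sum.cong refl) (auto simp: cyl_level split: split_indicator)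
    then show ?thesis using boundary_level[OF z] by (simp add: osc_def)
  qed
  ultimately show ?thesis by (subst measurable_cong) auto
qed

text \<open>
  Jensen's inequality on the cylinder of \<open>\<zeta> n\<close>.
\<close>

lemma avg_osc:
  assumes u: "u \<in> borel_measurable N" "set_integrable N (cyl (\<zeta> n)) u" and p: "1 \<le> p" and z: "\<zeta> \<in> B"
  shows "ennreal (\<bar>avg u (\<zeta> n) - u \<zeta>\<bar> powr p) \<le> osc p u n \<zeta>"
proof -
  note l = boundary_level[OF z, of n]
  have "ennreal (\<bar>avg u (\<zeta> n) - u \<zeta>\<bar> powr p) * emeasure N (cyl (\<zeta> n))
      \<le> (\<integral>\<^sup>+\<xi>\<in>cyl (\<zeta> n). ennreal (\<bar>u \<xi> - u \<zeta>\<bar> powr p) \<partial>N)"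
    unfolding avg_def
    by (rule powr_mean_le[OF N.finite_measure_axioms cyl_in_N measure_cyl_pos[OF l] u(2,1) p])
  then have "ennreal (\<bar>avg u (\<zeta> n) - u \<zeta>\<bar> powr p) * emeasure N (cyl (\<zeta> n)) / emeasure N (cyl (\<zeta> n)) \<le> osc p u n \<zeta>"
    unfolding osc_def by (intro divide_right_mono_ennreal) (simp add: abs_minus_commute)
  moreover have "emeasure N (cyl (\<zeta> n)) \<noteq> 0" "emeasure N (cyl (\<zeta> n)) \<noteq> top"
    using emeasure_cyl[OF l] K_pos by auto
  ultimately show ?thesis by (simp add: ennreal_mult_divide_eq)
qed

lemma sum_avg_powr:
  assumes u: "u \<in> borel_measurable N" "\<And>v. set_integrable N (cyl v) u" and p: "1 \<le> p"
  shows "(\<Sum>v\<in>level n. ennreal (\<bar>avg u v\<bar> powr p)) \<le> ennreal (real K ^ n) * (\<integral>\<^sup>+\<zeta>. ennreal (\<bar>u \<zeta>\<bar> powr p) \<partial>N)"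
proof -
  note [measurable] = u(1)
  have "ennreal (\<bar>avg u v\<bar> powr p) \<le> ennreal (real K ^ n) * (\<integral>\<^sup>+\<zeta>\<in>cyl v. ennreal (\<bar>u \<zeta>\<bar> powr p) \<partial>N)"
    if v: "v \<in> level n" for v
    using powr_mean_le[OF N.finite_measure_axioms cyl_in_N measure_cyl_pos[OF v] u(2,1) p, of 0] K_pos
    by (intro ennreal_le_mult_power) (simp_all add: avg_def emeasure_cyl[OF v])
  then have "(\<Sum>v\<in>level n. ennreal (\<bar>avg u v\<bar> powr p)) \<le>
      (\<Sum>v\<in>level n. ennreal (real K ^ n) * (\<integral>\<^sup>+\<zeta>\<in>cyl v. ennreal (\<bar>u \<zeta>\<bar> powr p) \<partial>N))" by (rule sum_mono)
  also have "\<dots> = ennreal (real K ^ n) * (\<integral>\<^sup>+\<zeta>. ennreal (\<bar>u \<zeta>\<bar> powr p) \<partial>N)"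
    unfolding sum_distrib_left[symmetric] by (subst sum_cyl_integrals) auto
  finally show ?thesis .
qed

text \<open>
  Jensen's inequality is applied twice: on the cylinder of \<open>v\<close>, to compare \<open>avg u v\<close> with \<open>avg u (par v)\<close>, and on
  the cylinder of the parent, to compare \<open>avg u (par v)\<close> with the values of \<open>u\<close>.
\<close>

lemma sum_incr_powr:
  assumes u: "u \<in> borel_measurable N" "\<And>v. set_integrable N (cyl v) u" and p: "1 \<le> p"
  shows "(\<Sum>v\<in>level (Suc n). ennreal (\<bar>incr (avg u) v\<bar> powr p)) \<le> ennreal (real K ^ Suc n) * mean_osc p u n"
proof -
  have "ennreal (\<bar>incr (avg u) v\<bar> powr p) \<le> ennreal (real K ^ Suc n) * (\<integral>\<^sup>+\<zeta>\<in>cyl v. osc p u n \<zeta> \<partial>N)"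
    if v: "v \<in> level (Suc n)" for v
  proof (rule ennreal_le_mult_power)
    have "ennreal (\<bar>incr (avg u) v\<bar> powr p) * ennreal ((1 / real K) ^ Suc n)
        \<le> (\<integral>\<^sup>+\<zeta>\<in>cyl v. ennreal (\<bar>u \<zeta> - avg u (par v)\<bar> powr p) \<partial>N)"
      using powr_mean_le[OF N.finite_measure_axioms cyl_in_N measure_cyl_pos[OF v] u(2,1) p, of "avg u (par v)"]
      by (simp add: incr_def avg_def emeasure_cyl[OF v])
    also have "\<dots> \<le> (\<integral>\<^sup>+\<zeta>\<in>cyl v. osc p u n \<zeta> \<partial>N)"
    proof (rule nn_integral_mono)
      fix \<zeta>
      show "ennreal (\<bar>u \<zeta> - avg u (par v)\<bar> powr p) * indicator (cyl v) \<zeta> \<le> osc p u n \<zeta> * indicator (cyl v) \<zeta>"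
      proof (cases "\<zeta> \<in> cyl v")
        case True
        then have z: "\<zeta> \<in> B" "\<zeta> (Suc n) = v" using cyl_level[OF v] by auto
        then have "\<zeta> n = par v" using boundary_iff[of \<zeta>] by metis
        then show ?thesis using avg_osc[OF u(1) u(2) p z(1), of n] True by (simp add: abs_minus_commute)
      qed simp
    qed
    finally show "ennreal (\<bar>incr (avg u) v\<bar> powr p) * ennreal ((1 / real K) ^ Suc n)
        \<le> (\<integral>\<^sup>+\<zeta>\<in>cyl v. osc p u n \<zeta> \<partial>N)" .
  qed (rule K_pos)
  then have "(\<Sum>v\<in>level (Suc n). ennreal (\<bar>incr (avg u) v\<bar> powr p)) \<le>
      (\<Sum>v\<in>level (Suc n). ennreal (real K ^ Suc n) * (\<integral>\<^sup>+\<zeta>\<in>cyl v. osc p u n \<zeta> \<partial>N))" by (rule sum_mono)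
  also have "\<dots> = ennreal (real K ^ Suc n) * mean_osc p u n"
    unfolding sum_distrib_left[symmetric] mean_osc_def by (subst sum_cyl_integrals) (auto intro: osc_measurable u)
  finally show ?thesis .
qed

text \<open>
  The oscillations are summable in mean, hence almost everywhere, and so they tend to \<open>0\<close>.
\<close>

lemma avg_tendsto_AE:
  assumes u: "u \<in> borel_measurable N" "\<And>v. set_integrable N (cyl v) u" and p: "1 \<le> p" and \<theta>: "0 < \<theta>"
    and fin: "besov_series p \<theta> u < \<infinity>"
  shows "AE \<zeta> in N. (\<lambda>n. avg u (\<zeta> n)) \<longlonglongrightarrow> u \<zeta>"
proof -
  note [measurable] = osc_measurable[OF u(1)]
  have "(\<integral>\<^sup>+\<zeta>. (\<Sum>n. osc p u n \<zeta>) \<partial>N) = (\<Sum>n. mean_osc p u n)"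
    unfolding mean_osc_def by (rule nn_integral_suminf) measurable
  also have "\<dots> \<le> besov_series p \<theta> u"
    unfolding besov_series_def
  proof (rule suminf_le)
    fix n
    have "1 \<le> ennreal (exp (\<epsilon> * \<theta> * p * real n))" using eps p \<theta> by simp
    then show "mean_osc p u n \<le> ennreal (exp (\<epsilon> * \<theta> * p * real n)) * mean_osc p u n"
      using mult_right_mono[of 1 _ "mean_osc p u n"] by simp
  qed auto
  finally have "(\<integral>\<^sup>+\<zeta>. (\<Sum>n. osc p u n \<zeta>) \<partial>N) \<noteq> \<infinity>" using fin by auto
  then have "AE \<zeta> in N. (\<Sum>n. osc p u n \<zeta>) \<noteq> \<infinity>" by (intro nn_integral_PInf_AE) measurable
  with AE_space show ?thesis
  proof eventually_elim
    case (elim \<zeta>)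
    then have z: "\<zeta> \<in> B" by simp
    let ?r = "\<lambda>n. \<bar>avg u (\<zeta> n) - u \<zeta>\<bar> powr p"
    have "(\<Sum>n. ennreal (?r n)) \<le> (\<Sum>n. osc p u n \<zeta>)"
      using avg_osc[OF u(1) u(2) p z] by (intro suminf_le) auto
    then have "(\<Sum>n. ennreal (?r n)) \<noteq> top" using elim by (auto simp: top_unique)
    then have "summable ?r" by (intro summable_suminf_not_top) auto
    then have "?r \<longlonglongrightarrow> 0" by (rule summable_LIMSEQ_zero)
    then have "(\<lambda>n. ?r n powr (1 / p)) \<longlonglongrightarrow> 0 powr (1 / p)"
      using p by (intro tendsto_powr' tendsto_const) auto
    moreover have "?r n powr (1 / p) = \<bar>avg u (\<zeta> n) - u \<zeta>\<bar>" for n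
      using p by (simp add: powr_powr)
    ultimately have "(\<lambda>n. \<bar>avg u (\<zeta> n) - u \<zeta>\<bar>) \<longlonglongrightarrow> 0" by simp
    then have "(\<lambda>n. avg u (\<zeta> n) - u \<zeta>) \<longlonglongrightarrow> 0" by (rule tendsto_rabs_zero_cancel)
    then show ?case by (rule LIM_zero_cancel)
  qed
qed

section \<open>Norm estimates\<close>

text \<open>
  An edge that ends at level \<open>n + 1\<close> contributes the \<open>p\<close>-th power of its increment times at most
  \<open>e\<^sup>\<epsilon>\<^sup>p\<close> times \<open>e\<close> to the power \<open>(\<epsilon>p - \<beta>)n\<close>, and the increments of the whole level contribute \<open>K\<close> to the
  power \<open>n + 1\<close> times the mean oscillation. The assumption on \<open>\<theta>\<close> compares the product with the Besov weight.
\<close>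

lemma slope_energy:
  assumes u: "u \<in> borel_measurable N" "\<And>v. set_integrable N (cyl v) u" and p: "1 \<le> p" and \<beta>: "0 \<le> \<beta>"
    and \<theta>: "p * \<epsilon> - (\<beta> - ln (real K)) \<le> p * \<epsilon> * \<theta>"
  shows "(\<integral>\<^sup>+x. enn_powr (slope (avg u) x) p \<partial>mu T \<epsilon> \<beta>) \<le> ennreal (real K * exp (\<epsilon> * p)) * besov_series p \<theta> u"
proof -
  let ?U = "avg u"
  have "(\<integral>\<^sup>+t\<in>{0<..1}. ennreal (exp (- \<beta> * (real n + t))) * enn_powr (slope ?U (v, t)) p \<partial>lborel)
      \<le> ennreal (exp (\<epsilon> * p) * exp ((\<epsilon> * p - \<beta>) * real n)) * ennreal (\<bar>incr ?U v\<bar> powr p)"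
    (is "?I \<le> ?c") if v: "v \<in> level (Suc n)" for n v
  proof -
    have "?I \<le> (\<integral>\<^sup>+t. ?c * indicator {0<..1 :: real} t \<partial>lborel)"
    proof (rule nn_integral_mono)
      fix t :: real
      show "ennreal (exp (- \<beta> * (real n + t))) * enn_powr (slope ?U (v, t)) p * indicator {0<..1} t \<le> ?c * indicator {0<..1} t"
      proof (cases "t \<in> {0<..1}")
        case True
        have hv: "hgt (v, t) = real n + t" using v by (simp add: hgt_def level_def)
        have e: "exp (- \<beta> * (real n + t)) * exp (\<epsilon> * p * (real n + t)) \<le> exp (\<epsilon> * p) * exp ((\<epsilon> * p - \<beta>) * real n)"
        proof -
          have "0 \<le> \<beta> * t" using \<beta> True by simp
          moreover have "\<epsilon> * p * t \<le> \<epsilon> * p * 1" using True eps p by (intro mult_left_mono) auto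
          ultimately have "- \<beta> * (real n + t) + \<epsilon> * p * (real n + t) \<le> \<epsilon> * p + (\<epsilon> * p - \<beta>) * real n"
            by (simp add: algebra_simps)
          then show ?thesis by (simp flip: exp_add)
        qed
        have "exp (- \<beta> * (real n + t)) * (\<bar>incr ?U v\<bar> * exp (\<epsilon> * (real n + t))) powr p
            = exp (- \<beta> * (real n + t)) * exp (\<epsilon> * p * (real n + t)) * \<bar>incr ?U v\<bar> powr p"
          by (simp add: powr_mult exp_powr_real mult_ac)
        also have "\<dots> \<le> exp (\<epsilon> * p) * exp ((\<epsilon> * p - \<beta>) * real n) * \<bar>incr ?U v\<bar> powr p"
          by (rule mult_right_mono[OF e]) simp
        finally have "ennreal (exp (- \<beta> * (real n + t)) * (\<bar>incr ?U v\<bar> * exp (\<epsilon> * (real n + t))) powr p) \<le> ?c"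
          by (subst ennreal_mult[symmetric]) (auto intro: ennreal_leI)
        moreover have "ennreal (exp (- \<beta> * (real n + t))) * enn_powr (slope ?U (v, t)) p =
            ennreal (exp (- \<beta> * (real n + t)) * (\<bar>incr ?U v\<bar> * exp (\<epsilon> * (real n + t))) powr p)"
        proof -
          have "enn_powr (slope ?U (v, t)) p = ennreal ((\<bar>incr ?U v\<bar> * exp (\<epsilon> * (real n + t))) powr p)"
            by (simp add: slope_def hv enn_powr_ennreal)
          then show ?thesis by (simp add: ennreal_mult[symmetric])
        qed
        ultimately have "ennreal (exp (- \<beta> * (real n + t))) * enn_powr (slope ?U (v, t)) p \<le> ?c" by simp
        then show ?thesis by (auto split: split_indicator)
      qed simp
    qed
    also have "\<dots> = ?c" by (subst nn_integral_cmult_indicator) auto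
    finally show ?thesis .
  qed
  then have "(\<integral>\<^sup>+x. enn_powr (slope ?U x) p \<partial>mu T \<epsilon> \<beta>) \<le>
      (\<Sum>n. \<Sum>v\<in>level (Suc n). ennreal (exp (\<epsilon> * p) * exp ((\<epsilon> * p - \<beta>) * real n)) * ennreal (\<bar>incr ?U v\<bar> powr p))"
    using slope_measurable[of ?U] by (subst nn_integral_mu) (auto intro!: suminf_le sum_mono)
  also have "\<dots> \<le> (\<Sum>n. ennreal (real K * exp (\<epsilon> * p)) * (ennreal (exp (\<epsilon> * \<theta> * p * real n)) * mean_osc p u n))"
  proof (rule suminf_le)
    fix n
    let ?e = "exp (\<epsilon> * p) * exp ((\<epsilon> * p - \<beta>) * real n)"
    have "(\<Sum>v\<in>level (Suc n). ennreal ?e * ennreal (\<bar>incr ?U v\<bar> powr p)) \<le>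
        ennreal ?e * (ennreal (real K ^ Suc n) * mean_osc p u n)"
      unfolding sum_distrib_left[symmetric] by (intro mult_left_mono sum_incr_powr u p) auto
    also have "\<dots> = ennreal (?e * real K ^ Suc n) * mean_osc p u n"
      by (simp add: ennreal_mult mult_ac)
    also have "\<dots> \<le> ennreal ((real K * exp (\<epsilon> * p)) * exp (\<epsilon> * \<theta> * p * real n)) * mean_osc p u n"
    proof (intro mult_right_mono ennreal_leI)
      have "exp ((\<epsilon> * p - \<beta>) * real n) * real K ^ n = exp ((\<epsilon> * p - \<beta>) * real n) * exp (real n * ln (real K))"
        using K_pos by (simp add: exp_of_nat_mult)
      also have "\<dots> = exp ((p * \<epsilon> - (\<beta> - ln (real K))) * real n)"
        by (simp add: mult_exp_exp algebra_simps)
      also have "\<dots> \<le> exp (p * \<epsilon> * \<theta> * real n)"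
        using \<theta> by (simp add: mult_right_mono)
      finally have "exp ((\<epsilon> * p - \<beta>) * real n) * real K ^ n \<le> exp (\<epsilon> * \<theta> * p * real n)" by (simp add: mult_ac)
      then have "(real K * exp (\<epsilon> * p)) * (exp ((\<epsilon> * p - \<beta>) * real n) * real K ^ n)
          \<le> (real K * exp (\<epsilon> * p)) * exp (\<epsilon> * \<theta> * p * real n)"
        by (intro mult_left_mono) auto
      then show "?e * real K ^ Suc n \<le> (real K * exp (\<epsilon> * p)) * exp (\<epsilon> * \<theta> * p * real n)"
        by (simp add: mult_ac)
    qed simp
    also have "\<dots> = ennreal (real K * exp (\<epsilon> * p)) * (ennreal (exp (\<epsilon> * \<theta> * p * real n)) * mean_osc p u n)"
      by (simp add: ennreal_mult mult.assoc)
    finally show "(\<Sum>v\<in>level (Suc n). ennreal ?e * ennreal (\<bar>incr ?U v\<bar> powr p)) \<le> \<dots>" .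
  qed auto
  finally show ?thesis by (simp add: besov_series_def)
qed

text \<open>
  The values on an edge lie between those at its ends. Level \<open>n\<close> has total mass comparable to
  \<open>e\<close> to the power \<open>-(\<beta> - log K)n\<close>, and averaging does not increase the \<open>L\<^sup>p\<close> norm.
\<close>

lemma interp_Lp:
  assumes u: "u \<in> borel_measurable N" "\<And>v. set_integrable N (cyl v) u" and p: "1 \<le> p" and \<beta>: "ln (real K) < \<beta>"
  shows "(\<integral>\<^sup>+x. ennreal (\<bar>interp (avg u) x\<bar> powr p) \<partial>mu T \<epsilon> \<beta>) \<le>
    ennreal (2 * real K / (1 - exp (- (\<beta> - ln (real K))))) * (\<integral>\<^sup>+\<zeta>. ennreal (\<bar>u \<zeta>\<bar> powr p) \<partial>N)"
proof -
  let ?U = "avg u" and ?J = "\<integral>\<^sup>+\<zeta>. ennreal (\<bar>u \<zeta>\<bar> powr p) \<partial>N"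
  have \<beta>0: "0 < \<beta>" using \<beta> ln_gt_zero[OF K_pos(2)] by linarith
  have "(\<integral>\<^sup>+t\<in>{0<..1}. ennreal (exp (- \<beta> * (real n + t))) * ennreal (\<bar>interp ?U (v, t)\<bar> powr p) \<partial>lborel)
      \<le> ennreal (exp (- \<beta> * real n)) * (ennreal (\<bar>?U (par v)\<bar> powr p) + ennreal (\<bar>?U v\<bar> powr p))"
    (is "?I \<le> ?c") if v: "v \<in> level (Suc n)" for n v
  proof -
    have "v \<noteq> orig" using v by (auto simp: level_def)
    have "?I \<le> (\<integral>\<^sup>+t. ?c * indicator {0<..1 :: real} t \<partial>lborel)"
    proof (rule nn_integral_mono)
      fix t :: real
      show "ennreal (exp (- \<beta> * (real n + t))) * ennreal (\<bar>interp ?U (v, t)\<bar> powr p) * indicator {0<..1} t \<le> ?c * indicator {0<..1} t"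
      proof (cases "t \<in> {0<..1}")
        case True
        have "\<bar>interp ?U (v, t)\<bar> powr p \<le> \<bar>?U (par v)\<bar> powr p + \<bar>?U v\<bar> powr p"
          using abs_convex_powr_le[of t p "?U (par v)" "?U v"] True p \<open>v \<noteq> orig\<close> by (simp add: interp_def)
        then have "ennreal (\<bar>interp ?U (v, t)\<bar> powr p) \<le> ennreal (\<bar>?U (par v)\<bar> powr p) + ennreal (\<bar>?U v\<bar> powr p)"
          by (simp add: ennreal_leI flip: ennreal_plus)
        moreover have "ennreal (exp (- \<beta> * (real n + t))) \<le> ennreal (exp (- \<beta> * real n))"
          using True \<beta>0 by (intro ennreal_leI) (simp add: algebra_simps)
        ultimately show ?thesis using True by (simp add: mult_mono)
      qed simp
    qed
    also have "\<dots> = ?c" by (subst nn_integral_cmult_indicator) auto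
    finally show ?thesis .
  qed
  moreover have "(\<lambda>x. ennreal (\<bar>interp ?U x\<bar> powr p)) \<in> borel_measurable XB"
    using interp_measurable[of ?U] by measurable
  ultimately have "(\<integral>\<^sup>+x. ennreal (\<bar>interp ?U x\<bar> powr p) \<partial>mu T \<epsilon> \<beta>) \<le>
      (\<Sum>n. \<Sum>v\<in>level (Suc n). ennreal (exp (- \<beta> * real n)) * (ennreal (\<bar>?U (par v)\<bar> powr p) + ennreal (\<bar>?U v\<bar> powr p)))"
    by (subst nn_integral_mu) (auto intro!: suminf_le sum_mono)
  also have "\<dots> \<le> (\<Sum>n. ennreal (2 * real K * exp (- (\<beta> - ln (real K))) ^ n) * ?J)"
  proof (rule suminf_le)
    fix n
    have "(\<Sum>v\<in>level (Suc n). ennreal (\<bar>?U (par v)\<bar> powr p)) = of_nat K * (\<Sum>v\<in>level n. ennreal (\<bar>?U v\<bar> powr p))"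
    proof -
      have "(\<Sum>w\<in>children T v. ennreal (\<bar>?U (par w)\<bar> powr p)) = of_nat K * ennreal (\<bar>?U v\<bar> powr p)"
        if v: "v \<in> level n" for v
      proof -
        have "(\<Sum>w\<in>children T v. ennreal (\<bar>?U (par w)\<bar> powr p)) = (\<Sum>w\<in>children T v. ennreal (\<bar>?U v\<bar> powr p))"
          using child_iff[OF v] by (intro sum.cong) auto
        then show ?thesis using card_children[OF levelD(1)[OF v]] by simp
      qed
      then show ?thesis unfolding sum_level_Suc sum_distrib_left by (intro sum.cong refl)
    qed
    also have "\<dots> \<le> of_nat K * (ennreal (real K ^ n) * ?J)"
      by (intro mult_left_mono sum_avg_powr u p) auto
    also have "\<dots> = ennreal (real K ^ Suc n) * ?J"
      by (simp add: ennreal_mult mult.assoc ennreal_of_nat_eq_real_of_nat)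
    finally have a: "(\<Sum>v\<in>level (Suc n). ennreal (\<bar>?U (par v)\<bar> powr p)) \<le> ennreal (real K ^ Suc n) * ?J" .
    have "(\<Sum>v\<in>level (Suc n). ennreal (exp (- \<beta> * real n)) * (ennreal (\<bar>?U (par v)\<bar> powr p) + ennreal (\<bar>?U v\<bar> powr p)))
        \<le> ennreal (exp (- \<beta> * real n)) * (ennreal (real K ^ Suc n) * ?J + ennreal (real K ^ Suc n) * ?J)"
      unfolding sum_distrib_left[symmetric] sum.distrib
      by (intro mult_left_mono add_mono a sum_avg_powr u p) auto
    also have "\<dots> = ennreal (exp (- \<beta> * real n) * (real K ^ Suc n + real K ^ Suc n)) * ?J"
    proof -
      have "ennreal (exp (- \<beta> * real n) * (real K ^ Suc n + real K ^ Suc n)) =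
          ennreal (exp (- \<beta> * real n)) * (ennreal (real K ^ Suc n) + ennreal (real K ^ Suc n))"
        by (subst ennreal_mult) (simp_all add: ennreal_plus[symmetric] del: ennreal_plus power_Suc)
      then show ?thesis by (simp only: distrib_right mult.assoc)
    qed
    also have "exp (- \<beta> * real n) * (real K ^ Suc n + real K ^ Suc n) = 2 * real K * exp (- (\<beta> - ln (real K))) ^ n"
    proof -
      have "exp (- (\<beta> - ln (real K))) ^ n = exp (- \<beta> * real n) * exp (real n * ln (real K))"
        by (simp add: mult_exp_exp algebra_simps flip: exp_of_nat_mult)
      also have "exp (real n * ln (real K)) = real K ^ n" using K_pos by (simp add: exp_of_nat_mult)
      finally show ?thesis by simp
    qed
    finally show "(\<Sum>v\<in>level (Suc n). ennreal (exp (- \<beta> * real n)) * (ennreal (\<bar>?U (par v)\<bar> powr p) + ennreal (\<bar>?U v\<bar> powr p)))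
        \<le> ennreal (2 * real K * exp (- (\<beta> - ln (real K))) ^ n) * ?J" .
  qed auto
  also have "\<dots> = (\<Sum>n. ennreal (2 * real K * exp (- (\<beta> - ln (real K))) ^ n)) * ?J" by simp
  also have "(\<Sum>n. ennreal (2 * real K * exp (- (\<beta> - ln (real K))) ^ n)) = ennreal (2 * real K / (1 - exp (- (\<beta> - ln (real K)))))"
  proof (rule suminf_ennreal_eq)
    have "(\<lambda>n. exp (- (\<beta> - ln (real K))) ^ n) sums (1 / (1 - exp (- (\<beta> - ln (real K)))))"
      using \<beta> by (intro geometric_sums) simp
    from sums_mult[OF this, of "2 * real K"]
    show "(\<lambda>n. 2 * real K * exp (- (\<beta> - ln (real K))) ^ n) sums (2 * real K / (1 - exp (- (\<beta> - ln (real K)))))" by simp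
  qed simp
  finally show ?thesis .
qed

lemma interp_linear:
  "(\<And>v. U v = a * U1 v + b * U2 v) \<Longrightarrow> interp U x = a * interp U1 x + b * interp U2 x"
  by (simp add: interp_def algebra_simps)

end

section \<open>The extension operator\<close>

theorem proposition6p4:
  fixes T :: "'v rtree" and K :: nat and \<epsilon> \<beta> p \<theta> :: real
  assumes "2 \<le> K" and "0 < \<epsilon>" and "ln (real K) < \<beta>" and "1 \<le> p"
    and "regular_tree K T"
    and "1 - (\<beta> - ln (real K)) / (p * \<epsilon>) \<le> \<theta>" and "0 < \<theta>"
  shows "\<exists>(Ext :: ((nat \<Rightarrow> 'v) \<Rightarrow> real) \<Rightarrow> 'v point \<Rightarrow> real) (C :: real).
    (\<forall>u\<in>besov_space K T \<epsilon> p \<theta>. Ext u \<in> newton_space T \<epsilon> \<beta> p) \<and>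
    (\<forall>u\<in>besov_space K T \<epsilon> p \<theta>. \<forall>v\<in>besov_space K T \<epsilon> p \<theta>. \<forall>a b. \<forall>x\<in>points T.
        Ext (\<lambda>\<zeta>. a * u \<zeta> + b * v \<zeta>) x = a * Ext u x + b * Ext v x) \<and>
    (\<forall>u\<in>besov_space K T \<epsilon> p \<theta>.
        (AE \<zeta> in nu K T \<epsilon>.
            (\<exists>l. (Ext u \<longlongrightarrow> l) (radial T \<epsilon> \<zeta>)) \<and> boundary_trace T \<epsilon> (Ext u) \<zeta> = u \<zeta>) \<and>
        (AE \<zeta> in nu K T \<epsilon>. \<forall>\<gamma>. geodesic_to T \<epsilon> \<gamma> \<zeta> \<longrightarrow>
            ((\<lambda>t. Ext u (\<gamma> t)) \<longlongrightarrow> u \<zeta>) at_top) \<and>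
        (\<exists>g. minimal_upper_gradient T \<epsilon> \<beta> p (Ext u) g \<and>
            Lp_norm (mu T \<epsilon> \<beta>) p g \<le> ennreal C * besov_seminorm K T \<epsilon> p \<theta> u) \<and>
        newton_norm T \<epsilon> \<beta> p (Ext u) \<le> ennreal C * besov_norm K T \<epsilon> p \<theta> u)"
proof -
  have rt: "rooted_tree T" and reg: "\<And>x. x \<in> verts T \<Longrightarrow> finite (children T x) \<and> card (children T x) = K"
    using assms(5) by (auto simp: regular_tree_def)
  interpret kary_tree T K \<epsilon>
    using rt reg assms(1,2) by unfold_locales auto
  define Ext where "Ext u = interp (avg u)" for u
  define J where "J u = (\<integral>\<^sup>+\<zeta>. ennreal (\<bar>u \<zeta>\<bar> powr p) \<partial>N)" for u :: "(nat \<Rightarrow> 'v) \<Rightarrow> real"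
  define S where "S u = (\<integral>\<^sup>+t\<in>{0<..}. enn_powr (besov_E K T \<epsilon> p u t / ennreal (t powr \<theta>)) p / ennreal t \<partial>lborel)" for u
  obtain \<kappa> where \<kappa>: "0 < \<kappa>" "\<And>u. ennreal \<kappa> * besov_series p \<theta> u \<le> S u"
    using besov_series_le[OF assms(4,7)] unfolding S_def by blast
  define C1 where "C1 = real K * exp (\<epsilon> * p) / \<kappa>"
  define C2 where "C2 = 2 * real K / (1 - exp (- (\<beta> - ln (real K))))"
  define C where "C = (C1 + C2) powr (1 / p)"
  have p: "0 < p" "0 < 1 / p" using assms(4) by auto
  have \<beta>: "0 \<le> \<beta>" using assms(3) ln_gt_zero[OF K_pos(2)] by linarith
  have nonneg: "0 \<le> C1" "0 \<le> C2" using \<kappa>(1) assms(3) by (simp_all add: C1_def C2_def)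
  have \<theta>: "p * \<epsilon> - (\<beta> - ln (real K)) \<le> p * \<epsilon> * \<theta>"
  proof -
    have "p * \<epsilon> * (1 - (\<beta> - ln (real K)) / (p * \<epsilon>)) \<le> p * \<epsilon> * \<theta>"
      using p eps by (intro mult_left_mono assms(6)) auto
    moreover have "p * \<epsilon> * ((\<beta> - ln (real K)) / (p * \<epsilon>)) = \<beta> - ln (real K)" using p eps by simp
    ultimately show ?thesis unfolding right_diff_distrib[of "p * \<epsilon>" 1] by simp
  qed
  have Lp: "Lp_norm N p (\<lambda>\<zeta>. ennreal \<bar>u \<zeta>\<bar>) = enn_powr (J u) (1 / p)" for u
    by (simp add: Lp_norm_def J_def enn_powr_ennreal)
  have semi: "besov_seminorm K T \<epsilon> p \<theta> u = enn_powr (S u) (1 / p)" for u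
    by (simp add: besov_seminorm_def S_def)
  have fin_iff: "enn_powr x (1 / p) < top \<longleftrightarrow> x < top" for x
    by (cases x) (auto simp: enn_powr_ennreal enn_powr_top)
  have besov: "u \<in> borel_measurable N" "set_integrable N (cyl v) u" "J u < \<infinity>" "S u < \<infinity>" "besov_series p \<theta> u < \<infinity>"
    if "u \<in> besov_space K T \<epsilon> p \<theta>" for u v
  proof -
    show u: "u \<in> borel_measurable N" "J u < \<infinity>" "S u < \<infinity>"
      using that by (auto simp: besov_space_def Lp semi fin_iff)
    then show "set_integrable N (cyl v) u" using integrable_if_Lp[of u p v] assms(4) by (simp add: J_def)
    have "ennreal \<kappa> * besov_series p \<theta> u < \<infinity>" using \<kappa>(2)[of u] u(3) by (rule le_less_trans)
    then show "besov_series p \<theta> u < \<infinity>" using \<kappa>(1) by (auto simp: ennreal_mult_less_top)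
  qed
  have energy: "(\<integral>\<^sup>+x. enn_powr (slope (avg u) x) p \<partial>mu T \<epsilon> \<beta>) \<le> ennreal C1 * S u"
    if u: "u \<in> besov_space K T \<epsilon> p \<theta>" for u
  proof -
    have "(\<integral>\<^sup>+x. enn_powr (slope (avg u) x) p \<partial>mu T \<epsilon> \<beta>) \<le> ennreal (real K * exp (\<epsilon> * p)) * besov_series p \<theta> u"
      by (rule slope_energy[OF besov(1,2)[OF u] assms(4) \<beta> \<theta>])
    also have "ennreal (real K * exp (\<epsilon> * p)) = ennreal (C1 * \<kappa>)" using \<kappa>(1) by (simp add: C1_def)
    also have "ennreal (C1 * \<kappa>) * besov_series p \<theta> u = ennreal C1 * (ennreal \<kappa> * besov_series p \<theta> u)"
      using nonneg \<kappa>(1) by (simp add: ennreal_mult mult.assoc)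
    also have "\<dots> \<le> ennreal C1 * S u" by (intro mult_left_mono \<kappa>(2)) simp
    finally show ?thesis .
  qed
  have Lp_Ext: "(\<integral>\<^sup>+x. ennreal (\<bar>Ext u x\<bar> powr p) \<partial>mu T \<epsilon> \<beta>) \<le> ennreal C2 * J u"
    if u: "u \<in> besov_space K T \<epsilon> p \<theta>" for u
    unfolding Ext_def C2_def J_def by (rule interp_Lp[OF besov(1,2)[OF u] assms(4,3)])
  have norm: "newton_norm T \<epsilon> \<beta> p (Ext u) \<le> ennreal C * besov_norm K T \<epsilon> p \<theta> u"
    if u: "u \<in> besov_space K T \<epsilon> p \<theta>" for u
  proof -
    let ?b = "besov_norm K T \<epsilon> p \<theta> u"
    have b: "?b = enn_powr (J u) (1 / p) + enn_powr (S u) (1 / p)" by (simp add: besov_norm_def Lp semi)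
    have "J u = enn_powr (enn_powr (J u) (1 / p)) p" "S u = enn_powr (enn_powr (S u) (1 / p)) p"
      using p by (simp_all add: enn_powr_inverse)
    then have le: "J u \<le> enn_powr ?b p" "S u \<le> enn_powr ?b p"
      unfolding b using p(1) by (metis enn_powr_mono add_increasing2 add_increasing zero_le order_refl)+
    have "(INF g\<in>{g. upper_gradient T \<epsilon> (Ext u) g}. \<integral>\<^sup>+x. enn_powr (g x) p \<partial>mu T \<epsilon> \<beta>)
        \<le> (\<integral>\<^sup>+x. enn_powr (slope (avg u) x) p \<partial>mu T \<epsilon> \<beta>)"
      unfolding Ext_def by (rule INF_lower) (simp add: slope_upper_gradient)
    also have "\<dots> \<le> ennreal C1 * enn_powr ?b p"
      using energy[OF u] le(2) by (meson mult_left_mono order_trans zero_le)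
    finally have "(\<integral>\<^sup>+x. ennreal (\<bar>Ext u x\<bar> powr p) \<partial>mu T \<epsilon> \<beta>) +
        (INF g\<in>{g. upper_gradient T \<epsilon> (Ext u) g}. \<integral>\<^sup>+x. enn_powr (g x) p \<partial>mu T \<epsilon> \<beta>)
        \<le> ennreal C2 * enn_powr ?b p + ennreal C1 * enn_powr ?b p"
      using Lp_Ext[OF u] le(1) by (intro add_mono) (meson mult_left_mono order_trans zero_le)
    also have "\<dots> = ennreal (C1 + C2) * enn_powr ?b p"
      using nonneg by (simp add: ennreal_plus distrib_right add.commute)
    finally have "newton_norm T \<epsilon> \<beta> p (Ext u) \<le> enn_powr (ennreal (C1 + C2) * enn_powr ?b p) (1 / p)"
      unfolding newton_norm_def using p(2) by (intro enn_powr_mono)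
    also have "\<dots> = ennreal C * ?b"
      using p nonneg by (simp add: enn_powr_mult enn_powr_inverse enn_powr_ennreal C_def del: ennreal_plus)
    finally show ?thesis .
  qed
  have slope_norm: "Lp_norm (mu T \<epsilon> \<beta>) p (slope (avg u)) \<le> ennreal C * besov_seminorm K T \<epsilon> p \<theta> u"
    if u: "u \<in> besov_space K T \<epsilon> p \<theta>" for u
  proof -
    have "Lp_norm (mu T \<epsilon> \<beta>) p (slope (avg u)) \<le> enn_powr (ennreal C1 * S u) (1 / p)"
      unfolding Lp_norm_def using energy[OF u] p(2) by (intro enn_powr_mono)
    also have "\<dots> \<le> enn_powr (ennreal (C1 + C2) * S u) (1 / p)"
      using nonneg p(2) by (intro enn_powr_mono mult_right_mono ennreal_leI) auto
    also have "\<dots> = ennreal C * besov_seminorm K T \<epsilon> p \<theta> u"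
      unfolding semi using p nonneg by (simp add: enn_powr_mult enn_powr_ennreal C_def del: ennreal_plus)
    finally show ?thesis .
  qed
  have finite_rhs: "ennreal C * besov_seminorm K T \<epsilon> p \<theta> u < \<infinity>" "ennreal C * besov_norm K T \<epsilon> p \<theta> u < \<infinity>"
    if u: "u \<in> besov_space K T \<epsilon> p \<theta>" for u
    using besov(3,4)[OF u] by (auto simp: semi besov_norm_def Lp fin_iff ennreal_mult_less_top)
  show ?thesis
  proof (intro exI[of _ Ext] exI[of _ C] conjI ballI allI)
    fix u assume u: "u \<in> besov_space K T \<epsilon> p \<theta>"
    show "newton_norm T \<epsilon> \<beta> p (Ext u) \<le> ennreal C * besov_norm K T \<epsilon> p \<theta> u" by (rule norm[OF u])
    then have "newton_norm T \<epsilon> \<beta> p (Ext u) < \<infinity>" using finite_rhs(2)[OF u] by (rule le_less_trans)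
    then show "Ext u \<in> newton_space T \<epsilon> \<beta> p"
      unfolding newton_space_def Ext_def using measurable_mu[OF interp_measurable] by simp
    have lim: "AE \<zeta> in N. (\<lambda>n. avg u (\<zeta> n)) \<longlonglongrightarrow> u \<zeta>"
      by (rule avg_tendsto_AE[OF besov(1,2)[OF u] assms(4,7) besov(5)[OF u]])
    show "AE \<zeta> in N. (\<exists>l. (Ext u \<longlongrightarrow> l) (radial T \<epsilon> \<zeta>)) \<and> boundary_trace T \<epsilon> (Ext u) \<zeta> = u \<zeta>"
      using lim AE_space unfolding Ext_def
      by eventually_elim (auto dest: interp_radial_limit[rotated])
    show "AE \<zeta> in N. \<forall>\<gamma>. geodesic_to T \<epsilon> \<gamma> \<zeta> \<longrightarrow> ((\<lambda>t. Ext u (\<gamma> t)) \<longlongrightarrow> u \<zeta>) at_top"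
      using lim AE_space unfolding Ext_def
      by eventually_elim (auto dest: interp_geodesic_limit[rotated])
    have "minimal_upper_gradient T \<epsilon> \<beta> p (Ext u) (slope (avg u))"
      unfolding minimal_upper_gradient_def Ext_def
    proof (intro conjI allI impI)
      show "Lp_norm (mu T \<epsilon> \<beta>) p (slope (avg u)) < \<infinity>"
        using slope_norm[OF u] finite_rhs(1)[OF u] by (rule le_less_trans)
      fix g assume g: "upper_gradient T \<epsilon> (interp (avg u)) g \<and> Lp_norm (mu T \<epsilon> \<beta>) p g < \<infinity>"
      then have "(\<integral>\<^sup>+x. enn_powr (g x) p \<partial>mu T \<epsilon> \<beta>) < \<infinity>" by (simp add: Lp_norm_def fin_iff)
      then show "AE x in mu T \<epsilon> \<beta>. slope (avg u) x \<le> g x"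
        using g slope_minimal[of "avg u" g \<beta> p] assms(4) \<beta> by blast
    qed (rule slope_upper_gradient)
    then show "\<exists>g. minimal_upper_gradient T \<epsilon> \<beta> p (Ext u) g \<and>
        Lp_norm (mu T \<epsilon> \<beta>) p g \<le> ennreal C * besov_seminorm K T \<epsilon> p \<theta> u"
      using slope_norm[OF u] by blast
  next
    fix u v a b x
    assume u: "u \<in> besov_space K T \<epsilon> p \<theta>" and v: "v \<in> besov_space K T \<epsilon> p \<theta>"
    show "Ext (\<lambda>\<zeta>. a * u \<zeta> + b * v \<zeta>) x = a * Ext u x + b * Ext v x"
      unfolding Ext_def by (rule interp_linear) (rule avg_linear[OF besov(2)[OF u] besov(2)[OF v]])
  qed
qed

end
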